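(* Let $\Delta$ be a simplicial complex on vertex set $[n]$. If its Alexander dual $\Delta^\vee$ is sequentially Cohen–Macaulay over some field $\mathbb K$, then $\Delta$ is geochordal.
   Context: Simplicial complexes are finite and not necessarily pure. The Alexander dual of $\Delta$ on vertex set $[n]$ is $\Delta^\vee=\{F\subseteq[n] : [n]\setminus F\notin\Delta\}$. Sequential Cohen–Macaulayness over $\mathbb K$ is Stanley's standard notion for simplicial complexes (by Duval, it amounts to every pure $t$-skeleton, i.e. the subcomplex generated by all $t$-dimensional faces, being Cohen–Macaulay over $\mathbb K$). A $d$-dimensional complex $\Delta$ is geometrically-$k$-chordal, for $k\in\{1,\dots,d\}$, if every induced subcomplex of $\Delta$ that is homeomorphic to the boundary of the $(k+1)$-simplex is combinatorially equivalent to the boundary of the $(k+1)$-simplex. $\Delta$ is geochordal if it is geometrically-$k$-chordal for all $k=1,\dots,d$. *)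

theory Defs
  imports
    "HOL-Analysis.Analysis"
    "HOL-Algebra.Ideal"
    "HOL-Library.Poly_Mapping"
    "HOL-Library.Extended_Nat"
begin

section \<open>Abstract simplicial complexes on the vertex set $\{1,\dots,n\}$\<close>

text \<open>
  A complex is given by its set of faces. Neither the void complex (no face at all) nor elements
  of $\{1,\dots,n\}$ that are not vertices are excluded; both arise as soon as Alexander duals
  are formed.
\<close>

definition simplicial_complex_on :: "nat \<Rightarrow> nat set set \<Rightarrow> bool" where
  "simplicial_complex_on n \<Delta> \<longleftrightarrow>
     \<Delta> \<subseteq> Pow {1..n} \<and> (\<forall>F\<in>\<Delta>. \<forall>G. G \<subseteq> F \<longrightarrow> G \<in> \<Delta>)"

text \<open>For the void complex the supremum below is \<open>0\<close>, so its dimension is \<open>-1\<close>.\<close>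

definition complex_dim :: "nat set set \<Rightarrow> int" where
  "complex_dim \<Delta> = int (Sup (card ` \<Delta>)) - 1"

definition alexander_dual :: "nat \<Rightarrow> nat set set \<Rightarrow> nat set set" where
  "alexander_dual n \<Delta> = {F. F \<subseteq> {1..n} \<and> {1..n} - F \<notin> \<Delta>}"

definition induced_subcomplex :: "nat set set \<Rightarrow> nat set \<Rightarrow> nat set set" where
  "induced_subcomplex \<Delta> W = {F \<in> \<Delta>. F \<subseteq> W}"

text \<open>The simplex of dimension \<open>d\<close> has the \<open>d + 1\<close> vertices \<open>0, \<dots>, d\<close>.\<close>

definition boundary_simplex :: "nat \<Rightarrow> nat set set" where
  "boundary_simplex d = {F. F \<subset> {0..d}}"

definition combinatorially_equivalent :: "nat set set \<Rightarrow> nat set set \<Rightarrow> bool" where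
  "combinatorially_equivalent \<Gamma> \<Gamma>' \<longleftrightarrow>
     (\<exists>f. bij_betw f (\<Union>\<Gamma>) (\<Union>\<Gamma>') \<and> (\<lambda>F. f ` F) ` \<Gamma> = \<Gamma>')"

text \<open>
  Points of the geometric realization are given by their barycentric coordinates. For finite
  complexes the product topology induces the usual topology.
\<close>

definition geometric_realization :: "nat set set \<Rightarrow> (nat \<Rightarrow> real) topology" where
  "geometric_realization \<Delta> =
     subtopology (powertop_real UNIV)
       {x. (\<forall>i. 0 \<le> x i) \<and> (\<exists>F\<in>\<Delta>. (\<forall>i. i \<notin> F \<longrightarrow> x i = 0) \<and> (\<Sum>i\<in>F. x i) = 1)}"

definition geometrically_chordal :: "nat \<Rightarrow> nat set set \<Rightarrow> bool" where
  "geometrically_chordal k \<Delta> \<longleftrightarrow>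
     (\<forall>W. geometric_realization (induced_subcomplex \<Delta> W) homeomorphic_space
            geometric_realization (boundary_simplex (k + 1))
          \<longrightarrow> combinatorially_equivalent (induced_subcomplex \<Delta> W) (boundary_simplex (k + 1)))"

definition geochordal :: "nat set set \<Rightarrow> bool" where
  "geochordal \<Delta> \<longleftrightarrow> (\<forall>k. 1 \<le> k \<and> int k \<le> complex_dim \<Delta> \<longrightarrow> geometrically_chordal k \<Delta>)"


section \<open>The polynomial ring $S = K[x_1,\dots,x_n]$\<close>

type_synonym 'k mpoly = "(nat \<Rightarrow>\<^sub>0 nat) \<Rightarrow>\<^sub>0 'k"

definition poly_ring :: "nat \<Rightarrow> ('k::field mpoly) ring" where
  "poly_ring n =
     \<lparr>carrier = {p. \<forall>m\<in>Poly_Mapping.keys p. Poly_Mapping.keys m \<subseteq> {1..n}},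
      monoid.mult = (*), one = 1, zero = 0, add = (+)\<rparr>"

definition monom_degree :: "(nat \<Rightarrow>\<^sub>0 nat) \<Rightarrow> nat" where
  "monom_degree m = (\<Sum>i\<in>Poly_Mapping.keys m. Poly_Mapping.lookup m i)"

definition homogeneous_of_degree :: "nat \<Rightarrow> 'k::field mpoly \<Rightarrow> bool" where
  "homogeneous_of_degree d p \<longleftrightarrow> (\<forall>m\<in>Poly_Mapping.keys p. monom_degree m = d)"

definition homogeneous_component :: "nat \<Rightarrow> 'k::field mpoly \<Rightarrow> 'k mpoly" where
  "homogeneous_component d p =
     (\<Sum>m\<in>{m \<in> Poly_Mapping.keys p. monom_degree m = d}.
        Poly_Mapping.single m (Poly_Mapping.lookup p m))"

definition graded_ideal :: "nat \<Rightarrow> 'k::field mpoly set \<Rightarrow> bool" where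
  "graded_ideal n J \<longleftrightarrow>
     ideal J (poly_ring n) \<and> (\<forall>p\<in>J. \<forall>d. homogeneous_component d p \<in> J)"

definition squarefree_monomial :: "nat set \<Rightarrow> 'k::field mpoly" where
  "squarefree_monomial F =
     Poly_Mapping.single (\<Sum>i\<in>F. Poly_Mapping.single i 1) 1"

definition stanley_reisner_ideal :: "nat \<Rightarrow> nat set set \<Rightarrow> 'k::field mpoly set" where
  "stanley_reisner_ideal n \<Delta> =
     genideal (poly_ring n) (squarefree_monomial ` {F. F \<subseteq> {1..n} \<and> F \<notin> \<Delta>})"


section \<open>Cohen-Macaulay and sequentially Cohen-Macaulay modules\<close>

text \<open>
  A graded submodule of \<open>S/I\<close> is \<open>J/I\<close> for a unique graded ideal \<open>J\<close> containing \<open>I\<close>, and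
  \<open>(J'/I)/(J/I)\<close> is \<open>J'/J\<close>. Hence all modules needed are of the form \<open>J/I\<close> with ideals
  \<open>I \<subseteq> J\<close> of \<open>S\<close>; such a module is represented by the pair \<open>I\<close>, \<open>J\<close>.
\<close>

definition annihilator :: "nat \<Rightarrow> 'k::field mpoly set \<Rightarrow> 'k mpoly set \<Rightarrow> 'k mpoly set" where
  "annihilator n I J = {f \<in> carrier (poly_ring n). \<forall>g\<in>J. f * g \<in> I}"

text \<open>
  The dimension of \<open>J/I\<close> is the Krull dimension of \<open>S\<close> modulo the annihilator of \<open>J/I\<close>.
\<close>

definition module_dim :: "nat \<Rightarrow> 'k::field mpoly set \<Rightarrow> 'k mpoly set \<Rightarrow> enat" where
  "module_dim n I J =
     Sup {enat l | l. \<exists>P. (\<forall>i\<le>l. primeideal (P i) (poly_ring n) \<and> annihilator n I J \<subseteq> P i) \<and>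
                          (\<forall>i<l. P i \<subset> P (Suc i))}"

text \<open>
  With \<open>M = J/I\<close>, the ideal \<open>I + (fs)J\<close> is the preimage in \<open>J\<close> of the submodule \<open>(fs)M\<close>.
\<close>

definition plus_multiples ::
  "nat \<Rightarrow> 'k::field mpoly set \<Rightarrow> 'k mpoly set \<Rightarrow> 'k mpoly list \<Rightarrow> 'k mpoly set" where
  "plus_multiples n I J fs = genideal (poly_ring n) (I \<union> {f * g | f g. f \<in> set fs \<and> g \<in> J})"

definition regular_sequence ::
  "nat \<Rightarrow> 'k::field mpoly set \<Rightarrow> 'k mpoly set \<Rightarrow> 'k mpoly list \<Rightarrow> bool" where
  "regular_sequence n I J fs \<longleftrightarrow>
     (\<forall>f\<in>set fs. f \<in> carrier (poly_ring n) \<and> (\<exists>d>0. homogeneous_of_degree d f)) \<and>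
     (\<forall>i<length fs. \<forall>g\<in>J. fs ! i * g \<in> plus_multiples n I J (take i fs)
                            \<longrightarrow> g \<in> plus_multiples n I J (take i fs)) \<and>
     plus_multiples n I J fs \<noteq> J"

definition module_depth :: "nat \<Rightarrow> 'k::field mpoly set \<Rightarrow> 'k mpoly set \<Rightarrow> enat" where
  "module_depth n I J = Sup {enat (length fs) | fs. regular_sequence n I J fs}"

definition Cohen_Macaulay_module :: "nat \<Rightarrow> 'k::field mpoly set \<Rightarrow> 'k mpoly set \<Rightarrow> bool" where
  "Cohen_Macaulay_module n I J \<longleftrightarrow> module_depth n I J = module_dim n I J"

text \<open>
  Stanley's definition: \<open>J/I\<close> has a finite filtration by graded submodules whose successive
  quotients are nonzero Cohen-Macaulay modules of strictly increasing dimension. For \<open>r = 0\<close>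
  this includes the zero module.
\<close>

definition sequentially_Cohen_Macaulay_module ::
  "nat \<Rightarrow> 'k::field mpoly set \<Rightarrow> 'k mpoly set \<Rightarrow> bool" where
  "sequentially_Cohen_Macaulay_module n I J \<longleftrightarrow>
     (\<exists>r M. M 0 = I \<and> M r = J \<and>
        (\<forall>i\<le>r. graded_ideal n (M i)) \<and>
        (\<forall>i<r. M i \<subset> M (Suc i) \<and> Cohen_Macaulay_module n (M i) (M (Suc i))) \<and>
        (\<forall>i. Suc i < r \<longrightarrow>
           module_dim n (M i) (M (Suc i)) < module_dim n (M (Suc i)) (M (Suc (Suc i)))))"

text \<open>
  A complex is sequentially Cohen-Macaulay over \<open>K\<close> if its Stanley-Reisner ring is so.
\<close>

definition sequentially_Cohen_Macaulay :: "'k::field itself \<Rightarrow> nat \<Rightarrow> nat set set \<Rightarrow> bool" where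
  "sequentially_Cohen_Macaulay K n \<Delta> \<longleftrightarrow>
     sequentially_Cohen_Macaulay_module n
       (stanley_reisner_ideal n \<Delta> :: 'k mpoly set) (carrier (poly_ring n))"

end

theory Submission
  imports Defs "HOL-Homology.Homology"
begin

text \<open>
  Let the induced subcomplex \<open>\<Sigma>\<close> of \<open>\<Delta>\<close> on \<open>W\<close> be a \<open>k\<close>-sphere. By invariance of domain
  \<open>\<Sigma>\<close> has dimension at most \<open>k\<close>, and if it contains the boundary of a \<open>(k + 1)\<close>-simplex it is equal to it.
  Otherwise all minimal nonfaces of \<open>\<Sigma>\<close> have at most \<open>k + 1\<close> elements, so all faces of the dual \<open>\<Delta>\<^sup>\<or>\<close>
  containing \<open>{1..n} - W\<close> lie in faces with at least \<open>e = n - k - 1\<close> elements. In the given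
  filtration of the Stanley-Reisner ring, the ideals below the layers of dimension at least \<open>e\<close> are
  contained in the prime ideals of the latter faces, and these layers have depth at least \<open>e\<close>. So there is
  an ideal \<open>J\<close> above the Stanley-Reisner ideal, equal to it after inverting the variables outside \<open>W\<close>,
  such that the Koszul homology of \<open>S/J\<close> with respect to
  powers of the variables vanishes in degree \<open>k + 2\<close>. By the combinatorial form of Alexander duality,
  a nonzero simplicial \<open>k\<close>-cycle of \<open>\<Sigma>\<close> over \<open>K\<close> would give a nonzero class in that homology.

  But such a cycle exists. It is enough to find an integral one. A singular \<open>k\<close>-cycle with small simplices
  is homotopic to the affine chain obtained by moving the corner of every simplex to a vertex with large
  barycentric coordinate; after one barycentric subdivision the latter only depends on the associated
  simplicial cycle. If this were always zero, the \<open>k\<close>-th singular homology of the sphere would vanish.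
\<close>

section \<open>The Koszul complex\<close>

text \<open>One complex serves both halves: with all \<open>X v = 1\<close> the Koszul complex is
  the augmented chain complex of a full simplex, and with powers of the variables it measures depth.
  Alexander duality thereby becomes a computation with a single chain. The dual of the subcomplex on
  W is the link of \<open>{1..n} - W\<close> in the dual complex, and passing to a link means
  inverting the variables outside W. Exponents imitate this: a variable that enters the Koszul
  complex as a square cannot contribute in a squarefree multidegree. The degree k + 2 arises because
  the cone over a k-cycle is carried by sets with k + 2 elements, while depth at least n - k - 1
  makes Koszul homology vanish in all degrees above k + 1. As the sphere has no faces with more than
  k + 1 vertices, a simplicial homology class in degree k is the same as a cycle, so the topological
  half only has to produce a nonzero cycle. It yields one with integer coefficients, whereas the
  field has arbitrary characteristic; dividing by the characteristic as long as possible makes the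
  cycle survive reduction.\<close>

definition ksgn :: "nat \<Rightarrow> nat set \<Rightarrow> 'a::comm_ring_1" where
  "ksgn v A = (-1) ^ card {u \<in> A. u < v}"

text \<open>A chain, the sum of the c_A e_A in an exterior algebra, is stored as its coefficient
  function on sets, so the boundary collects at A what comes from sets with one more element. Chains
  of all degrees share one type; degrees enter only as conditions on \<open>card\<close>.\<close>

definition koszul_boundary ::
  "nat \<Rightarrow> (nat \<Rightarrow> 'a::comm_ring_1) \<Rightarrow> (nat set \<Rightarrow> 'a) \<Rightarrow> nat set \<Rightarrow> 'a" where
  "koszul_boundary n X c A = (\<Sum>v\<in>{1..n} - A. ksgn v (insert v A) * X v * c (insert v A))"

definition koszul_wedge :: "nat \<Rightarrow> (nat set \<Rightarrow> 'a::comm_ring_1) \<Rightarrow> nat set \<Rightarrow> 'a" where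
  "koszul_wedge v c A = (if v \<in> A then ksgn v A * c (A - {v}) else 0)"

lemma ksgn_sq [simp]: "ksgn v A * ksgn v A = (1::'a::comm_ring_1)"
  by (simp add: ksgn_def flip: power_add)

lemma ksgn_insert_self: "ksgn v (insert v A) = ksgn v A"
proof -
  have "{u \<in> insert v A. u < v} = {u \<in> A. u < v}" by auto
  then show ?thesis by (simp add: ksgn_def)
qed

lemma ksgn_insert:
  assumes "finite A" "u \<notin> A"
  shows "ksgn v (insert u A) = (if u < v then - ksgn v A else ksgn v A)"
proof -
  have "{w \<in> insert u A. w < v} = (if u < v then insert u {w \<in> A. w < v} else {w \<in> A. w < v})"
    by auto
  then show ?thesis using assms by (simp add: ksgn_def)
qed

lemma ksgn_swap:
  assumes "finite A" "u \<notin> A" "v \<notin> A" "u \<noteq> v"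
  shows "ksgn u (insert v A) * ksgn v A = - (ksgn v (insert u A) * ksgn u A :: 'a::comm_ring_1)"
proof -
  have "u < v \<and> \<not> v < u \<or> v < u \<and> \<not> u < v" using assms(4) by auto
  then show ?thesis unfolding ksgn_insert[OF assms(1,2)] ksgn_insert[OF assms(1,3)]
    by (auto simp: mult.commute)
qed

lemma koszul_boundary_cong:
  "(\<And>v. v \<in> {1..n} - A \<Longrightarrow> c (insert v A) = c' (insert v A)) \<Longrightarrow>
     koszul_boundary n X c A = koszul_boundary n X c' A"
  by (simp add: koszul_boundary_def)

lemma koszul_boundary_add:
  "koszul_boundary n X (\<lambda>A. b A + c A) A = koszul_boundary n X b A + koszul_boundary n X c A"
  by (simp add: koszul_boundary_def algebra_simps sum.distrib)

lemma koszul_boundary_diff: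
  "koszul_boundary n X (\<lambda>A. b A - c A) A = koszul_boundary n X b A - koszul_boundary n X c A"
  by (simp add: koszul_boundary_def algebra_simps sum_subtractf)

lemma koszul_boundary_mult:
  "koszul_boundary n X (\<lambda>A. p * c A) A = p * koszul_boundary n X c A"
  by (simp add: koszul_boundary_def sum_distrib_left mult_ac)

lemma koszul_boundary_sum:
  "koszul_boundary n X (\<lambda>A. \<Sum>i\<in>I. f i A) A = (\<Sum>i\<in>I. koszul_boundary n X (f i) A)"
  unfolding koszul_boundary_def by (subst sum.swap) (simp add: sum_distrib_left)

lemma koszul_boundary_zero [simp]: "koszul_boundary n X (\<lambda>A. 0) A = 0"
  by (simp add: koszul_boundary_def)

text \<open>Removing u before v and removing v before u contribute the same term with opposite
  signs.\<close>

lemma koszul_boundary_boundary: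
  assumes "finite A"
  shows "koszul_boundary n X (koszul_boundary n X c) A = (0::'a::comm_ring_1)"
proof -
  let ?V = "{1..n} - A"
  define f where "f u v = ksgn u A * X u * (ksgn v (insert u A) * X v * c (insert u (insert v A)))"
    for u v
  have "koszul_boundary n X (koszul_boundary n X c) A
      = (\<Sum>u\<in>?V. \<Sum>v\<in>?V - {u}. f u v)"
    unfolding koszul_boundary_def f_def sum_distrib_left
  proof (intro sum.cong refl)
    fix u v
    show "ksgn u (insert u A) * X u * (ksgn v (insert v (insert u A)) * X v
        * c (insert v (insert u A)))
      = ksgn u A * X u * (ksgn v (insert u A) * X v * c (insert u (insert v A)))"
      by (simp only: ksgn_insert_self[of u A] ksgn_insert_self[of v "insert u A"] insert_commute[of u v])
  qed auto
  also have "\<dots> = (\<Sum>(u,v)\<in>{(u,v). u \<in> ?V \<and> v \<in> ?V \<and> u \<noteq> v}. f u v)"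
    by (subst sum.Sigma) (auto intro!: sum.cong)
  also have "{(u,v). u \<in> ?V \<and> v \<in> ?V \<and> u \<noteq> v}
      = {(u,v). u \<in> ?V \<and> v \<in> ?V \<and> u < v} \<union> (\<lambda>(u,v). (v,u)) ` {(u,v). u \<in> ?V \<and> v \<in> ?V \<and> u < v}"
    (is "_ = ?S \<union> _") by (auto simp: image_iff)
  also have "(\<Sum>(u,v)\<in>?S \<union> (\<lambda>(u,v). (v,u)) ` ?S. f u v)
      = (\<Sum>(u,v)\<in>?S. f u v) + (\<Sum>(u,v)\<in>(\<lambda>(u,v). (v,u)) ` ?S. f u v)"
    by (rule sum.union_disjoint) (auto intro: finite_subset[of _ "{1..n} \<times> {1..n}"])
  also have "(\<Sum>(u,v)\<in>(\<lambda>(u,v). (v,u)) ` ?S. f u v) = (\<Sum>(u,v)\<in>?S. f v u)"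
    by (subst sum.reindex) (auto simp: inj_on_def intro!: sum.cong)
  also have "(\<Sum>(u,v)\<in>?S. f u v) + (\<Sum>(u,v)\<in>?S. f v u) = (\<Sum>(u,v)\<in>?S. f u v + f v u)"
    by (simp add: sum.distrib case_prod_beta)
  also have "\<dots> = 0"
  proof (rule sum.neutral, clarsimp)
    fix u v assume "u \<notin> A" "v \<notin> A" "u < v"
    then have "ksgn v (insert u A) * ksgn u A + ksgn u (insert v A) * ksgn v A = (0::'a)"
      using ksgn_swap[of A u v, where 'a = 'a] assms by (simp only: simp_thms) simp
    moreover have "f u v + f v u = (ksgn v (insert u A) * ksgn u A + ksgn u (insert v A) * ksgn v A)
        * (X u * X v * c (insert u (insert v A)))"
      unfolding f_def insert_commute[of v u A] by (simp only: distrib_left distrib_right mult_ac)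
    ultimately show "f u v + f v u = 0" by simp
  qed
  finally show ?thesis .
qed

text \<open>This is the Leibniz rule for wedging with e_v. For variables it makes \<open>X v\<close>
  act as zero on Koszul homology; for \<open>X v = 1\<close> it is the cone with apex v, which turns
  a cycle into a boundary.\<close>

lemma koszul_boundary_wedge:
  assumes "v \<in> {1..n}" "finite A"
  shows "koszul_boundary n X (koszul_wedge v c) A + koszul_wedge v (koszul_boundary n X c) A
    = X v * (c A :: 'a::comm_ring_1)"
proof (cases "v \<in> A")
  case False
  have "koszul_boundary n X (koszul_wedge v c) A
      = (\<Sum>u\<in>{1..n} - A. if u = v then X v * c A else 0)"
    unfolding koszul_boundary_def
  proof (intro sum.cong refl)
    fix u assume "u \<in> {1..n} - A"
    then show "ksgn u (insert u A) * X u * koszul_wedge v c (insert u A)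
        = (if u = v then X v * c A else 0)"
      using False by (auto simp: koszul_wedge_def mult_ac simp flip: mult.assoc)
  qed
  also have "\<dots> = X v * c A" using assms False by simp
  finally show ?thesis using False by (simp add: koszul_wedge_def)
next
  case True
  \<comment> \<open>At B the term of the boundary removing v yields \<open>X v * c A\<close>; all
    other terms cancel because e_u and e_v anticommute.\<close>
  define B where "B = A - {v}"
  have A: "A = insert v B" "v \<notin> B" and "finite B" using True assms by (auto simp: B_def)
  have V: "{1..n} - B = insert v ({1..n} - A)" using True assms by (auto simp: B_def)
  have "koszul_boundary n X c B
      = (\<Sum>u\<in>insert v ({1..n} - A). ksgn u (insert u B) * X u * c (insert u B))"
    unfolding koszul_boundary_def V ..
  also have "\<dots> = ksgn v A * X v * c A
      + (\<Sum>u\<in>{1..n} - A. ksgn u (insert u B) * X u * c (insert u B))"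
    using True by (subst sum.insert) (auto simp flip: A(1))
  finally have "ksgn v A * koszul_boundary n X c B = (ksgn v A * ksgn v A) * X v * c A
      + (\<Sum>u\<in>{1..n} - A. ksgn v A * (ksgn u (insert u B) * X u * c (insert u B)))"
    by (simp only: distrib_left sum_distrib_left mult.assoc)
  then have "koszul_wedge v (koszul_boundary n X c) A = X v * c A
      + (\<Sum>u\<in>{1..n} - A. ksgn v A * (ksgn u (insert u B) * X u * c (insert u B)))"
    using True by (simp add: koszul_wedge_def flip: B_def)
  also have "(\<Sum>u\<in>{1..n} - A. ksgn v A * (ksgn u (insert u B) * X u * c (insert u B)))
      = (\<Sum>u\<in>{1..n} - A. - (ksgn u (insert u A) * X u * koszul_wedge v c (insert u A)))"
  proof (rule sum.cong[OF refl])
    fix u assume "u \<in> {1..n} - A"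
    then have u: "u \<notin> B" "u \<noteq> v" using A by auto
    have "ksgn u (insert v B) * ksgn v B = - (ksgn v (insert u B) * ksgn u B :: 'a)"
      using ksgn_swap[of B u v] u A \<open>finite B\<close> by simp
    moreover have "ksgn v (insert u (insert v B)) = (ksgn v (insert u B) :: 'a)"
      using ksgn_insert_self[of v "insert u B"] by (simp only: insert_commute[of u v])
    moreover have "insert u A - {v} = insert u B" using u A by auto
    ultimately have *: "ksgn u (insert u A) = (ksgn u (insert v B)::'a)"
      "koszul_wedge v c (insert u A) = ksgn v (insert u B) * c (insert u B)"
      using True A(1) by (auto simp: koszul_wedge_def ksgn_insert_self)
    have "ksgn v B * ksgn u B = - (ksgn u (insert v B) * ksgn v (insert u B) :: 'a)"
    proof -
      have "u < v \<and> \<not> v < u \<or> v < u \<and> \<not> u < v" using u by auto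
      then show ?thesis
        unfolding ksgn_insert[OF \<open>finite B\<close> u(1)] ksgn_insert[OF \<open>finite B\<close> A(2)]
        by (auto simp: mult.commute)
    qed
    then have "ksgn v B * ksgn u B * (X u * c (insert u B))
      = - (ksgn u (insert v B) * ksgn v (insert u B)) * (X u * c (insert u B))" by simp
    then show "ksgn v A * (ksgn u (insert u B) * X u * c (insert u B))
        = - (ksgn u (insert u A) * X u * koszul_wedge v c (insert u A))"
      unfolding * unfolding A(1) ksgn_insert_self by (simp add: mult_ac)
  qed
  also have "\<dots> = - koszul_boundary n X (koszul_wedge v c) A"
    by (simp add: sum_negf koszul_boundary_def)
  finally show ?thesis by simp
qed

lemma koszul_wedge_swap:
  assumes "finite A"
  shows "koszul_wedge u (koszul_wedge v c) A = - (koszul_wedge v (koszul_wedge u c) A :: 'a::comm_ring_1)"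
proof (cases "u \<in> A \<and> v \<in> A \<and> u \<noteq> v")
  case True
  define B where "B = A - {u} - {v}"
  have A: "A = insert u (insert v B)" "u \<notin> B" "v \<notin> B" "u \<noteq> v" "finite B"
    using True assms by (auto simp: B_def)
  have D: "insert u (insert v B) - {u} = insert v B" "insert u (insert v B) - {v} = insert u B"
    "insert v B - {v} = B" "insert u B - {u} = B"
    using A by auto
  have "ksgn u (insert u (insert v B)) * ksgn v (insert v B)
    = - (ksgn v (insert u (insert v B)) * ksgn u (insert u B) :: 'a)"
  proof -
    have "ksgn v (insert u (insert v B)) = (ksgn v (insert u B) :: 'a)"
      using ksgn_insert_self[of v "insert u B"] by (simp only: insert_commute[of u v])
    then show ?thesis
      using ksgn_swap[of B u v, where 'a = 'a] A by (simp only: ksgn_insert_self simp_thms)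
  qed
  then have "ksgn u (insert u (insert v B)) * ksgn v (insert v B) * c B
    = - (ksgn v (insert u (insert v B)) * ksgn u (insert u B)) * c B" by simp
  then show ?thesis
    unfolding koszul_wedge_def A(1) D using A by (simp add: mult.assoc)
next
  case False
  then show ?thesis by (cases "u = v") (auto simp: koszul_wedge_def)
qed

section \<open>Koszul homology of graded modules over the polynomial ring\<close>

lemma carrier_poly_ring:
  "p \<in> carrier (poly_ring n) \<longleftrightarrow> (\<forall>m\<in>Poly_Mapping.keys p. Poly_Mapping.keys m \<subseteq> {1..n})"
  by (simp add: poly_ring_def)

lemma poly_ring_simps [simp]:
  "x \<otimes>\<^bsub>poly_ring n\<^esub> y = x * y" "x \<oplus>\<^bsub>poly_ring n\<^esub> y = x + y"
  "\<one>\<^bsub>poly_ring n\<^esub> = 1" "\<zero>\<^bsub>poly_ring n\<^esub> = 0"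
  by (simp_all add: poly_ring_def)

lemma keys_add_nat:
  "Poly_Mapping.keys (a + b :: nat \<Rightarrow>\<^sub>0 nat) = Poly_Mapping.keys a \<union> Poly_Mapping.keys b"
  by (auto simp: in_keys_iff lookup_add)

lemma poly_ring_closed:
  "(0::'k::field mpoly) \<in> carrier (poly_ring n)" "(1::'k mpoly) \<in> carrier (poly_ring n)"
  "p \<in> carrier (poly_ring n) \<Longrightarrow> (q::'k mpoly) \<in> carrier (poly_ring n) \<Longrightarrow> p + q \<in> carrier (poly_ring n)"
  "p \<in> carrier (poly_ring n) \<Longrightarrow> q \<in> carrier (poly_ring n) \<Longrightarrow> p * q \<in> carrier (poly_ring n)"
  "p \<in> carrier (poly_ring n) \<Longrightarrow> - p \<in> carrier (poly_ring n)"
proof -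
  show "p + q \<in> carrier (poly_ring n)" if "p \<in> carrier (poly_ring n)" "q \<in> carrier (poly_ring n)"
    using that keys_add[of p q] by (auto simp: carrier_poly_ring)
  show "p * q \<in> carrier (poly_ring n)" if "p \<in> carrier (poly_ring n)" "q \<in> carrier (poly_ring n)"
    using that keys_mult[of p q] unfolding carrier_poly_ring by (fastforce simp: keys_add_nat)
  show "- p \<in> carrier (poly_ring n)" if "p \<in> carrier (poly_ring n)"
    using that by (auto simp: carrier_poly_ring in_keys_iff)
qed (auto simp: carrier_poly_ring)

lemma single_in_carrier:
  "Poly_Mapping.keys m \<subseteq> {1..n} \<Longrightarrow> Poly_Mapping.single m a \<in> carrier (poly_ring n)"
  by (auto simp: carrier_poly_ring)

lemma cring_poly_ring: "cring (poly_ring n :: 'k::field mpoly ring)"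
proof (rule cringI)
  show "abelian_group (poly_ring n :: 'k mpoly ring)"
  proof (rule abelian_groupI)
    fix x :: "'k mpoly" assume "x \<in> carrier (poly_ring n)"
    then show "\<exists>y\<in>carrier (poly_ring n). y \<oplus>\<^bsub>poly_ring n\<^esub> x = \<zero>\<^bsub>poly_ring n\<^esub>"
      by (intro bexI[of _ "- x"]) (auto simp: poly_ring_closed)
  qed (auto simp: poly_ring_closed algebra_simps)
  show "Group.comm_monoid (poly_ring n :: 'k mpoly ring)"
    by (rule comm_monoidI) (auto simp: poly_ring_closed algebra_simps)
qed (auto simp: algebra_simps)

lemma ring_poly_ring: "ring (poly_ring n :: 'k::field mpoly ring)"
  using cring_poly_ring by (rule cring.axioms)

text \<open>Negatives are multiples by -1, so closure under sums and under multiplication by ring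
  elements suffices.\<close>

lemma ideal_poly_ring_iff:
  "ideal I (poly_ring n) \<longleftrightarrow>
     I \<subseteq> carrier (poly_ring n) \<and> (0::'k::field mpoly) \<in> I \<and> (\<forall>a\<in>I. \<forall>b\<in>I. a + b \<in> I) \<and>
     (\<forall>r\<in>carrier (poly_ring n). \<forall>a\<in>I. r * a \<in> I)" (is "_ \<longleftrightarrow> ?R")
proof
  assume "ideal I (poly_ring n)"
  then interpret ideal I "poly_ring n" .
  show ?R
    using a_subset additive_subgroup.zero_closed[OF is_additive_subgroup]
      additive_subgroup.a_closed[OF is_additive_subgroup] I_l_closed by auto
next
  assume R: ?R
  interpret ring "poly_ring n :: 'k mpoly ring" by (rule ring_poly_ring)
  show "ideal I (poly_ring n)"
  proof (rule idealI[OF ring_poly_ring])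
    show "subgroup I (add_monoid (poly_ring n))"
    proof
      fix x assume x: "x \<in> I"
      have "- 1 * x \<in> I" using R x poly_ring_closed(5)[OF poly_ring_closed(2)] by blast
      then have "- x \<in> I" by simp
      moreover have "\<ominus>\<^bsub>poly_ring n\<^esub> x = - x"
        by (rule minus_equality) (use R x in \<open>auto simp: poly_ring_closed\<close>)
      ultimately show "inv\<^bsub>add_monoid (poly_ring n)\<^esub> x \<in> I" by (simp add: a_inv_def)
    qed (use R in auto)
 next
    fix a x :: "'k mpoly" assume ax: "a \<in> I" "x \<in> carrier (poly_ring n)"
    then have "x * a \<in> I" using R by blast
    then show "x \<otimes>\<^bsub>poly_ring n\<^esub> a \<in> I" "a \<otimes>\<^bsub>poly_ring n\<^esub> x \<in> I"
      by (simp_all add: mult.commute[of a])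
  qed
qed

lemma ideal_poly_ringD:
  fixes I :: "'k::field mpoly set"
  assumes "ideal I (poly_ring n)"
  shows "I \<subseteq> carrier (poly_ring n)" "0 \<in> I" "a \<in> I \<Longrightarrow> b \<in> I \<Longrightarrow> a + b \<in> I"
    "r \<in> carrier (poly_ring n) \<Longrightarrow> a \<in> I \<Longrightarrow> r * a \<in> I"
    "a \<in> I \<Longrightarrow> - a \<in> I" "a \<in> I \<Longrightarrow> b \<in> I \<Longrightarrow> a - b \<in> I"
proof -
  note I = assms[unfolded ideal_poly_ring_iff]
  show "I \<subseteq> carrier (poly_ring n)" "0 \<in> I" "a \<in> I \<Longrightarrow> b \<in> I \<Longrightarrow> a + b \<in> I"
    "r \<in> carrier (poly_ring n) \<Longrightarrow> a \<in> I \<Longrightarrow> r * a \<in> I" for a b r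
    using I by auto
  show m: "- a \<in> I" if "a \<in> I" for a
  proof -
    have "- 1 * a \<in> I" using I that poly_ring_closed(5)[OF poly_ring_closed(2)] by blast
    then show ?thesis by simp
  qed
  show "a - b \<in> I" if "a \<in> I" "b \<in> I"
    using I m that by (metis diff_conv_add_uminus)
qed

lemma ideal_sum_closed:
  fixes I :: "'k::field mpoly set"
  assumes "ideal I (poly_ring n)" "\<And>i. i \<in> A \<Longrightarrow> f i \<in> I"
  shows "sum f A \<in> I"
  using assms(2) by (induction A rule: infinite_finite_induct) (auto intro: ideal_poly_ringD[OF assms(1)])

lemma ideal_carrier: "ideal (carrier (poly_ring n)) (poly_ring n :: 'k::field mpoly ring)"
  by (auto simp: ideal_poly_ring_iff poly_ring_closed)

lemma ideal_genideal:
  "S \<subseteq> carrier (poly_ring n) \<Longrightarrow> ideal (genideal (poly_ring n) S) (poly_ring n :: 'k::field mpoly ring)"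
  by (rule ring.genideal_ideal[OF ring_poly_ring])

lemma ksgn_cases: "ksgn v A = (1::'a::comm_ring_1) \<or> ksgn v A = (-1::'a)"
  unfolding ksgn_def by (cases "even (card {u \<in> A. u < v})") auto

lemma ksgn_closed: "(ksgn v A :: 'k::field mpoly) \<in> carrier (poly_ring n)"
  using ksgn_cases[of v A, where 'a = "'k mpoly"] by (auto simp: poly_ring_closed)

lemma ksgn_mult_closed:
  fixes I :: "'k::field mpoly set"
  shows "ideal I (poly_ring n) \<Longrightarrow> p \<in> I \<Longrightarrow> ksgn v A * p \<in> I"
  by (simp add: ideal_poly_ringD(4) ksgn_closed)

lemma koszul_boundary_closed:
  fixes I :: "'k::field mpoly set"
  assumes "ideal I (poly_ring n)" "\<And>v. v \<in> {1..n} \<Longrightarrow> X v \<in> carrier (poly_ring n)"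
    and "\<And>v. v \<in> {1..n} - A \<Longrightarrow> c (insert v A) \<in> I"
  shows "koszul_boundary n X c A \<in> I"
  unfolding koszul_boundary_def
  by (rule ideal_sum_closed[OF assms(1)])
    (use assms in \<open>auto simp: mult.assoc intro!: ksgn_mult_closed ideal_poly_ringD(4)\<close>)

section \<open>Vanishing of Koszul homology and its annihilators\<close>

text \<open>Vanishing of the \<open>j\<close>-th Koszul homology of \<open>J/I\<close>. A \<open>j\<close>-chain is represented by a function on
  all sets, of which only the values at the \<open>j\<close>-element subsets of \<open>{1..n}\<close> matter.\<close>

definition koszul_acyclic ::
  "nat \<Rightarrow> (nat \<Rightarrow> 'k::field mpoly) \<Rightarrow> nat \<Rightarrow> 'k mpoly set \<Rightarrow> 'k mpoly set \<Rightarrow> bool" where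
  "koszul_acyclic n X j I J \<longleftrightarrow>
     (\<forall>c. (\<forall>A. c A \<in> J) \<longrightarrow>
          (\<forall>B. B \<subseteq> {1..n} \<and> Suc (card B) = j \<longrightarrow> koszul_boundary n X c B \<in> I) \<longrightarrow>
          (\<exists>b. (\<forall>A. b A \<in> J) \<and>
               (\<forall>A. A \<subseteq> {1..n} \<and> card A = j \<longrightarrow> c A - koszul_boundary n X b A \<in> I)))"

lemma koszul_acyclicD:
  assumes "koszul_acyclic n X j I J" "\<And>A. c A \<in> J"
    "\<And>B. B \<subseteq> {1..n} \<Longrightarrow> Suc (card B) = j \<Longrightarrow> koszul_boundary n X c B \<in> I"
  shows "\<exists>b. (\<forall>A. b A \<in> J) \<and>
    (\<forall>A. A \<subseteq> {1..n} \<and> card A = j \<longrightarrow> c A - koszul_boundary n X b A \<in> I)"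
  using assms unfolding koszul_acyclic_def by simp

lemma koszul_acyclic_above:
  assumes "ideal J (poly_ring n)" "n < j"
  shows "koszul_acyclic n X j I J"
  unfolding koszul_acyclic_def
proof (intro allI impI exI[of _ "\<lambda>_. 0"] conjI)
  fix A assume "A \<subseteq> {1..n} \<and> card A = j"
  then have "card A \<le> n" using card_mono[of "{1..n}" A] by simp
  then show "c A - koszul_boundary n X (\<lambda>_. 0) A \<in> I" for c :: "nat set \<Rightarrow> 'a mpoly"
    using \<open>A \<subseteq> {1..n} \<and> card A = j\<close> assms(2) by simp
qed (use assms(1) in \<open>auto intro: ideal_poly_ringD\<close>)

text \<open>This is the middle of the long exact sequence for J/I, L/I and L/J: a cycle of L/I is
  corrected by a boundary until its values lie in J.\<close>

lemma koszul_acyclic_trans: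
  fixes I :: "'k::field mpoly set"
  assumes I: "ideal I (poly_ring n)" and J: "ideal J (poly_ring n)" and L: "ideal L (poly_ring n)"
    and sub: "I \<subseteq> J" "J \<subseteq> L" and X: "\<And>v. v \<in> {1..n} \<Longrightarrow> X v \<in> carrier (poly_ring n)"
    and 1: "koszul_acyclic n X j I J" and 2: "koszul_acyclic n X j J L"
  shows "koszul_acyclic n X j I L"
  unfolding koszul_acyclic_def
proof (intro allI impI)
  fix c assume c: "\<forall>A. c A \<in> L"
    and cyc: "\<forall>B. B \<subseteq> {1..n} \<and> Suc (card B) = j \<longrightarrow> koszul_boundary n X c B \<in> I"
  have "\<exists>b. (\<forall>A. b A \<in> L) \<and>
      (\<forall>A. A \<subseteq> {1..n} \<and> card A = j \<longrightarrow> c A - koszul_boundary n X b A \<in> J)"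
    by (rule koszul_acyclicD[OF 2]) (use c cyc sub in auto)
  then obtain b where b: "\<forall>A. b A \<in> L"
    "\<forall>A. A \<subseteq> {1..n} \<and> card A = j \<longrightarrow> c A - koszul_boundary n X b A \<in> J"
    by (elim exE conjE) (rule that)
  \<comment> \<open>The corrected values are known to lie in J only at j-element sets, but chains of
    J/I have all their values in J; hence the default 0.\<close>
  define d where "d A = (if A \<subseteq> {1..n} \<and> card A = j then c A - koszul_boundary n X b A else 0)" for A
  have d: "\<forall>A. d A \<in> J" using b ideal_poly_ringD(2)[OF J] by (auto simp: d_def)
  have "koszul_boundary n X d B \<in> I" if B: "B \<subseteq> {1..n}" "Suc (card B) = j" for B
  proof -
    have fB: "finite B" using B finite_subset by auto
    have "koszul_boundary n X d B = koszul_boundary n X (\<lambda>A. c A - koszul_boundary n X b A) B"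
      by (rule koszul_boundary_cong) (use B fB in \<open>auto simp: d_def\<close>)
    also have "\<dots> = koszul_boundary n X c B"
      by (simp add: koszul_boundary_diff koszul_boundary_boundary[OF fB])
    finally show ?thesis using cyc B by simp
  qed
  then have "\<exists>b'. (\<forall>A. b' A \<in> J) \<and>
      (\<forall>A. A \<subseteq> {1..n} \<and> card A = j \<longrightarrow> d A - koszul_boundary n X b' A \<in> I)"
    by (intro koszul_acyclicD[OF 1] d[rule_format])
  then obtain b' where b': "\<forall>A. b' A \<in> J"
    "\<forall>A. A \<subseteq> {1..n} \<and> card A = j \<longrightarrow> d A - koszul_boundary n X b' A \<in> I"
    by (elim exE conjE) (rule that)
  show "\<exists>b. (\<forall>A. b A \<in> L) \<and>
            (\<forall>A. A \<subseteq> {1..n} \<and> card A = j \<longrightarrow> c A - koszul_boundary n X b A \<in> I)"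
  proof (intro exI[of _ "\<lambda>A. b A + b' A"] conjI allI impI)
    show "b A + b' A \<in> L" for A using b b' sub ideal_poly_ringD(3)[OF L] by blast
    show "c A - koszul_boundary n X (\<lambda>A. b A + b' A) A \<in> I" if "A \<subseteq> {1..n} \<and> card A = j" for A
    proof -
      have "d A - koszul_boundary n X b' A \<in> I" using b' that by blast
      then show ?thesis using that by (simp add: d_def koszul_boundary_add algebra_simps)
    qed
  qed
qed

text \<open>For a cycle c this says that p annihilates its class. With p isolated, the lemmas below
  show that such p form an ideal, which reduces everything to powers of single variables.\<close>

definition koszul_kills ::
  "nat \<Rightarrow> (nat \<Rightarrow> 'k::field mpoly) \<Rightarrow> nat \<Rightarrow> 'k mpoly set \<Rightarrow> 'k mpoly set \<Rightarrow>
    (nat set \<Rightarrow> 'k mpoly) \<Rightarrow> 'k mpoly \<Rightarrow> bool" where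
  "koszul_kills n X j I J c p \<longleftrightarrow>
     (\<exists>b. (\<forall>A. b A \<in> J) \<and>
          (\<forall>A. A \<subseteq> {1..n} \<and> card A = j \<longrightarrow> p * c A - koszul_boundary n X b A \<in> I))"

lemma koszul_kills_zero:
  assumes "ideal I (poly_ring n)" "ideal J (poly_ring n)"
  shows "koszul_kills n X j I J c 0"
  unfolding koszul_kills_def
  by (rule exI[of _ "\<lambda>_. 0"]) (use assms ideal_poly_ringD(2) in auto)

lemma koszul_kills_add:
  assumes I: "ideal I (poly_ring n)" and J: "ideal J (poly_ring n)"
    and "koszul_kills n X j I J c p" "koszul_kills n X j I J c q"
  shows "koszul_kills n X j I J c (p + q)"
proof -
  obtain b b' where b: "\<forall>A. b A \<in> J" "\<forall>A. b' A \<in> J"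
    "\<And>A. A \<subseteq> {1..n} \<and> card A = j \<Longrightarrow> p * c A - koszul_boundary n X b A \<in> I"
    "\<And>A. A \<subseteq> {1..n} \<and> card A = j \<Longrightarrow> q * c A - koszul_boundary n X b' A \<in> I"
    using assms(3,4) unfolding koszul_kills_def by meson
  show ?thesis
    unfolding koszul_kills_def
  proof (intro exI[of _ "\<lambda>A. b A + b' A"] conjI allI impI)
    show "(p + q) * c A - koszul_boundary n X (\<lambda>A. b A + b' A) A \<in> I"
      if "A \<subseteq> {1..n} \<and> card A = j" for A
      using ideal_poly_ringD(3)[OF I b(3)[OF that] b(4)[OF that]]
      by (simp add: koszul_boundary_add algebra_simps)
  qed (use b J in \<open>auto intro: ideal_poly_ringD\<close>)
qed

lemma koszul_kills_mult:
  assumes I: "ideal I (poly_ring n)" and J: "ideal J (poly_ring n)"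
    and "r \<in> carrier (poly_ring n)" "koszul_kills n X j I J c p"
  shows "koszul_kills n X j I J c (r * p)"
proof -
  obtain b where b: "\<forall>A. b A \<in> J"
    "\<And>A. A \<subseteq> {1..n} \<and> card A = j \<Longrightarrow> p * c A - koszul_boundary n X b A \<in> I"
    using assms(4) unfolding koszul_kills_def by meson
  show ?thesis
    unfolding koszul_kills_def
  proof (intro exI[of _ "\<lambda>A. r * b A"] conjI allI impI)
    show "r * p * c A - koszul_boundary n X (\<lambda>A. r * b A) A \<in> I"
      if "A \<subseteq> {1..n} \<and> card A = j" for A
      using ideal_poly_ringD(4)[OF I assms(3) b(2)[OF that]]
      by (simp add: koszul_boundary_mult algebra_simps)
  qed (use b assms in \<open>auto intro: ideal_poly_ringD\<close>)
qed

text \<open>The bounding chain is \<open>koszul_wedge v c\<close>: by the Leibniz rule the error is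
  e_v wedged with the boundary of c, which has values in I.\<close>

lemma koszul_kills_variable:
  fixes I :: "'k::field mpoly set"
  assumes I: "ideal I (poly_ring n)" and J: "ideal J (poly_ring n)" and v: "v \<in> {1..n}"
    and c: "\<forall>A. c A \<in> J"
    and cyc: "\<forall>B. B \<subseteq> {1..n} \<and> Suc (card B) = j \<longrightarrow> koszul_boundary n X c B \<in> I"
  shows "koszul_kills n X j I J c (X v)"
  unfolding koszul_kills_def
proof (intro exI[of _ "koszul_wedge v c"] conjI allI impI)
  show "koszul_wedge v c A \<in> J" for A
    using c J by (auto simp: koszul_wedge_def intro: ksgn_mult_closed ideal_poly_ringD)
  fix A assume A: "A \<subseteq> {1..n} \<and> card A = j"
  then have fA: "finite A" using finite_subset by auto
  have "X v * c A - koszul_boundary n X (koszul_wedge v c) A = koszul_wedge v (koszul_boundary n X c) A"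
    unfolding koszul_boundary_wedge[OF v fA, symmetric] by simp
  also have "\<dots> \<in> I"
  proof (cases "v \<in> A")
    case True
    then have "A - {v} \<subseteq> {1..n}" "Suc (card (A - {v})) = j"
      using A fA by (auto simp: card_Suc_Diff1 simp del: card_Diff_insert)
    then show ?thesis using True I cyc by (auto simp: koszul_wedge_def intro: ksgn_mult_closed)
  qed (use I in \<open>auto simp: koszul_wedge_def intro: ideal_poly_ringD\<close>)
  finally show "X v * c A - koszul_boundary n X (koszul_wedge v c) A \<in> I" .
qed

definition var_power :: "(nat \<Rightarrow> nat) \<Rightarrow> nat \<Rightarrow> 'k::field mpoly" where
  "var_power t v = Poly_Mapping.single (Poly_Mapping.single v (t v)) 1"

lemma var_power_closed: "v \<in> {1..n} \<Longrightarrow> var_power t v \<in> carrier (poly_ring n)"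
  unfolding var_power_def by (rule single_in_carrier) auto

lemma poly_mapping_sum_singles:
  "(\<Sum>m\<in>Poly_Mapping.keys p. Poly_Mapping.single m (Poly_Mapping.lookup p m)) = p"
  by (rule poly_mapping_eqI)
    (simp add: lookup_sum lookup_single when_def sum.delta' in_keys_iff)

lemma koszul_kills_monomials:
  fixes I :: "'k::field mpoly set"
  assumes I: "ideal I (poly_ring n)" and J: "ideal J (poly_ring n)"
    and c: "\<forall>A. c A \<in> J"
    and cyc: "\<forall>B. B \<subseteq> {1..n} \<and> Suc (card B) = j \<longrightarrow> koszul_boundary n (var_power t) c B \<in> I"
    and p: "p \<in> carrier (poly_ring n)"
      "\<And>m. m \<in> Poly_Mapping.keys p \<Longrightarrow> \<exists>v\<in>{1..n}. t v \<le> Poly_Mapping.lookup m v"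
  shows "koszul_kills n (var_power t) j I J c p"
proof -
  have "koszul_kills n (var_power t) j I J c
      (\<Sum>m\<in>M. Poly_Mapping.single m (Poly_Mapping.lookup p m))"
    if "finite M" "M \<subseteq> Poly_Mapping.keys p" for M
    using that
  proof (induction M)
    case empty
    show ?case by (simp add: koszul_kills_zero[OF I J])
  next
    case (insert m M)
    obtain v where v: "v \<in> {1..n}" "t v \<le> Poly_Mapping.lookup m v" using p(2) insert by blast
    define m' where "m' = m - Poly_Mapping.single v (t v)"
    have m: "m = m' + Poly_Mapping.single v (t v)"
      by (rule poly_mapping_eqI) (use v in \<open>auto simp: m'_def lookup_add lookup_minus lookup_single when_def\<close>)
    have "Poly_Mapping.keys m' \<subseteq> {1..n}"
    proof -
      have "Poly_Mapping.keys m \<subseteq> {1..n}" using p(1) insert.prems by (auto simp: carrier_poly_ring)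
      then show ?thesis by (subst (asm) m) (simp add: keys_add_nat)
    qed
    then have "koszul_kills n (var_power t) j I J c
        (Poly_Mapping.single m' (Poly_Mapping.lookup p m) * var_power t v)"
      by (intro koszul_kills_mult[OF I J] single_in_carrier koszul_kills_variable[OF I J v(1) c cyc])
    also have "Poly_Mapping.single m' (Poly_Mapping.lookup p m) * var_power t v
        = Poly_Mapping.single m (Poly_Mapping.lookup p m)"
      unfolding var_power_def by (simp add: mult_single flip: m)
    finally show ?case using insert by (simp add: koszul_kills_add[OF I J])
  qed
  from this[of "Poly_Mapping.keys p"] show ?thesis by (simp add: poly_mapping_sum_singles)
qed

lemma monom_degree_superset:
  "finite A \<Longrightarrow> Poly_Mapping.keys m \<subseteq> A \<Longrightarrow> monom_degree m = (\<Sum>i\<in>A. Poly_Mapping.lookup m i)"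
  unfolding monom_degree_def by (rule sum.mono_neutral_left) (auto simp: in_keys_iff)

lemma monom_degree_add: "monom_degree (a + b) = monom_degree a + monom_degree b"
proof -
  let ?A = "Poly_Mapping.keys a \<union> Poly_Mapping.keys b"
  show ?thesis
    by (simp add: monom_degree_superset[of ?A] keys_add_nat lookup_add sum.distrib)
qed

lemma monom_degree_power:
  fixes f :: "'k::field mpoly"
  assumes "\<And>m. m \<in> Poly_Mapping.keys f \<Longrightarrow> 0 < monom_degree m" "m \<in> Poly_Mapping.keys (f ^ N)"
  shows "N \<le> monom_degree m"
  using assms(2)
proof (induction N arbitrary: m)
  case (Suc N)
  then obtain a b where "m = a + b" "a \<in> Poly_Mapping.keys f" "b \<in> Poly_Mapping.keys (f ^ N)"
    using keys_mult[of f "f ^ N"] by auto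
  then show ?case using Suc.IH[of b] assms(1)[of a] by (simp add: monom_degree_add)
qed simp

lemma power_closed: "f \<in> carrier (poly_ring n) \<Longrightarrow> (f :: 'k::field mpoly) ^ N \<in> carrier (poly_ring n)"
  by (induction N) (auto simp: poly_ring_closed)

text \<open>By pigeonhole, a monomial whose degree exceeds the sum of the t v has some exponent at
  least t v. So a high power of f lies in the ideal of the \<open>var_power t v\<close>, with an
  exponent N independent of c.\<close>

lemma koszul_kills_power:
  fixes I :: "'k::field mpoly set"
  assumes I: "ideal I (poly_ring n)" and J: "ideal J (poly_ring n)"
    and f: "f \<in> carrier (poly_ring n)" "homogeneous_of_degree d f" "0 < d"
  obtains N where "\<And>c. \<lbrakk>\<forall>A. c A \<in> J;
      \<forall>B. B \<subseteq> {1..n} \<and> Suc (card B) = j \<longrightarrow> koszul_boundary n (var_power t) c B \<in> I\<rbrakk>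
    \<Longrightarrow> koszul_kills n (var_power t) j I J c (f ^ N)"
proof
  fix c assume c: "\<forall>A. c A \<in> J"
    "\<forall>B. B \<subseteq> {1..n} \<and> Suc (card B) = j \<longrightarrow> koszul_boundary n (var_power t) c B \<in> I"
  let ?N = "Suc (\<Sum>v\<in>{1..n}. t v)"
  have fN: "f ^ ?N \<in> carrier (poly_ring n)" using f power_closed by blast
  show "koszul_kills n (var_power t) j I J c (f ^ ?N)"
  proof (rule koszul_kills_monomials[OF I J c fN])
    fix m assume m: "m \<in> Poly_Mapping.keys (f ^ ?N)"
    then have "?N \<le> monom_degree m"
      by (rule monom_degree_power[rotated]) (use f in \<open>auto simp: homogeneous_of_degree_def\<close>)
    moreover have "monom_degree m = (\<Sum>v\<in>{1..n}. Poly_Mapping.lookup m v)"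
      by (rule monom_degree_superset) (use fN m in \<open>auto simp: carrier_poly_ring\<close>)
    ultimately have le: "Suc (sum t {1..n}) \<le> (\<Sum>v\<in>{1..n}. Poly_Mapping.lookup m v)" by simp
    show "\<exists>v\<in>{1..n}. t v \<le> Poly_Mapping.lookup m v"
    proof (rule ccontr)
      assume "\<not> ?thesis"
      then have "(\<Sum>v\<in>{1..n}. Poly_Mapping.lookup m v) \<le> sum t {1..n}"
        by (intro sum_mono) force
      then show False using le by simp
    qed
  qed
qed

text \<open>The ideal I' is I + fJ, described by its properties. In the long exact sequence of
  multiplication by f on J/I, vanishing for J/I' in degree j + 1 makes f injective on homology in
  degree j; there it is also nilpotent. The induction on N strips off the factors f one at a
  time.\<close>

lemma koszul_acyclic_step:
  fixes I :: "'k::field mpoly set"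
  assumes I: "ideal I (poly_ring n)" and J: "ideal J (poly_ring n)" and "I \<subseteq> J"
    and I': "ideal I' (poly_ring n)" "I \<subseteq> I'" "\<And>g. g \<in> J \<Longrightarrow> f * g \<in> I'"
      "\<And>p. p \<in> I' \<Longrightarrow> \<exists>a\<in>I. \<exists>g\<in>J. p = a + f * g"
    and f: "f \<in> carrier (poly_ring n)" "homogeneous_of_degree d f" "0 < d"
    and reg: "\<And>g. g \<in> J \<Longrightarrow> f * g \<in> I \<Longrightarrow> g \<in> I"
    and ac: "koszul_acyclic n (var_power t) (Suc j) I' J"
  shows "koszul_acyclic n (var_power t) j I J"
  unfolding koszul_acyclic_def
proof (intro allI impI)
  fix c assume c: "\<forall>A. c A \<in> J"
    and cyc: "\<forall>B. B \<subseteq> {1..n} \<and> Suc (card B) = j \<longrightarrow> koszul_boundary n (var_power t) c B \<in> I"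
  let ?d = "koszul_boundary n (var_power t)"
  obtain N where "koszul_kills n (var_power t) j I J c (f ^ N)"
    using koszul_kills_power[OF I J f] c cyc by metis
  then have "koszul_kills n (var_power t) j I J c 1"
  proof (induction N)
    case (Suc N)
    obtain b where b: "\<And>A. b A \<in> J"
      "\<And>A. A \<subseteq> {1..n} \<Longrightarrow> card A = j \<Longrightarrow> f ^ Suc N * c A - ?d b A \<in> I"
      using Suc.prems unfolding koszul_kills_def by meson
    \<comment> \<open>The chain b bounds a multiple of f, hence it is a cycle modulo I + fJ.\<close>
    have "?d b B \<in> I'" if "B \<subseteq> {1..n}" "Suc (card B) = Suc j" for B
    proof -
      have "f * (f ^ N * c B) \<in> I'"
        using c J f by (intro I'(3) ideal_poly_ringD(4)[OF J]) (auto simp: power_closed)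
      moreover have "f ^ Suc N * c B - ?d b B \<in> I'" using b(2)[of B] that I'(2) by auto
      ultimately have "f * (f ^ N * c B) - (f ^ Suc N * c B - ?d b B) \<in> I'"
        by (rule ideal_poly_ringD(6)[OF I'(1)])
      then show ?thesis by (simp add: mult.assoc)
    qed
    then have "\<exists>b''. (\<forall>A. b'' A \<in> J) \<and>
        (\<forall>A. A \<subseteq> {1..n} \<and> card A = Suc j \<longrightarrow> b A - ?d b'' A \<in> I')"
      by (rule koszul_acyclicD[OF ac b(1)])
    then obtain b'' where b'': "\<forall>A. b'' A \<in> J"
      "\<forall>A. A \<subseteq> {1..n} \<and> card A = Suc j \<longrightarrow> b A - ?d b'' A \<in> I'"
      by (elim exE conjE) (rule that)
    have "\<forall>A. \<exists>gr. fst gr \<in> J \<and> (A \<subseteq> {1..n} \<longrightarrow> card A = Suc j \<longrightarrow>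
        snd gr \<in> I \<and> b A - ?d b'' A = snd gr + f * fst gr)"
    proof
      fix A
      show "\<exists>gr. fst gr \<in> J \<and> (A \<subseteq> {1..n} \<longrightarrow> card A = Suc j \<longrightarrow>
          snd gr \<in> I \<and> b A - ?d b'' A = snd gr + f * fst gr)"
      proof (cases "A \<subseteq> {1..n} \<and> card A = Suc j")
        case True
        then obtain a g where "a \<in> I" "g \<in> J" "b A - ?d b'' A = a + f * g"
          using b''(2) I'(4)[of "b A - ?d b'' A"] by blast
        then show ?thesis by (intro exI[of _ "(g, a)"]) simp
      qed (use ideal_poly_ringD(2)[OF J] in \<open>auto intro: exI[of _ "(0, 0)"]\<close>)
    qed
    then obtain gr where gr': "\<And>A. fst (gr A) \<in> J" "\<And>A. A \<subseteq> {1..n} \<Longrightarrow> card A = Suc j \<Longrightarrow>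
        snd (gr A) \<in> I \<and> b A - ?d b'' A = snd (gr A) + f * fst (gr A)"
      unfolding choice_iff by blast
    define g r where "g A = fst (gr A)" and "r A = snd (gr A)" for A
    have gr: "\<And>A. g A \<in> J"
      "\<And>A. A \<subseteq> {1..n} \<Longrightarrow> card A = Suc j \<Longrightarrow> r A \<in> I \<and> b A - ?d b'' A = r A + f * g A"
      using gr' unfolding g_def r_def by blast+
    \<comment> \<open>Taking boundaries in b = db'' + r + fg shows that f times this difference lies
      in I; regularity cancels f.\<close>
    have "f ^ N * c A - ?d g A \<in> I" if A: "A \<subseteq> {1..n}" "card A = j" for A
    proof (rule reg)
      have fA: "finite A" using A finite_subset by auto
      have ins: "insert v A \<subseteq> {1..n} \<and> card (insert v A) = Suc j" if "v \<in> {1..n} - A" for v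
        using that A fA by auto
      have dg: "?d g A \<in> J" using koszul_boundary_closed[OF J] var_power_closed gr(1) by metis
      then show "f ^ N * c A - ?d g A \<in> J"
        by (intro ideal_poly_ringD(4,6)[OF J] power_closed f(1)) (use c in auto)
      have "?d b A = ?d (\<lambda>A. (?d b'' A + r A) + f * g A) A"
      proof (rule koszul_boundary_cong)
        fix v assume "v \<in> {1..n} - A"
        then have "b (insert v A) - ?d b'' (insert v A) = r (insert v A) + f * g (insert v A)"
          using ins gr(2) by blast
        then show "b (insert v A) = ?d b'' (insert v A) + r (insert v A) + f * g (insert v A)"
          by (simp add: algebra_simps)
      qed
      also have "\<dots> = ?d r A + f * ?d g A"
        by (simp add: koszul_boundary_add koszul_boundary_mult koszul_boundary_boundary[OF fA])
      finally have *: "f * (f ^ N * c A - ?d g A) = (f ^ Suc N * c A - ?d b A) + ?d r A"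
        by (simp add: algebra_simps)
      have "?d r A \<in> I"
        by (rule koszul_boundary_closed[OF I], erule var_power_closed) (use ins gr(2) in blast)
      then show "f * (f ^ N * c A - ?d g A) \<in> I"
        unfolding * using b(2)[OF A] ideal_poly_ringD(3)[OF I] by blast
    qed
    then have "koszul_kills n (var_power t) j I J c (f ^ N)"
      unfolding koszul_kills_def using gr(1) by blast
    then show ?case by (rule Suc.IH)
  qed simp
  then show "\<exists>b. (\<forall>A. b A \<in> J) \<and> (\<forall>A. A \<subseteq> {1..n} \<and> card A = j \<longrightarrow> c A - ?d b A \<in> I)"
    by (simp add: koszul_kills_def)
qed

section \<open>Regular sequences and depth sensitivity\<close>

lemma plus_multiples_generators:
  assumes "ideal I (poly_ring n)" "ideal J (poly_ring n)" "set fs \<subseteq> carrier (poly_ring n)"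
  shows "I \<union> {f * g | f g. f \<in> set fs \<and> g \<in> J} \<subseteq> carrier (poly_ring n :: 'k::field mpoly ring)"
  using ideal_poly_ringD(1)[OF assms(1)] ideal_poly_ringD(1)[OF assms(2)] assms(3)
  by (auto intro!: poly_ring_closed(4))

lemma ideal_plus_multiples:
  assumes "ideal I (poly_ring n)" "ideal J (poly_ring n)" "set fs \<subseteq> carrier (poly_ring n)"
  shows "ideal (plus_multiples n I J fs) (poly_ring n :: 'k::field mpoly ring)"
  unfolding plus_multiples_def by (rule ideal_genideal[OF plus_multiples_generators[OF assms]])

lemma plus_multiples_least:
  fixes L :: "'k::field mpoly set"
  assumes "ideal L (poly_ring n)" "I \<subseteq> L" "\<And>f g. f \<in> set fs \<Longrightarrow> g \<in> J \<Longrightarrow> f * g \<in> L"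
  shows "plus_multiples n I J fs \<subseteq> L"
  unfolding plus_multiples_def
  by (rule ring.genideal_minimal[OF ring_poly_ring assms(1)]) (use assms in auto)

lemma plus_multiples_superset:
  fixes I :: "'k::field mpoly set"
  assumes "ideal I (poly_ring n)" "ideal J (poly_ring n)" "set fs \<subseteq> carrier (poly_ring n)"
  shows "I \<subseteq> plus_multiples n I J fs"
    and "f \<in> set fs \<Longrightarrow> g \<in> J \<Longrightarrow> f * g \<in> plus_multiples n I J fs"
  using ring.genideal_self[OF ring_poly_ring plus_multiples_generators[OF assms]]
  unfolding plus_multiples_def by auto

lemma plus_multiples_Nil:
  fixes I :: "'k::field mpoly set"
  assumes "ideal I (poly_ring n)" "ideal J (poly_ring n)"
  shows "plus_multiples n I J [] = I"
  using plus_multiples_least[of I n I "[]" J] plus_multiples_superset(1)[of I n J "[]"] assms by auto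

text \<open>The sums a + f g already form an ideal because J is one, so a single multiple of f is
  enough.\<close>

lemma plus_multiples_snoc:
  fixes I :: "'k::field mpoly set"
  assumes I: "ideal I (poly_ring n)" and J: "ideal J (poly_ring n)"
    and fs: "set fs \<subseteq> carrier (poly_ring n)" and f: "f \<in> carrier (poly_ring n)"
    and p: "p \<in> plus_multiples n I J (fs @ [f])"
  shows "\<exists>a\<in>plus_multiples n I J fs. \<exists>g\<in>J. p = a + f * g"
proof -
  let ?K = "plus_multiples n I J fs"
  note K = ideal_plus_multiples[OF I J fs]
  let ?L = "{a + f * g | a g. a \<in> ?K \<and> g \<in> J}"
  have "ideal ?L (poly_ring n)"
    unfolding ideal_poly_ring_iff
  proof (intro conjI ballI)
    show "?L \<subseteq> carrier (poly_ring n)"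
      using ideal_poly_ringD(1)[OF K] ideal_poly_ringD(1)[OF J] f
      by (auto intro!: poly_ring_closed(3,4))
    show "0 \<in> ?L"
      using ideal_poly_ringD(2)[OF K] ideal_poly_ringD(2)[OF J] by force
  next
    fix x y assume "x \<in> ?L" "y \<in> ?L"
    then obtain a g a' g' where "x = a + f * g" "y = a' + f * g'" "a \<in> ?K" "a' \<in> ?K" "g \<in> J" "g' \<in> J"
      by blast
    moreover from this have "x + y = (a + a') + f * (g + g')" by (simp add: algebra_simps)
    ultimately show "x + y \<in> ?L"
      using ideal_poly_ringD(3)[OF K] ideal_poly_ringD(3)[OF J] by blast
  next
    fix r x :: "'k mpoly" assume "r \<in> carrier (poly_ring n)" "x \<in> ?L"
    then obtain a g where "x = a + f * g" "a \<in> ?K" "g \<in> J"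
      by blast
    moreover from this have "r * x = r * a + f * (r * g)" by (simp add: algebra_simps)
    ultimately show "r * x \<in> ?L"
      using ideal_poly_ringD(4)[OF K] ideal_poly_ringD(4)[OF J] \<open>r \<in> _\<close> by blast
  qed
  then have "plus_multiples n I J (fs @ [f]) \<subseteq> ?L"
  proof (rule plus_multiples_least)
    have "a = a + f * 0" for a by simp
    then show "I \<subseteq> ?L"
      using plus_multiples_superset(1)[OF I J fs] ideal_poly_ringD(2)[OF J] by blast
    show "f' * g \<in> ?L" if "f' \<in> set (fs @ [f])" "g \<in> J" for f' g
    proof (cases "f' = f")
      case True
      have "f * g = 0 + f * g" by simp
      then show ?thesis using True that ideal_poly_ringD(2)[OF K] by blast
    next
      case False
      then have "f' * g \<in> ?K" using that plus_multiples_superset(2)[OF I J fs] by auto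
      moreover have "f' * g = f' * g + f * 0" by simp
      ultimately show ?thesis using ideal_poly_ringD(2)[OF J] by blast
    qed
  qed
  then show ?thesis using p by blast
qed

text \<open>Each element of the sequence trades one quotient for one degree, so j plus the number of
  remaining elements stays fixed. The induction starts at the full sequence, where j exceeds n and
  there are no chains.\<close>

lemma regular_sequence_koszul_acyclic:
  fixes I :: "'k::field mpoly set"
  assumes I: "ideal I (poly_ring n)" and J: "ideal J (poly_ring n)" and "I \<subseteq> J"
    and reg: "regular_sequence n I J fs" and j: "n < j + length fs"
  shows "koszul_acyclic n (var_power t) j I J"
proof -
  let ?K = "\<lambda>i. plus_multiples n I J (take i fs)"
  have fs: "set fs \<subseteq> carrier (poly_ring n)" using reg by (auto simp: regular_sequence_def)
  then have tk: "set (take i fs) \<subseteq> carrier (poly_ring n)" for i using set_take_subset by fast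
  have K: "ideal (?K i) (poly_ring n)" for i by (rule ideal_plus_multiples[OF I J tk])
  have KJ: "?K i \<subseteq> J" for i
    by (rule plus_multiples_least[OF J \<open>I \<subseteq> J\<close>]) (use tk ideal_poly_ringD(4)[OF J] in blast)
  have "koszul_acyclic n (var_power t) j (?K i) J" if "i \<le> length fs" "n < j + (length fs - i)" for i j
    using that
  proof (induction i arbitrary: j rule: inc_induct)
    case base
    then show ?case by (intro koszul_acyclic_above[OF J]) simp
  next
    case (step i)
    let ?f = "fs ! i"
    have take: "take (Suc i) fs = take i fs @ [?f]" using step by (simp add: take_Suc_conv_app_nth)
    have fi: "?f \<in> set fs" using step by simp
    then obtain d where d: "0 < d" "homogeneous_of_degree d ?f"
      using reg unfolding regular_sequence_def by blast
    have fc: "?f \<in> carrier (poly_ring n)" using fi fs by blast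
    show ?case
    proof (rule koszul_acyclic_step[OF K J KJ K])
      show "?K i \<subseteq> ?K (Suc i)"
      proof (rule plus_multiples_least[OF K])
        show "I \<subseteq> ?K (Suc i)" by (rule plus_multiples_superset[OF I J tk])
        show "f * g \<in> ?K (Suc i)" if "f \<in> set (take i fs)" "g \<in> J" for f g
          by (rule plus_multiples_superset[OF I J tk]) (use that take in auto)
      qed
      show "?f * g \<in> ?K (Suc i)" if "g \<in> J" for g
        by (rule plus_multiples_superset[OF I J tk]) (use that take in auto)
      show "\<exists>a\<in>?K i. \<exists>g\<in>J. p = a + ?f * g" if "p \<in> ?K (Suc i)" for p
        using plus_multiples_snoc[OF I J tk fc] that unfolding take by blast
      show "g \<in> ?K i" if "g \<in> J" "?f * g \<in> ?K i" for g
        using reg that step(2) unfolding regular_sequence_def by blast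
      show "koszul_acyclic n (var_power t) (Suc j) (?K (Suc i)) J"
        by (rule step.IH) (use step in auto)
    qed (fact fc d)+
  qed
  from this[of 0 j] j show ?thesis by (simp add: plus_multiples_Nil[OF I J])
qed

text \<open>If all values are below e, so is their supremum. For e = 0 the set could be empty, with
  supremum 0.\<close>

lemma Sup_enat_witness:
  assumes "enat e \<le> Sup {enat (g x) | x. P x}" "0 < e"
  shows "\<exists>x. P x \<and> e \<le> g x"
proof (rule ccontr)
  assume "\<not> ?thesis"
  then have "g x \<le> e - 1" if "P x" for x using that by force
  then have "Sup {enat (g x) | x. P x} \<le> enat (e - 1)" by (intro Sup_least) auto
  with assms(1) have "enat e \<le> enat (e - 1)" by (rule order_trans)
  then show False using assms(2) by simp
qed

lemma Cohen_Macaulay_koszul_acyclic: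
  fixes I :: "'k::field mpoly set"
  assumes "ideal I (poly_ring n)" "ideal J (poly_ring n)" "I \<subseteq> J"
    and "Cohen_Macaulay_module n I J" "enat e \<le> module_dim n I J" "n < j + e"
  shows "koszul_acyclic n (var_power t) j I J"
proof (cases "e = 0")
  case True
  then show ?thesis using assms by (intro koszul_acyclic_above) auto
next
  case False
  have "enat e \<le> Sup {enat (length fs) | fs. regular_sequence n I J fs}"
    using assms(4,5) by (simp add: Cohen_Macaulay_module_def module_depth_def)
  then have "\<exists>fs. regular_sequence n I J fs \<and> e \<le> length fs"
    by (rule Sup_enat_witness) (use False in simp)
  then obtain fs where "regular_sequence n I J fs" "e \<le> length fs" by (elim exE conjE)
  then show ?thesis using assms by (intro regular_sequence_koszul_acyclic) auto
qed

section \<open>Prime ideals of faces and the dimension of a layer\<close>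

text \<open>This is the ideal generated by the variables outside \<open>F\<close>.\<close>

definition face_ideal :: "nat \<Rightarrow> nat set \<Rightarrow> 'k::field mpoly set" where
  "face_ideal n F =
     {p \<in> carrier (poly_ring n). \<forall>m\<in>Poly_Mapping.keys p. \<not> Poly_Mapping.keys m \<subseteq> F}"

lemma ideal_face_ideal: "ideal (face_ideal n F) (poly_ring n :: 'k::field mpoly ring)"
  unfolding ideal_poly_ring_iff
proof (intro conjI ballI)
  fix a b :: "'k mpoly" assume "a \<in> face_ideal n F" "b \<in> face_ideal n F"
  then show "a + b \<in> face_ideal n F"
    using keys_add[of a b] by (auto simp: face_ideal_def poly_ring_closed)
next
  fix r a :: "'k mpoly" assume "r \<in> carrier (poly_ring n)" "a \<in> face_ideal n F"
  then show "r * a \<in> face_ideal n F"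
    using keys_mult[of r a] by (fastforce simp: face_ideal_def poly_ring_closed keys_add_nat)
qed (auto simp: face_ideal_def poly_ring_closed)

text \<open>This is the projection to the polynomial ring on F, whose kernel is the face
  ideal.\<close>

definition face_part :: "nat set \<Rightarrow> 'k::field mpoly \<Rightarrow> 'k mpoly" where
  "face_part F p = (\<Sum>m\<in>{m \<in> Poly_Mapping.keys p. Poly_Mapping.keys m \<subseteq> F}.
      Poly_Mapping.single m (Poly_Mapping.lookup p m))"

lemma lookup_face_part:
  "Poly_Mapping.lookup (face_part F p) m = (if Poly_Mapping.keys m \<subseteq> F then Poly_Mapping.lookup p m else 0)"
  unfolding face_part_def
  by (auto simp: lookup_sum lookup_single when_def sum.delta' in_keys_iff)

lemma keys_face_part: "Poly_Mapping.keys (face_part F p) = {m \<in> Poly_Mapping.keys p. Poly_Mapping.keys m \<subseteq> F}"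
proof (rule Set.set_eqI)
  show "m \<in> Poly_Mapping.keys (face_part F p)
      \<longleftrightarrow> m \<in> {m \<in> Poly_Mapping.keys p. Poly_Mapping.keys m \<subseteq> F}" for m
    by (cases "Poly_Mapping.keys m \<subseteq> F") (simp_all add: in_keys_iff[of m] lookup_face_part)
qed

lemma face_part_diff:
  assumes "p \<in> carrier (poly_ring n)"
  shows "p - face_part F p \<in> face_ideal n F"
proof -
  have "m \<in> Poly_Mapping.keys p \<and> \<not> Poly_Mapping.keys m \<subseteq> F"
    if "m \<in> Poly_Mapping.keys (p - face_part F p)" for m
    using that by (cases "Poly_Mapping.keys m \<subseteq> F")
      (simp_all add: in_keys_iff[of m] lookup_minus lookup_face_part)
  then show ?thesis using assms unfolding face_ideal_def carrier_poly_ring by blast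
qed

text \<open>Modulo the ideal, a and b may be replaced by their parts on F. The product of these lies
  in the ideal but only has monomials on F, so it is 0, and polynomials have no zero
  divisors.\<close>

lemma primeideal_face_ideal:
  "primeideal (face_ideal n F) (poly_ring n :: 'k::field mpoly ring)"
proof (rule primeidealI[OF ideal_face_ideal cring_poly_ring])
  have "(1 :: 'k mpoly) \<notin> face_ideal n F" by (simp add: face_ideal_def)
  then show "carrier (poly_ring n) \<noteq> (face_ideal n F :: 'k mpoly set)"
    using poly_ring_closed(2) by blast
  fix a b :: "'k mpoly"
  assume ab: "a \<in> carrier (poly_ring n)" "b \<in> carrier (poly_ring n)"
    "a \<otimes>\<^bsub>poly_ring n\<^esub> b \<in> face_ideal n F"
  note I = ideal_face_ideal[of n F, where 'k = 'k]
  let ?a = "face_part F a" and ?b = "face_part F b"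
  have a': "?a \<in> carrier (poly_ring n)" using ab(1) by (auto simp: carrier_poly_ring keys_face_part)
  have "?a * ?b = a * b - (b * (a - ?a) + ?a * (b - ?b))" by (simp add: algebra_simps)
  also have "\<dots> \<in> face_ideal n F"
  proof (rule ideal_poly_ringD(6)[OF I])
    show "a * b \<in> face_ideal n F" using ab(3) by simp
    show "b * (a - ?a) + ?a * (b - ?b) \<in> face_ideal n F"
      by (rule ideal_poly_ringD(3)[OF I]; rule ideal_poly_ringD(4)[OF I])
        (fact ab(2) face_part_diff[OF ab(1)] a' face_part_diff[OF ab(2)])+
  qed
  finally have "?a * ?b \<in> face_ideal n F" .
  moreover have "Poly_Mapping.keys m \<subseteq> F" if m: "m \<in> Poly_Mapping.keys (?a * ?b)" for m
  proof -
    obtain x y where "m = x + y" "x \<in> Poly_Mapping.keys ?a" "y \<in> Poly_Mapping.keys ?b"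
      using subsetD[OF keys_mult m] by blast
    then show ?thesis by (simp add: keys_face_part keys_add_nat)
  qed
  ultimately have "Poly_Mapping.keys (?a * ?b) = {}" by (auto simp: face_ideal_def)
  then have "?a = 0 \<or> ?b = 0" by simp
  then show "a \<in> face_ideal n F \<or> b \<in> face_ideal n F"
    using face_part_diff[OF ab(1), of F] face_part_diff[OF ab(2), of F] by auto
qed

lemma face_ideal_strict_mono:
  assumes "G \<subset> F" "F \<subseteq> {1..n}"
  shows "face_ideal n F \<subset> (face_ideal n G :: 'k::field mpoly set)"
proof
  show "face_ideal n F \<subseteq> (face_ideal n G :: 'k mpoly set)"
    using assms unfolding face_ideal_def by blast
  obtain v where v: "v \<in> F" "v \<notin> G" using assms by blast
  let ?p = "Poly_Mapping.single (Poly_Mapping.single v 1) 1 :: 'k mpoly"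
  have "?p \<in> face_ideal n G" "?p \<notin> face_ideal n F"
    using v assms by (auto simp: face_ideal_def intro!: single_in_carrier)
  then show "face_ideal n F \<noteq> (face_ideal n G :: 'k mpoly set)" by blast
qed

text \<open>Deleting the elements of F one at a time enlarges the face ideal strictly, which gives
  \<open>card F\<close> steps of primes above the annihilator.\<close>

lemma module_dim_ge_card:
  fixes I :: "'k::field mpoly set"
  assumes F: "F \<subseteq> {1..n}" and ann: "annihilator n I J \<subseteq> face_ideal n F"
  shows "enat (card F) \<le> module_dim n I J"
proof -
  have fin: "finite F" using F finite_subset by auto
  define xs where "xs = sorted_list_of_set F"
  have xs: "set xs = F" "distinct xs" "length xs = card F" using fin by (auto simp: xs_def)
  define P where "P i = (face_ideal n (set (drop i xs)) :: 'k mpoly set)" for i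
  have mono: "annihilator n I J \<subseteq> P i" for i
    using ann set_drop_subset[of i xs] xs(1) by (fastforce simp: P_def face_ideal_def)
  have "P i \<subset> P (Suc i)" if "i < card F" for i
    unfolding P_def
  proof (rule face_ideal_strict_mono)
    show "set (drop i xs) \<subseteq> {1..n}" using F set_drop_subset[of i xs] xs(1) by auto
    have "drop i xs = xs ! i # drop (Suc i) xs" using that xs(3) by (simp add: Cons_nth_drop_Suc)
    moreover have "xs ! i \<notin> set (drop (Suc i) xs)"
      using distinct_drop[OF xs(2), of i] calculation by simp
    ultimately show "set (drop (Suc i) xs) \<subset> set (drop i xs)" by auto
  qed
  then have "(\<forall>i\<le>card F. primeideal (P i) (poly_ring n) \<and> annihilator n I J \<subseteq> P i) \<and>
      (\<forall>i<card F. P i \<subset> P (Suc i))"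
    using mono by (simp add: P_def primeideal_face_ideal)
  then show ?thesis unfolding module_dim_def
    by (intro Sup_upper CollectI exI[of _ "card F"] exI[of _ P] conjI[OF refl])
qed

text \<open>J is the filtration step below the first layer of dimension at least e. If a layer left
  the prime of a face F, its annihilator would lie in that prime and its dimension would be at least
  \<open>card F\<close>; below J this is impossible. The layers above J all have depth at least e
  and are assembled by \<open>koszul_acyclic_trans\<close>.\<close>

lemma sequentially_Cohen_Macaulay_filtration:
  fixes I :: "'k::field mpoly set"
  assumes scm: "sequentially_Cohen_Macaulay_module n I (carrier (poly_ring n))"
    and FF: "\<And>F. F \<in> \<F> \<Longrightarrow> F \<subseteq> {1..n} \<and> e \<le> card F \<and> I \<subseteq> face_ideal n F"
  shows "\<exists>J. ideal J (poly_ring n) \<and> I \<subseteq> J \<and> (\<forall>F\<in>\<F>. J \<subseteq> face_ideal n F) \<and>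
    (\<forall>j t. n < j + e \<longrightarrow> koszul_acyclic n (var_power t) j J (carrier (poly_ring n)))"
proof -
  obtain r M where M: "M 0 = I" "M r = carrier (poly_ring n)" "\<And>i. i \<le> r \<Longrightarrow> graded_ideal n (M i)"
    "\<And>i. i < r \<Longrightarrow> M i \<subset> M (Suc i) \<and> Cohen_Macaulay_module n (M i) (M (Suc i))"
    "\<And>i. Suc i < r \<Longrightarrow> module_dim n (M i) (M (Suc i)) < module_dim n (M (Suc i)) (M (Suc (Suc i)))"
    using scm unfolding sequentially_Cohen_Macaulay_module_def by blast
  have id: "ideal (M i) (poly_ring n)" if "i \<le> r" for i
    using M(3)[OF that] by (simp add: graded_ideal_def)
  let ?dim = "\<lambda>i. module_dim n (M i) (M (Suc i))"
  \<comment> \<open>The alternative \<open>i = r\<close> covers filtrations without a layer of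
    dimension at least e.\<close>
  define s where "s = (LEAST i. i = r \<or> enat e \<le> ?dim i)"
  have s: "s = r \<or> enat e \<le> ?dim s" unfolding s_def by (rule LeastI[of _ r]) simp
  have "s \<le> r" unfolding s_def by (rule Least_le) simp
  have low: "\<not> enat e \<le> ?dim i" if "i < s" for i using not_less_Least[of i] that unfolding s_def by blast
  have high: "enat e \<le> ?dim i" if "s \<le> i" "i < r" for i
    using that
  proof (induction i rule: dec_induct)
    case base
    then show ?case using s by simp
  next
    case (step i)
    then show ?case using M(5)[of i] by (meson Suc_lessD less_imp_le order_trans)
  qed
  have sub: "M i \<subseteq> face_ideal n F" if "F \<in> \<F>" "i \<le> s" for F i
    using that(2)
  proof (induction i)
    case 0
    then show ?case using FF[OF that(1)] M(1) by simp
  next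
    case (Suc i)
    show ?case
    proof (rule ccontr)
      assume "\<not> ?thesis"
      then obtain g where g: "g \<in> M (Suc i)" "g \<notin> face_ideal n F" by blast
      have "M (Suc i) \<subseteq> carrier (poly_ring n)"
        using id[of "Suc i"] Suc.prems \<open>s \<le> r\<close> ideal_poly_ringD(1) by force
      then have gc: "g \<in> carrier (poly_ring n)" using g by blast
      \<comment> \<open>A member f of the annihilator sends g into \<open>M i\<close>, which lies in
        a prime ideal not containing g.\<close>
      have "annihilator n (M i) (M (Suc i)) \<subseteq> face_ideal n F"
      proof
        fix f assume f: "f \<in> annihilator n (M i) (M (Suc i))"
        then have "f * g \<in> face_ideal n F" using Suc g by (auto simp: annihilator_def)
        moreover have "f \<in> carrier (poly_ring n)" using f by (simp add: annihilator_def)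
        ultimately show "f \<in> face_ideal n F"
          using primeideal.I_prime[OF primeideal_face_ideal[of n F], of f g] gc g(2) by auto
      qed
      then have "enat (card F) \<le> ?dim i" using FF[OF that(1)] module_dim_ge_card by blast
      moreover have "enat e \<le> enat (card F)" using FF[OF that(1)] by simp
      ultimately have "enat e \<le> ?dim i" by (rule order_trans[rotated])
      then show False using low[of i] Suc.prems by simp
    qed
  qed
  have inc: "M i \<subseteq> M k" if "i \<le> k" "k \<le> r" for i k
    using that
  proof (induction k rule: dec_induct)
    case (step k)
    then show ?case using M(4)[of k] by force
  qed simp
  have ac: "koszul_acyclic n (var_power t) j (M i) (carrier (poly_ring n))"
    if "n < j + e" "s \<le> i" "i \<le> r" for j t i
    using that(3,2)
  proof (induction i rule: inc_induct)
    case base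
    show ?case
      unfolding koszul_acyclic_def M(2)
      by (intro allI impI exI[of _ "\<lambda>_. 0"]) (auto simp: poly_ring_closed)
  next
    case (step i)
    have "koszul_acyclic n (var_power t) j (M i) (M (Suc i))"
      by (rule Cohen_Macaulay_koszul_acyclic[of _ _ _ e])
        (use step M(4)[of i] high[of i] id[of i] id[of "Suc i"] that(1) in auto)
    moreover have "koszul_acyclic n (var_power t) j (M (Suc i)) (carrier (poly_ring n))"
      using step by simp
    ultimately show ?case
      by (rule koszul_acyclic_trans[rotated -2])
        (use step M(4)[of i] id[of i] id[of "Suc i"] ideal_poly_ringD(1) in
          \<open>auto intro: ideal_carrier var_power_closed\<close>)
  qed
  show ?thesis
  proof (intro exI[of _ "M s"] conjI ballI allI impI)
    show "ideal (M s) (poly_ring n)" using id \<open>s \<le> r\<close> .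
    show "I \<subseteq> M s" using inc[of 0 s] \<open>s \<le> r\<close> M(1) by simp
  qed (use sub ac \<open>s \<le> r\<close> in auto)
qed

section \<open>Sequentially Cohen-Macaulay Alexander duals\<close>

definition face_monom :: "nat set \<Rightarrow> (nat \<Rightarrow>\<^sub>0 nat)" where
  "face_monom F = (\<Sum>i\<in>F. Poly_Mapping.single i 1)"

lemma lookup_face_monom:
  "finite F \<Longrightarrow> Poly_Mapping.lookup (face_monom F) i = (if i \<in> F then 1 else 0)"
  by (simp add: face_monom_def lookup_sum lookup_single when_def)

lemma keys_face_monom: "finite F \<Longrightarrow> Poly_Mapping.keys (face_monom F) = F"
proof (rule Set.set_eqI)
  show "i \<in> Poly_Mapping.keys (face_monom F) \<longleftrightarrow> i \<in> F" if "finite F" for i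
    using that by (cases "i \<in> F") (simp_all add: in_keys_iff lookup_face_monom)
qed

lemma face_monom_remove:
  "finite F \<Longrightarrow> v \<in> F \<Longrightarrow> face_monom F = Poly_Mapping.single v 1 + face_monom (F - {v})"
  by (simp add: face_monom_def sum.remove)

lemma squarefree_monomial_face_monom:
  "squarefree_monomial F = Poly_Mapping.single (face_monom F) 1"
  by (simp add: squarefree_monomial_def face_monom_def)

lemma lookup_single_mult:
  fixes p :: "'k::field mpoly"
  shows "Poly_Mapping.lookup (Poly_Mapping.single a 1 * p) (a + m) = Poly_Mapping.lookup p m"
proof -
  have "Poly_Mapping.single a 1 * p
      = (\<Sum>l\<in>Poly_Mapping.keys p. Poly_Mapping.single (a + l) (Poly_Mapping.lookup p l))"
    by (subst (1) poly_mapping_sum_singles[symmetric]) (simp add: sum_distrib_left mult_single)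
  then show ?thesis
    by (simp add: lookup_sum lookup_single when_def sum.delta' in_keys_iff)
qed

lemma lookup_var_power_mult:
  fixes p :: "'k::field mpoly"
  shows "Poly_Mapping.lookup (var_power t v * p) m
    = (if t v \<le> Poly_Mapping.lookup m v then Poly_Mapping.lookup p (m - Poly_Mapping.single v (t v)) else 0)"
proof (cases "t v \<le> Poly_Mapping.lookup m v")
  case True
  then have "m = Poly_Mapping.single v (t v) + (m - Poly_Mapping.single v (t v))"
    by (intro poly_mapping_eqI) (auto simp: lookup_add lookup_minus lookup_single when_def)
  then show ?thesis using True lookup_single_mult unfolding var_power_def by metis
next
  case False
  have "m \<notin> Poly_Mapping.keys (var_power t v * p)"
  proof
    assume "m \<in> Poly_Mapping.keys (var_power t v * p)"
    from subsetD[OF keys_mult this] obtain l where "m = Poly_Mapping.single v (t v) + l"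
      by (auto simp: var_power_def)
    then show False using False by (simp add: lookup_add)
  qed
  then show ?thesis using False by (simp add: in_keys_iff)
qed

lemma lookup_ksgn_mult:
  fixes p :: "'k::field mpoly"
  shows "Poly_Mapping.lookup (ksgn v A * p) m = ksgn v A * Poly_Mapping.lookup p m"
proof (cases "even (card {u \<in> A. u < v})")
  case True
  then show ?thesis by (simp add: ksgn_def)
next
  case False
  then show ?thesis by (simp add: ksgn_def)
qed

lemma single_ksgn_mult:
  "ksgn v A * Poly_Mapping.single m a = (Poly_Mapping.single m (ksgn v A * a) :: 'k::field mpoly)"
proof (cases "even (card {u \<in> A. u < v})")
  case True
  then show ?thesis by (simp add: ksgn_def)
next
  case False
  then show ?thesis by (simp add: ksgn_def single_uminus)
qed

lemma single_face_monom_closed: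
  "G \<subseteq> {1..n} \<Longrightarrow> Poly_Mapping.single (face_monom G) a \<in> carrier (poly_ring n :: 'k::field mpoly ring)"
  by (rule single_in_carrier) (simp add: keys_face_monom finite_subset[of G "{1..n}"])

text \<open>A nonface is not contained in the face F, so each generator involves a variable outside
  F.\<close>

lemma stanley_reisner_subset_face_ideal:
  assumes "simplicial_complex_on n \<Gamma>" "F \<in> \<Gamma>"
  shows "stanley_reisner_ideal n \<Gamma> \<subseteq> (face_ideal n F :: 'k::field mpoly set)"
  unfolding stanley_reisner_ideal_def
proof (rule ring.genideal_minimal[OF ring_poly_ring ideal_face_ideal])
  show "squarefree_monomial ` {F. F \<subseteq> {1..n} \<and> F \<notin> \<Gamma>} \<subseteq> (face_ideal n F :: 'k mpoly set)"
  proof (clarsimp simp: squarefree_monomial_face_monom face_ideal_def)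
    fix G assume G: "G \<subseteq> {Suc 0..n}" "G \<notin> \<Gamma>"
    then have k: "Poly_Mapping.keys (face_monom G) = G" by (intro keys_face_monom) (rule finite_subset, auto)
    have "Poly_Mapping.single (face_monom G) 1 \<in> carrier (poly_ring n :: 'k mpoly ring)"
      by (rule single_in_carrier) (use k G in simp)
    moreover have "\<not> G \<subseteq> F" using assms G by (auto simp: simplicial_complex_on_def)
    ultimately show "Poly_Mapping.single (face_monom G) 1 \<in> carrier (poly_ring n :: 'k mpoly ring) \<and>
        \<not> Poly_Mapping.keys (face_monom G) \<subseteq> F" by (simp add: k)
  qed
qed

lemma stanley_reisner_monomial:
  assumes "G \<subseteq> {1..n}" "G \<notin> \<Gamma>"
  shows "Poly_Mapping.single (face_monom G) a \<in> (stanley_reisner_ideal n \<Gamma> :: 'k::field mpoly set)"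
proof -
  let ?S = "squarefree_monomial ` {F. F \<subseteq> {1..n} \<and> F \<notin> \<Gamma>} :: 'k mpoly set"
  have S: "?S \<subseteq> carrier (poly_ring n)"
    unfolding squarefree_monomial_face_monom using single_face_monom_closed by blast
  have "squarefree_monomial G \<in> genideal (poly_ring n) ?S"
    using ring.genideal_self[OF ring_poly_ring S] assms by blast
  then have "Poly_Mapping.single 0 a * squarefree_monomial G \<in> genideal (poly_ring n) ?S"
    by (rule ideal_poly_ringD(4)[OF ideal_genideal[OF S], rotated]) (rule single_in_carrier, simp)
  then show ?thesis
    by (simp add: squarefree_monomial_face_monom mult_single stanley_reisner_ideal_def)
qed

lemma simplicial_complex_alexander_dual:
  assumes "simplicial_complex_on n \<Delta>"
  shows "simplicial_complex_on n (alexander_dual n \<Delta>)"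
proof -
  have "{1..n} - G \<notin> \<Delta>" if "G \<subseteq> F" "{1..n} - F \<notin> \<Delta>" for F G
  proof
    assume "{1..n} - G \<in> \<Delta>"
    moreover have "{1..n} - F \<subseteq> {1..n} - G" using that by blast
    ultimately show False using assms that(2) unfolding simplicial_complex_on_def by blast
  qed
  then show ?thesis unfolding simplicial_complex_on_def alexander_dual_def by blast
qed

text \<open>The cone w over z, with e_A multiplied by the monomial of the complement of A, is a
  Koszul chain whose boundary lies in the Stanley-Reisner ideal of the dual: complements of faces
  are nonfaces of the dual. Being a cycle modulo J, it bounds modulo J. The coefficients in one
  squarefree multidegree turn this into w = du over the field, whence z = dw = ddu = 0.\<close>

theorem sequentially_Cohen_Macaulay_dual_no_cycle:
  fixes z :: "nat set \<Rightarrow> 'k::field"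
  assumes cx: "simplicial_complex_on n \<Delta>"
    and scm: "sequentially_Cohen_Macaulay TYPE('k) n (alexander_dual n \<Delta>)"
    and W: "W \<subseteq> {1..n}"
    and dim: "\<And>F. F \<in> \<Delta> \<Longrightarrow> F \<subseteq> W \<Longrightarrow> card F \<le> Suc k"
    and nomin: "\<And>A. A \<subseteq> W \<Longrightarrow> card A = Suc (Suc k) \<Longrightarrow> A \<notin> \<Delta> \<Longrightarrow> \<exists>B. B \<subset> A \<and> B \<notin> \<Delta>"
    and supp: "\<And>B. z B \<noteq> 0 \<Longrightarrow> B \<in> \<Delta> \<and> B \<subseteq> W \<and> card B = Suc k"
    and cyc: "\<And>B. B \<subseteq> {1..n} \<Longrightarrow> card B = k \<Longrightarrow> koszul_boundary n (\<lambda>_. 1) z B = 0"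
  shows "z B = 0"
proof (rule ccontr)
  assume zB: "z B \<noteq> 0"
  define V where "V = {1..n}"
  have [simp]: "finite V" by (simp add: V_def)
  define \<Gamma> where "\<Gamma> = alexander_dual n \<Delta>"
  have \<Gamma>: "simplicial_complex_on n \<Gamma>" unfolding \<Gamma>_def by (rule simplicial_complex_alexander_dual[OF cx])
  have \<Gamma>_iff: "F \<in> \<Gamma> \<longleftrightarrow> F \<subseteq> V \<and> V - F \<notin> \<Delta>" for F by (simp add: \<Gamma>_def alexander_dual_def V_def)
  \<comment> \<open>Complements of sets with at most k + 1 elements have at least this size, and k +
    2 + e exceeds n even when the subtraction truncates.\<close>
  define e where "e = n - k - 1"
  have "\<exists>J :: 'k mpoly set. ideal J (poly_ring n) \<and> stanley_reisner_ideal n \<Gamma> \<subseteq> J \<and>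
    (\<forall>F\<in>{F \<in> \<Gamma>. e \<le> card F}. J \<subseteq> face_ideal n F) \<and>
    (\<forall>j t. n < j + e \<longrightarrow> koszul_acyclic n (var_power t) j J (carrier (poly_ring n)))"
  proof (rule sequentially_Cohen_Macaulay_filtration)
    show "sequentially_Cohen_Macaulay_module n (stanley_reisner_ideal n \<Gamma> :: 'k mpoly set)
        (carrier (poly_ring n))"
      using scm by (simp add: sequentially_Cohen_Macaulay_def \<Gamma>_def)
    show "F \<subseteq> {1..n} \<and> e \<le> card F \<and> stanley_reisner_ideal n \<Gamma> \<subseteq> (face_ideal n F :: 'k mpoly set)"
      if "F \<in> {F \<in> \<Gamma>. e \<le> card F}" for F
      using that stanley_reisner_subset_face_ideal[OF \<Gamma>, of F, where 'k = 'k] by (simp add: \<Gamma>_iff V_def)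
  qed
  then obtain J :: "'k mpoly set" where J: "ideal J (poly_ring n)" "stanley_reisner_ideal n \<Gamma> \<subseteq> J"
    "\<forall>F\<in>{F \<in> \<Gamma>. e \<le> card F}. J \<subseteq> face_ideal n F"
    "\<forall>j t. n < j + e \<longrightarrow> koszul_acyclic n (var_power t) j J (carrier (poly_ring n))"
    by (elim exE conjE) (rule that)
  have big: "A \<notin> \<Delta>" if "A \<subseteq> W" "card A = Suc (Suc k)" for A
    using dim[of A] that by auto
  \<comment> \<open>This is the sense in which J agrees with the Stanley-Reisner ideal once the
    variables outside W are inverted.\<close>
  have J_supp: "Poly_Mapping.keys m \<union> (V - W) \<notin> \<Gamma>" if "p \<in> J" "m \<in> Poly_Mapping.keys p" for p m
  proof
    assume *: "Poly_Mapping.keys m \<union> (V - W) \<in> \<Gamma>"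
    let ?A0 = "V - (Poly_Mapping.keys m \<union> (V - W))"
    have A0: "?A0 \<notin> \<Delta>" "?A0 \<subseteq> W" using * by (auto simp: \<Gamma>_iff)
    \<comment> \<open>A smallest nonface has at most k + 1 elements: a subset of it with k + 2
      elements would be a nonface by \<open>big\<close> and contain a smaller one by
      \<open>nomin\<close>.\<close>
    define A where "A = (ARG_MIN card A. A \<subseteq> ?A0 \<and> A \<notin> \<Delta>)"
    have A: "A \<subseteq> ?A0 \<and> A \<notin> \<Delta>" unfolding A_def by (rule arg_min_natI[of _ ?A0]) (use A0 in simp)
    have Amin: "card A \<le> card C" if "C \<subseteq> ?A0 \<and> C \<notin> \<Delta>" for C
      unfolding A_def by (rule arg_min_nat_le) (fact that)
    have fA: "finite A" "A \<subseteq> W" "A \<subseteq> V" using A A0 finite_subset by (auto simp: V_def)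
    have "card A \<le> Suc k"
    proof (rule ccontr)
      assume "\<not> ?thesis"
      then obtain C where C: "C \<subseteq> A" "card C = Suc (Suc k)"
        by (metis not_less_eq_eq obtain_subset_with_card_n)
      obtain D where D: "D \<subset> C" "D \<notin> \<Delta>" using nomin[of C] big[of C] C fA by auto
      have "card D < card C" using D C fA by (meson finite_subset psubset_card_mono)
      also have "\<dots> \<le> card A" by (rule card_mono[OF fA(1) C(1)])
      also have "\<dots> \<le> card D" using Amin[of D] D C A by auto
      finally show False by simp
    qed
    then have "e \<le> card (V - A)" using fA by (simp add: card_Diff_subset e_def V_def)
    moreover have "V - A \<in> \<Gamma>" using A fA by (simp add: \<Gamma>_iff double_diff)
    ultimately have "J \<subseteq> face_ideal n (V - A)" using J(3) by blast
    then have "p \<in> face_ideal n (V - A)" using that by blast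
    then have "\<not> Poly_Mapping.keys m \<subseteq> V - A" "Poly_Mapping.keys m \<subseteq> V"
      using that(2) by (auto simp: face_ideal_def carrier_poly_ring V_def)
    then show False using A by blast
  qed
  obtain a where a: "a \<in> W" using supp[OF zB] by (metis card_eq_0_iff ex_in_conv nat.distinct(1) subset_empty)
  have aV: "a \<in> V" using a W by (auto simp: V_def)
  \<comment> \<open>The cone with apex a bounds the cycle z in the full simplex on W.\<close>
  define w where "w = koszul_wedge a z"
  have w_supp: "A \<subseteq> W \<and> card A = Suc (Suc k) \<and> finite A" if "w A \<noteq> 0" for A
  proof -
    have aA: "a \<in> A" "z (A - {a}) \<noteq> 0"
      using that by (auto simp: w_def koszul_wedge_def split: if_splits)
    from supp[OF this(2)] have *: "A - {a} \<subseteq> W" "card (A - {a}) = Suc k" by auto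
    then have "finite (A - {a})" by (metis card.infinite nat.distinct(1))
    then have "finite A" by simp
    moreover have "card A = Suc (Suc k)" using card_Suc_Diff1[OF \<open>finite A\<close> aA(1)] * by simp
    ultimately show ?thesis using * a by auto
  qed
  have dw: "koszul_boundary n (\<lambda>_. 1) w C = z C" if "C \<subseteq> V" "card C = Suc k" for C
  proof -
    have fC: "finite C" using finite_subset[OF that(1)] by simp
    have "koszul_wedge a (koszul_boundary n (\<lambda>_. 1) z) C = 0"
    proof (cases "a \<in> C")
      case True
      have "koszul_boundary n (\<lambda>_. 1) z (C - {a}) = 0"
        by (rule cyc) (use that True in \<open>auto simp: V_def\<close>)
      then show ?thesis by (simp add: koszul_wedge_def)
    qed (simp add: koszul_wedge_def)
    then show ?thesis
      using koszul_boundary_wedge[of a n C "\<lambda>_. 1" z] aV fC by (simp add: w_def V_def)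
  qed
  \<comment> \<open>The exponent \<open>2\<close> outside \<open>W\<close> prevents those variables from contributing to squarefree multidegrees.\<close>
  define t where "t v = (if v \<in> W then 1 else 2::nat)" for v
  \<comment> \<open>Counting e_v with the degree of its variable, every term has the multidegree of
    the product of all variables.\<close>
  define c :: "nat set \<Rightarrow> 'k mpoly" where "c A = Poly_Mapping.single (face_monom (V - A)) (w A)" for A
  let ?d = "koszul_boundary n (var_power t)"
  have cc: "c A \<in> carrier (poly_ring n)" for A
    unfolding c_def by (rule single_in_carrier) (auto simp: keys_face_monom V_def)
  have dc: "?d c C = Poly_Mapping.single (face_monom (V - C)) (z C)"
    if "C \<subseteq> V" "card C = Suc k" for C
  proof -
    have "ksgn v (insert v C) * var_power t v * c (insert v C)
      = Poly_Mapping.single (face_monom (V - C)) (ksgn v (insert v C) * w (insert v C))"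
      if "v \<in> V - C" for v
    proof (cases "w (insert v C) = 0")
      case False
      then have "v \<in> W" using w_supp by blast
      moreover have "V - insert v C = (V - C) - {v}" by auto
      ultimately show ?thesis
        using face_monom_remove[of "V - C" v] that
        by (simp add: c_def var_power_def t_def mult.assoc mult_single single_ksgn_mult)
    qed (simp add: c_def)
    then have "?d c C = (\<Sum>v\<in>V - C. Poly_Mapping.single (face_monom (V - C)) (ksgn v (insert v C) * w (insert v C)))"
      by (simp add: koszul_boundary_def V_def)
    also have "\<dots> = Poly_Mapping.single (face_monom (V - C)) (\<Sum>v\<in>V - C. ksgn v (insert v C) * w (insert v C))"
    proof -
      have "finite (V - C)" by simp
      then show ?thesis by (induction "V - C" rule: finite_induct)
        (rule poly_mapping_eqI, simp add: lookup_sum lookup_single when_def)+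
    qed
    also have "(\<Sum>v\<in>V - C. ksgn v (insert v C) * w (insert v C)) = z C"
      using dw[OF that] by (simp add: koszul_boundary_def V_def)
    finally show ?thesis .
  qed
  have "\<exists>b. (\<forall>A. b A \<in> carrier (poly_ring n)) \<and>
    (\<forall>A. A \<subseteq> {1..n} \<and> card A = Suc (Suc k) \<longrightarrow> c A - ?d b A \<in> J)"
  proof (rule koszul_acyclicD)
    show "koszul_acyclic n (var_power t) (Suc (Suc k)) J (carrier (poly_ring n))"
      using J(4) by (simp add: e_def)
    show "?d c C \<in> J" if C: "C \<subseteq> {1..n}" "Suc (card C) = Suc (Suc k)" for C
    proof (cases "z C = 0")
      case True
      then show ?thesis using dc[of C] C ideal_poly_ringD(2)[OF J(1)] by (simp add: V_def)
    next
      case False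
      \<comment> \<open>The set C is a face, so its complement is a nonface of the dual.\<close>
      then have "V - C \<notin> \<Gamma>" using supp[of C] C by (simp add: \<Gamma>_iff double_diff V_def)
      then have "Poly_Mapping.single (face_monom (V - C)) (z C) \<in> J"
        using J(2) stanley_reisner_monomial[of "V - C" n \<Gamma>] by (auto simp: V_def)
      then show ?thesis using dc[of C] C by (simp add: V_def)
    qed
  qed (rule cc)
  then obtain b where b: "\<forall>A. A \<subseteq> {1..n} \<and> card A = Suc (Suc k) \<longrightarrow> c A - ?d b A \<in> J"
    by (elim exE conjE)
  \<comment> \<open>Values outside W are set to 0, since multiplication by the square of such a
    variable cannot produce a squarefree monomial.\<close>
  define u where "u A = (if A \<subseteq> W then Poly_Mapping.lookup (b A) (face_monom (V - A)) else 0)" for A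
  have w_du: "w A = koszul_boundary n (\<lambda>_. 1) u A" if A: "A \<subseteq> V" "card A = Suc (Suc k)" for A
  proof (cases "A \<subseteq> W")
    case False
    then have "w A = 0" using w_supp by blast
    moreover have "koszul_boundary n (\<lambda>_. 1) u A = 0"
      unfolding koszul_boundary_def using False by (auto simp: u_def)
    ultimately show ?thesis by simp
  next
    case True
    have fA: "finite A" using finite_subset[OF A(1)] by simp
    let ?m = "face_monom (V - A)"
    \<comment> \<open>A nonface A inside W makes V - A a face of the dual; it equals the support of
      this monomial together with the vertices outside W. By \<open>J_supp\<close> the monomial
      occurs in no element of J.\<close>
    have "V - (V - A) \<notin> \<Delta>" using big[OF True A(2)] A by (simp add: double_diff)
    then have "Poly_Mapping.keys ?m \<union> (V - W) \<in> \<Gamma>"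
      using True by (simp add: keys_face_monom \<Gamma>_iff Un_absorb2 Diff_mono)
    then have "?m \<notin> Poly_Mapping.keys (c A - ?d b A)" using b J_supp A by (auto simp: V_def)
    then have "Poly_Mapping.lookup (c A) ?m = Poly_Mapping.lookup (?d b A) ?m"
      by (simp add: in_keys_iff lookup_minus)
    then have "w A = (\<Sum>v\<in>V - A. ksgn v (insert v A) * Poly_Mapping.lookup (var_power t v * b (insert v A)) ?m)"
      by (simp add: c_def koszul_boundary_def lookup_sum mult.assoc lookup_ksgn_mult V_def)
    also have "\<dots> = (\<Sum>v\<in>V - A. ksgn v (insert v A) * 1 * u (insert v A))"
    proof (rule sum.cong[OF refl])
      fix v assume v: "v \<in> V - A"
      have "Poly_Mapping.lookup (var_power t v * b (insert v A)) ?m = u (insert v A)"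
      proof (cases "v \<in> W")
        case vW: True
        have "V - insert v A = (V - A) - {v}" by auto
        then have "?m - Poly_Mapping.single v 1 = face_monom (V - insert v A)"
          using face_monom_remove[of "V - A" v] v by simp
        then show ?thesis
          using vW v True by (simp add: lookup_var_power_mult t_def lookup_face_monom u_def)
      next
        case False
        then show ?thesis
          using v by (simp add: lookup_var_power_mult t_def lookup_face_monom u_def)
      qed
      then show "ksgn v (insert v A) * Poly_Mapping.lookup (var_power t v * b (insert v A)) ?m
          = ksgn v (insert v A) * 1 * u (insert v A)" by simp
    qed
    also have "\<dots> = koszul_boundary n (\<lambda>_. 1) u A" by (simp add: koszul_boundary_def V_def)
    finally show ?thesis .
  qed
  have B: "B \<subseteq> V" "card B = Suc k" "finite B"
    using supp[OF zB] W finite_subset[of B V] by (auto simp: V_def)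
  have "z B = koszul_boundary n (\<lambda>_. 1) w B" using dw B by simp
  also have "\<dots> = koszul_boundary n (\<lambda>_. 1) (koszul_boundary n (\<lambda>_. 1) u) B"
    by (rule koszul_boundary_cong, rule w_du) (use B in \<open>auto simp: V_def\<close>)
  also have "\<dots> = 0" by (rule koszul_boundary_boundary) (rule B(3))
  finally show False using zB by simp
qed

lemma of_int_koszul_boundary:
  "koszul_boundary n (\<lambda>_. 1) (\<lambda>A. of_int (z A)) A = of_int (koszul_boundary n (\<lambda>_. 1) z A)"
  by (simp add: koszul_boundary_def ksgn_def)

text \<open>If z becomes 0 in the field, all its values are divisible by the characteristic, which
  is positive because \<open>z B0\<close> is nonzero. Dividing keeps a cycle and shrinks the
  absolute value of \<open>z B0\<close>.\<close>

lemma int_cycle_imp_field_cycle: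
  fixes z :: "nat set \<Rightarrow> int"
  assumes "finite S" and "\<And>B. z B \<noteq> 0 \<Longrightarrow> B \<in> S" and "z B0 \<noteq> 0"
    and "\<And>B. B \<in> T \<Longrightarrow> koszul_boundary n (\<lambda>_. 1) z B = 0"
  shows "\<exists>y :: nat set \<Rightarrow> 'k::field. (\<exists>B. y B \<noteq> 0) \<and> (\<forall>B. y B \<noteq> 0 \<longrightarrow> B \<in> S) \<and>
    (\<forall>B\<in>T. koszul_boundary n (\<lambda>_. 1) y B = 0)"
  using assms(2-)
proof (induction "nat \<bar>z B0\<bar>" arbitrary: z rule: less_induct)
  case less
  show ?case
  proof (cases "\<exists>B. (of_int (z B) :: 'k) \<noteq> 0")
    case True
    then show ?thesis
      using less.prems by (intro exI[of _ "\<lambda>B. of_int (z B)"] conjI allI impI ballI)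
        (auto simp: of_int_koszul_boundary, metis of_int_0)
  next
    case False
    define p where "p = CHAR('k)"
    have dvd: "int p dvd z B" for B using False by (auto simp: p_def of_int_eq_0_iff_char_dvd)
    have "p \<noteq> 1" by (simp add: p_def)
    moreover have "p \<noteq> 0" using dvd[of B0] less.prems(2) by auto
    ultimately have p: "2 \<le> p" by simp
    define y where "y B = z B div int p" for B
    have z: "z = (\<lambda>B. int p * y B)" using dvd by (simp add: y_def)
    show ?thesis
    proof (rule less.hyps[of y])
      show "nat \<bar>y B0\<bar> < nat \<bar>z B0\<bar>" using less.prems(2) p by (simp add: z abs_mult)
      show "y B0 \<noteq> 0" using less.prems(2) by (auto simp: z)
      show "B \<in> S" if "y B \<noteq> 0" for B using less.prems(1)[of B] that p by (simp add: z)
      show "koszul_boundary n (\<lambda>_. 1) y B = 0" if "B \<in> T" for B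
        using less.prems(3)[OF that] p unfolding z koszul_boundary_mult by simp
    qed
  qed
qed

section \<open>Alternating chains and barycentric subdivision\<close>

definition remove_nth :: "nat \<Rightarrow> 'a list \<Rightarrow> 'a list" where
  "remove_nth i w = take i w @ drop (Suc i) w"

lemma remove_nth_Cons_0 [simp]: "remove_nth 0 (x # xs) = xs"
  by (simp add: remove_nth_def)

lemma remove_nth_Cons_Suc [simp]: "remove_nth (Suc i) (x # xs) = x # remove_nth i xs"
  by (simp add: remove_nth_def)

lemma length_remove_nth: "i < length w \<Longrightarrow> length (remove_nth i w) = length w - 1"
  by (simp add: remove_nth_def)

lemma nth_remove_nth:
  "i < length w \<Longrightarrow> j < length w - 1 \<Longrightarrow> remove_nth i w ! j = (if j < i then w ! j else w ! Suc j)"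
  by (auto simp: remove_nth_def nth_append min_def)

lemma remove_nth_append:
  "remove_nth i (xs @ ys) = (if i < length xs then remove_nth i xs @ ys else xs @ remove_nth (i - length xs) ys)"
  by (auto simp: remove_nth_def Suc_diff_le)

text \<open>These are the coefficients of the exterior product of the e_v along the list: the sign
  of the sorting permutation at the set of entries, and 0 everywhere if an entry is
  repeated.\<close>

fun wedge_list :: "nat list \<Rightarrow> nat set \<Rightarrow> int" where
  "wedge_list [] = (\<lambda>A. if A = {} then 1 else 0)"
| "wedge_list (v # vs) = koszul_wedge v (wedge_list vs)"

lemma wedge_list_nonzero:
  "wedge_list w A \<noteq> 0 \<Longrightarrow> A = set w \<and> card A = length w"
proof (induction w arbitrary: A)
  case (Cons v vs)
  have v: "v \<in> A" "wedge_list vs (A - {v}) \<noteq> 0"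
    using Cons.prems by (auto simp: koszul_wedge_def split: if_splits)
  from Cons.IH[OF v(2)] have *: "A - {v} = set vs" "card (A - {v}) = length vs" by blast+
  have "finite (A - {v})" unfolding *(1) by simp
  then have "finite A" by simp
  then have "card A = Suc (length vs)" using card_Suc_Diff1[of A v] v(1) *(2) by simp
  moreover have "A = set (v # vs)" using *(1) v(1) by auto
  ultimately show ?case by simp
qed (auto split: if_splits)

text \<open>Iterating the Leibniz rule with all \<open>X v = 1\<close> gives the alternating sum
  over the faces of an ordered simplex.\<close>

lemma koszul_boundary_wedge_list:
  assumes "set w \<subseteq> {1..n}" "finite A"
  shows "koszul_boundary n (\<lambda>_. 1) (wedge_list w) A
    = (\<Sum>i<length w. (-1) ^ i * wedge_list (remove_nth i w) A)"
  using assms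
proof (induction w arbitrary: A)
  case Nil
  then show ?case by (simp add: koszul_boundary_def)
next
  case (Cons v vs)
  have "koszul_boundary n (\<lambda>_. 1) (wedge_list (v # vs)) A
      = wedge_list vs A - koszul_wedge v (koszul_boundary n (\<lambda>_. 1) (wedge_list vs)) A"
    using koszul_boundary_wedge[of v n A "\<lambda>_. 1" "wedge_list vs"] Cons.prems by simp
  also have "koszul_wedge v (koszul_boundary n (\<lambda>_. 1) (wedge_list vs)) A
      = koszul_wedge v (\<lambda>A. \<Sum>i<length vs. (-1) ^ i * wedge_list (remove_nth i vs) A) A"
    using Cons by (simp add: koszul_wedge_def)
  also have "\<dots> = (\<Sum>i<length vs. (-1) ^ i * koszul_wedge v (wedge_list (remove_nth i vs)) A)"
    by (simp add: koszul_wedge_def sum_distrib_left mult_ac)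
  finally show ?case
    by (simp add: sum.lessThan_Suc_shift sum_negf del: sum.lessThan_Suc)
qed

lemma wedge_list_swap:
  "finite A \<Longrightarrow> wedge_list (xs @ a # b # ys) A = - wedge_list (xs @ b # a # ys) A"
proof (induction xs arbitrary: A)
  case Nil
  then show ?case using koszul_wedge_swap by simp
next
  case (Cons x xs)
  then show ?case by (simp add: koszul_wedge_def)
qed

lemma wedge_list_sorted:
  assumes "sorted w" "distinct w"
  shows "wedge_list w A = (if A = set w then 1 else 0)"
  using assms
proof (induction w arbitrary: A)
  case (Cons v vs)
  have lt: "v < u" if "u \<in> set vs" for u using Cons.prems that by (auto simp: less_le)
  show ?case
  proof (cases "v \<in> A \<and> A - {v} = set vs")
    case True
    then have A: "A = insert v (set vs)" by auto
    have "ksgn v A = (1::int)"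
    proof -
      have "{u \<in> A. u < v} = {}" using A lt by (auto simp: not_less_iff_gr_or_eq dest: lt)
      then show ?thesis by (simp only: ksgn_def card.empty power_0)
    qed
    then show ?thesis using True A Cons by (simp add: koszul_wedge_def)
  next
    case False
    moreover have "A \<noteq> insert v (set vs)" using False Cons.prems by auto
    ultimately show ?thesis using Cons by (auto simp: koszul_wedge_def)
  qed
qed auto

definition alternating :: "('a list \<Rightarrow> 'b::ab_group_add) \<Rightarrow> bool" where
  "alternating G \<longleftrightarrow> (\<forall>xs a b ys. G (xs @ a # b # ys) = - G (xs @ b # a # ys))"

text \<open>Insertion sort consists of adjacent swaps, each of which changes the sign on both sides.
  The prefix xs holds the entries already passed.\<close>

lemma alternating_sort:
  fixes G H :: "nat list \<Rightarrow> 'b::ab_group_add"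
  assumes "alternating G" "alternating H" "G (sort w) = H (sort w)"
  shows "G w = H w"
proof -
  have swap: "G (xs @ a # b # ys) = H (xs @ a # b # ys) \<longleftrightarrow> G (xs @ b # a # ys) = H (xs @ b # a # ys)"
    for xs a b ys using assms(1,2) unfolding alternating_def by (metis neg_equal_iff_equal)
  have ins: "G (xs @ x # ys) = H (xs @ x # ys) \<longleftrightarrow> G (xs @ insort x ys) = H (xs @ insort x ys)" for xs x ys
  proof (induction ys arbitrary: xs)
    case (Cons y ys)
    show ?case
      using swap[of xs x y ys] Cons[of "xs @ [y]"] by simp
  qed simp
  have "G (xs @ w) = H (xs @ w) \<longleftrightarrow> G (xs @ sort w) = H (xs @ sort w)" for xs
  proof (induction w arbitrary: xs)
    case (Cons x w)
    show ?case using Cons[of "xs @ [x]"] ins[of xs x "sort w"] by simp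
  qed simp
  from this[of "[]"] show ?thesis using assms(3) by simp
qed

lemma sorted_not_distinct_decomp:
  fixes w :: "'a::linorder list"
  assumes "sorted w" "\<not> distinct w"
  obtains xs a ys where "w = xs @ a # a # ys"
  using assms
proof (induction w arbitrary: thesis)
  case (Cons x w)
  show ?case
  proof (cases "distinct w")
    case True
    then have "x \<in> set w" using Cons by auto
    then obtain y w' where w: "w = y # w'" by (cases w) auto
    then have "x \<le> y" "y \<le> x" using Cons.prems(2) \<open>x \<in> set w\<close> by auto
    then have "x # w = [] @ x # x # w'" using w by simp
    then show ?thesis by (rule Cons.prems(1))
  next
    case False
    then obtain xs a ys where "w = xs @ a # a # ys" using Cons by auto
    then have "x # w = (x # xs) @ a # a # ys" by simp
    then show ?thesis by (rule Cons.prems(1))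
  qed
qed simp

text \<open>Exterior powers are universal for alternating maps. Both sides alternate in w, so they
  need only be compared on sorted lists.\<close>

lemma alternating_eq_sum_wedge_list:
  fixes G :: "nat list \<Rightarrow> 'c \<Rightarrow>\<^sub>0 int"
  assumes G: "alternating G" and w: "set w \<subseteq> {1..n}"
  shows "G w = (\<Sum>B\<in>Pow {1..n}. frag_cmul (wedge_list w B) (G (sorted_list_of_set B)))"
proof -
  \<comment> \<open>Integral chains have no 2-torsion, so both sides vanish on lists with a repeated
    entry.\<close>
  have zero: "x = 0" if "x = - x" for x :: "'c \<Rightarrow>\<^sub>0 int"
  proof (rule poly_mapping_eqI)
    fix k
    have "Poly_Mapping.lookup x k = - Poly_Mapping.lookup x k" using that by (metis lookup_uminus)
    then show "Poly_Mapping.lookup x k = Poly_Mapping.lookup 0 k" by simp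
  qed
  let ?H = "\<lambda>w. \<Sum>B\<in>Pow {1..n}. frag_cmul (wedge_list w B) (G (sorted_list_of_set B))"
  have H: "alternating ?H"
    unfolding alternating_def
  proof (intro allI)
    fix xs ys a b
    have "?H (xs @ a # b # ys) = (\<Sum>B\<in>Pow {1..n}. - frag_cmul (wedge_list (xs @ b # a # ys) B) (G (sorted_list_of_set B)))"
      by (rule sum.cong[OF refl], subst wedge_list_swap) (auto intro: finite_subset)
    then show "?H (xs @ a # b # ys) = - ?H (xs @ b # a # ys)" by (simp only: sum_negf)
  qed
  show ?thesis
  proof (rule alternating_sort[OF G H])
    have sw: "set (sort w) \<subseteq> {1..n}" using w by simp
    show "G (sort w) = ?H (sort w)"
    proof (cases "distinct (sort w)")
      case True
      have "?H (sort w) = (\<Sum>B\<in>Pow {1..n}. if B = set (sort w) then G (sorted_list_of_set (set (sort w))) else 0)"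
        by (rule sum.cong[OF refl]) (use True in \<open>simp add: wedge_list_sorted\<close>)
      also have "\<dots> = G (sorted_list_of_set (set (sort w)))" using sw by (subst sum.delta) auto
      also have "sorted_list_of_set (set (sort w)) = sort w"
        using True by (metis sorted_list_of_set.idem_if_sorted_distinct sorted_sort)
      finally show ?thesis by simp
    next
      case False
      obtain xs a ys where d: "sort w = xs @ a # a # ys"
        by (rule sorted_not_distinct_decomp[OF sorted_sort False])
      have g: "G (sort w) = - G (sort w)" using G unfolding d alternating_def by blast
      have h: "?H (sort w) = - ?H (sort w)" using H unfolding d alternating_def by blast
      show ?thesis by (rule trans[OF zero[OF g] zero[OF h, symmetric]])
    qed
  qed
qed

section \<open>Subdivided affine simplices\<close>

definition affine_simplex :: "(nat \<Rightarrow> real) list \<Rightarrow> (nat \<Rightarrow> real) \<Rightarrow> nat \<Rightarrow> real" where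
  "affine_simplex w = oriented_simplex (length w - 1) (\<lambda>j. w ! j)"

lemma singular_face_affine_simplex:
  assumes "2 \<le> length w" "k < length w"
  shows "singular_face (length w - 1) k (affine_simplex w) = affine_simplex (remove_nth k w)"
proof -
  have "singular_face (length w - 1) k (affine_simplex w)
      = oriented_simplex (length w - 1 - 1) (\<lambda>j. if j < k then w ! j else w ! Suc j)"
    unfolding affine_simplex_def by (rule singular_face_oriented_simplex) (use assms in auto)
  also have "\<dots> = affine_simplex (remove_nth k w)"
    using assms by (auto simp: affine_simplex_def length_remove_nth oriented_simplex_eq nth_remove_nth)
  finally show ?thesis .
qed

definition subdivided :: "(nat \<Rightarrow> real) list \<Rightarrow> (nat \<Rightarrow> real) chain" where
  "subdivided w = simplicial_subdivision (length w - 1) (frag_of (affine_simplex w))"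

lemma simplicial_subdivision_cmul:
  "simplicial_subdivision p (frag_cmul a c) = frag_cmul a (simplicial_subdivision p c)"
  by (cases p) (auto simp: frag_extend_cmul)

lemma simplicial_subdivision_sum:
  "finite I \<Longrightarrow> simplicial_subdivision p (sum f I) = (\<Sum>i\<in>I. simplicial_subdivision p (f i))"
  by (cases p) (auto simp: frag_extend_sum)

text \<open>Writing the recursion for barycentric subdivision with vertex lists permits induction on
  the length of the list.\<close>

lemma subdivided_eq_cone:
  assumes "2 \<le> length w"
  shows "subdivided w = simplicial_cone (length w - 2) (\<lambda>i. (\<Sum>v\<leftarrow>w. v i) / length w)
    (\<Sum>k<length w. frag_cmul ((-1) ^ k) (subdivided (remove_nth k w)))"
proof -
  obtain p where p: "length w = Suc (Suc p)" using assms by (metis Suc_le_D numeral_2_eq_2 Suc_le_mono)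
  have "(\<Sum>j\<le>Suc p. simplicial_vertex j (affine_simplex w) i) = (\<Sum>j<length w. (w ! j) i)" for i
    unfolding affine_simplex_def simplicial_vertex_oriented_simplex
    by (rule sum.cong) (use p in auto)
  also have "(\<Sum>j<length w. (w ! j) i) = (\<Sum>v\<leftarrow>w. v i)" for i
    by (simp add: sum_list_sum_nth atLeast0LessThan)
  finally have bary: "(\<Sum>j\<le>Suc p. simplicial_vertex j (affine_simplex w) i) = (\<Sum>v\<leftarrow>w. v i)" for i .
  have "chain_boundary (Suc p) (frag_of (affine_simplex w))
      = (\<Sum>k<length w. frag_cmul ((-1) ^ k) (frag_of (affine_simplex (remove_nth k w))))"
    unfolding chain_boundary_of p lessThan_Suc_atMost using singular_face_affine_simplex[of w] p
    by (auto intro!: sum.cong)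
  then have sd: "simplicial_subdivision p (chain_boundary (Suc p) (frag_of (affine_simplex w)))
      = (\<Sum>k<length w. frag_cmul ((-1) ^ k) (subdivided (remove_nth k w)))"
    using p by (auto simp: simplicial_subdivision_sum simplicial_subdivision_cmul subdivided_def
        length_remove_nth intro!: sum.cong simp del: sum.lessThan_Suc)
  have "subdivided w = simplicial_cone p
      (\<lambda>i. (\<Sum>j\<le>Suc p. simplicial_vertex j (affine_simplex w) i) / Suc (Suc p))
      (simplicial_subdivision p (chain_boundary (Suc p) (frag_of (affine_simplex w))))"
    by (simp only: subdivided_def p simplicial_subdivision_of diff_Suc_1 nat.distinct if_False)
  then show ?thesis
    unfolding bary sd by (simp only: p diff_Suc_Suc diff_zero numeral_2_eq_2)
qed

lemma frag_cmul_uminus: "frag_cmul k (- c) = frag_cmul (- k) c"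
  by (rule poly_mapping_eqI) simp

lemma simplicial_cone_uminus: "simplicial_cone p v (- c) = - simplicial_cone p v c"
  by (simp add: simplicial_cone_def frag_extend_minus)

text \<open>The barycentre is symmetric in the vertices, and the cone over it is taken of an alternating
  boundary. So after one subdivision affine chains only depend on oriented simplices.\<close>

lemma alternating_subdivided: "alternating subdivided"
proof -
  have "subdivided (xs @ a # b # ys) = - subdivided (xs @ b # a # ys)" for xs a b ys
  proof (induction "length xs + length ys" arbitrary: xs ys rule: less_induct)
    case less
    let ?w = "xs @ a # b # ys" and ?w' = "xs @ b # a # ys"
    let ?f = "\<lambda>k. frag_cmul ((-1) ^ k) (subdivided (remove_nth k ?w))"
    let ?f' = "\<lambda>k. frag_cmul ((-1) ^ k) (subdivided (remove_nth k ?w'))"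
    let ?n = "length xs" and ?m = "length ys"
    have split: "{..<?n + ?m + 2} = {..<?n} \<union> {?n, Suc ?n} \<union> {?n + 2..<?n + ?m + 2}" by auto
    have sum: "(\<Sum>k<?n + ?m + 2. g k) = (\<Sum>k<?n. g k) + (g ?n + g (Suc ?n)) + (\<Sum>k=?n+2..<?n + ?m + 2. g k)"
      for g :: "nat \<Rightarrow> (nat \<Rightarrow> real) chain"
      unfolding split by (subst sum.union_disjoint; (subst sum.union_disjoint)?) auto
    have neg: "(\<Sum>k<?n + ?m + 2. g k) = - (\<Sum>k<?n + ?m + 2. g' k)"
      if "\<And>k. k < ?n \<Longrightarrow> g k = - g' k" "\<And>k. ?n + 2 \<le> k \<Longrightarrow> k < ?n + ?m + 2 \<Longrightarrow> g k = - g' k"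
        "g ?n + g (Suc ?n) = - (g' ?n + g' (Suc ?n))" for g g' :: "nat \<Rightarrow> (nat \<Rightarrow> real) chain"
    proof -
      have "(\<Sum>k<?n. g k) = - (\<Sum>k<?n. g' k)"
        "(\<Sum>k=?n+2..<?n + ?m + 2. g k) = - (\<Sum>k=?n+2..<?n + ?m + 2. g' k)"
        unfolding sum_negf[symmetric] by (rule sum.cong; use that in auto)+
      then show ?thesis unfolding sum that(3) by (simp only: minus_add_distrib)
    qed
    have "?f k = - ?f' k" if "k < ?n" for k
      using that less[of "remove_nth k xs" ys]
      by (simp add: remove_nth_append length_remove_nth frag_cmul_uminus)
    moreover have "?f k = - ?f' k" if k: "?n + 2 \<le> k" "k < ?n + ?m + 2" for k
    proof -
      obtain i where i: "k = Suc (Suc (?n + i))" "i < ?m"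
        using k by (auto simp: le_iff_add)
      then have "remove_nth k ?w = xs @ a # b # remove_nth i ys" "remove_nth k ?w' = xs @ b # a # remove_nth i ys"
        by (simp_all add: remove_nth_append)
      moreover have "length (remove_nth i ys) < ?m" using i by (simp add: length_remove_nth)
      ultimately show ?thesis using less[of xs "remove_nth i ys"] by (simp add: frag_cmul_uminus)
    qed
    \<comment> \<open>Deleting one of the two swapped vertices leaves the same list on both sides,
      but at neighbouring positions and hence with opposite signs.\<close>
    moreover have "?f ?n + ?f (Suc ?n) = - (?f' ?n + ?f' (Suc ?n))"
      by (simp add: remove_nth_append)
    ultimately have *: "(\<Sum>k<?n + ?m + 2. ?f k) = - (\<Sum>k<?n + ?m + 2. ?f' k)"
      by (rule neg)
    have l: "length ?w = ?n + ?m + 2" "length ?w' = ?n + ?m + 2" by simp_all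
    have s: "(\<Sum>v\<leftarrow>?w. v i) = (\<Sum>v\<leftarrow>?w'. v i)" for i by simp
    have "2 \<le> length ?w" "2 \<le> length ?w'" by simp_all
    note e = this[THEN subdivided_eq_cone]
    show ?case unfolding e l s * simplicial_cone_uminus ..
  qed
  then show ?thesis unfolding alternating_def by blast
qed

text \<open>This is linear extension to integer values, the counterpart of
  \<open>frag_extend\<close>.\<close>

definition frag_lin :: "('a \<Rightarrow> int) \<Rightarrow> ('a \<Rightarrow>\<^sub>0 int) \<Rightarrow> int" where
  "frag_lin f c = (\<Sum>x\<in>Poly_Mapping.keys c. Poly_Mapping.lookup c x * f x)"

lemma frag_lin_superset:
  "finite S \<Longrightarrow> Poly_Mapping.keys c \<subseteq> S \<Longrightarrow> frag_lin f c = (\<Sum>x\<in>S. Poly_Mapping.lookup c x * f x)"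
  unfolding frag_lin_def by (rule sum.mono_neutral_left) (auto simp: in_keys_iff)

lemma frag_lin_0 [simp]: "frag_lin f 0 = 0"
  by (simp add: frag_lin_def)

lemma frag_lin_of [simp]: "frag_lin f (frag_of x) = f x"
  by (simp add: frag_lin_def)

lemma frag_lin_diff: "frag_lin f (a - b) = frag_lin f a - frag_lin f b"
proof -
  let ?S = "Poly_Mapping.keys a \<union> Poly_Mapping.keys b"
  have "Poly_Mapping.keys (a - b) \<subseteq> ?S" by (rule keys_diff)
  then show ?thesis
    by (simp add: frag_lin_superset[of ?S] lookup_minus left_diff_distrib sum_subtractf)
qed

lemma frag_lin_uminus: "frag_lin f (- a) = - frag_lin f a"
  using frag_lin_diff[of f 0 a] by simp

lemma frag_lin_sum: "finite I \<Longrightarrow> frag_lin f (sum g I) = (\<Sum>i\<in>I. frag_lin f (g i))"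
proof (induction I rule: finite_induct)
  case (insert x F)
  have "frag_lin f (g x + sum g F) = frag_lin f (g x) - frag_lin f (- sum g F)"
    using frag_lin_diff[of f "g x" "- sum g F"] by simp
  then show ?case using insert by (simp add: frag_lin_uminus)
qed simp

lemma frag_lin_cmul: "frag_lin f (frag_cmul k c) = k * frag_lin f c"
  by (subst frag_lin_superset[of "Poly_Mapping.keys c"]) (auto simp: frag_lin_def sum_distrib_left mult_ac)

text \<open>Transposing the boundary lets a combinatorial boundary of labels be computed from the
  singular boundary of the chain.\<close>

lemma frag_lin_chain_boundary:
  assumes "0 < p"
  shows "frag_lin f (chain_boundary p c) = frag_lin (\<lambda>\<sigma>. \<Sum>k\<le>p. (-1) ^ k * f (singular_face p k \<sigma>)) c"
  using subset_UNIV
proof (induction c rule: frag_induction)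
  case (one x)
  then show ?case using assms by (simp add: chain_boundary_of frag_lin_sum frag_lin_cmul)
next
  case (diff a b)
  then show ?case by (simp add: chain_boundary_diff frag_lin_diff)
qed simp

section \<open>The prism operator\<close>

definition degeneracy :: "nat \<Rightarrow> (nat \<Rightarrow> real) \<Rightarrow> nat \<Rightarrow> real" where
  "degeneracy i x = (\<lambda>j. if j < i then x j else if j = i then x i + x (Suc i) else x (Suc j))"

text \<open>This and the next two lemmas are the cosimplicial identities; they decide to which
  smaller prism a face of a prism belongs.\<close>

lemma degeneracy_face_lt:
  assumes "k < i"
  shows "degeneracy i (simplical_face k x) = simplical_face k (degeneracy (i - 1) x)"
proof
  fix j
  obtain i' where i: "i = Suc i'" using assms by (cases i) auto
  show "degeneracy i (simplical_face k x) j = simplical_face k (degeneracy (i - 1) x) j"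
    using assms by (cases j) (auto simp: degeneracy_def simplical_face_def i)
qed

lemma degeneracy_face_gt:
  assumes "Suc i < k"
  shows "degeneracy i (simplical_face k x) = simplical_face (k - 1) (degeneracy i x)"
proof
  fix j
  obtain k' where k: "k = Suc k'" using assms by (cases k) auto
  show "degeneracy i (simplical_face k x) j = simplical_face (k - 1) (degeneracy i x) j"
    using assms by (cases j) (auto simp: degeneracy_def simplical_face_def k)
qed

lemma degeneracy_face_eq:
  "k = i \<or> k = Suc i \<Longrightarrow> degeneracy i (simplical_face k x) = x"
  by (rule ext) (auto simp: degeneracy_def simplical_face_def)

text \<open>The time coordinate of a prism is 1 minus a partial sum, so this describes time on the
  faces.\<close>

lemma sum_simplical_face:
  fixes x :: "nat \<Rightarrow> real"
  shows "(\<Sum>j\<le>i. simplical_face k x j) = (if k \<le> i then \<Sum>j<i. x j else \<Sum>j\<le>i. x j)"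
proof (induction i)
  case 0
  show ?case by (simp add: simplical_face_def)
next
  case (Suc i)
  have "(\<Sum>j\<le>Suc i. simplical_face k x j)
      = (if k \<le> i then \<Sum>j<i. x j else \<Sum>j\<le>i. x j) + simplical_face k x (Suc i)"
    by (simp add: Suc)
  also have "simplical_face k x (Suc i) = (if k \<le> i then x i else if k = Suc i then 0 else x (Suc i))"
    by (auto simp: simplical_face_def)
  finally show ?case
    by (cases "k \<le> i"; cases "k = Suc i") (auto simp flip: lessThan_Suc_atMost)
qed

lemma sum_degeneracy:
  assumes "i \<le> q"
  shows "(\<Sum>j\<le>q. degeneracy i x j) = (\<Sum>j\<le>Suc q. x j)"
  using assms
proof (induction q rule: dec_induct)
  case base
  have "(\<Sum>j\<le>i. degeneracy i x j) = (\<Sum>j<i. degeneracy i x j) + degeneracy i x i"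
    by (simp flip: lessThan_Suc_atMost)
  also have "\<dots> = (\<Sum>j<i. x j) + (x i + x (Suc i))" by (simp add: degeneracy_def)
  finally show ?case by (simp flip: lessThan_Suc_atMost)
next
  case (step q)
  then show ?case by (simp add: degeneracy_def)
qed

lemma standard_simplexI:
  assumes "\<And>i. 0 \<le> x i" "\<And>i. p < i \<Longrightarrow> x i = 0" "(\<Sum>i\<le>p. x i) = 1"
  shows "x \<in> standard_simplex p"
proof -
  have "x i \<le> 1" for i
  proof (cases "i \<le> p")
    case True
    then have "x i \<le> (\<Sum>i\<le>p. x i)" by (intro member_le_sum) (use assms(1) in auto)
    then show ?thesis using assms(3) by simp
  qed (use assms(2) in auto)
  then show ?thesis using assms by (simp add: standard_simplex_def)
qed

lemma degeneracy_in_standard_simplex: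
  assumes "x \<in> standard_simplex (Suc q)" "i \<le> q"
  shows "degeneracy i x \<in> standard_simplex q"
proof (rule standard_simplexI)
  show "(\<Sum>j\<le>q. degeneracy i x j) = 1"
    using assms sum_degeneracy[OF assms(2), of x] by (simp add: standard_simplex_def)
qed (use assms in \<open>auto simp: standard_simplex_def degeneracy_def\<close>)

lemma partial_sum_standard_simplex:
  assumes "x \<in> standard_simplex p" "finite I"
  shows "0 \<le> sum x I" "sum x I \<le> 1"
proof -
  have nn: "0 \<le> x i" for i using assms by (simp add: standard_simplex_def)
  then show "0 \<le> sum x I" by (simp add: sum_nonneg)
  have "sum x I \<le> sum x (I \<union> {..p})" by (rule sum_mono2) (use assms nn in auto)
  also have "\<dots> = sum x {..p}" by (rule sum.mono_neutral_right) (use assms in \<open>auto simp: standard_simplex_def\<close>)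
  finally show "sum x I \<le> 1" using assms by (simp add: standard_simplex_def)
qed

text \<open>A homotopy is prescribed separately on every singular simplex \<open>\<sigma>\<close>, as \<open>h q \<sigma> s t\<close> with time \<open>s\<close>
  and \<open>t\<close> in the standard \<open>q\<close>-simplex; only compatibility with faces is required.\<close>

definition prism ::
  "(nat \<Rightarrow> ((nat \<Rightarrow> real) \<Rightarrow> 'a) \<Rightarrow> real \<Rightarrow> (nat \<Rightarrow> real) \<Rightarrow> 'a) \<Rightarrow> nat \<Rightarrow> nat \<Rightarrow>
    ((nat \<Rightarrow> real) \<Rightarrow> 'a) \<Rightarrow> (nat \<Rightarrow> real) \<Rightarrow> 'a" where
  "prism h q i \<sigma> = restrict (\<lambda>x. h q \<sigma> (1 - (\<Sum>j\<le>i. x j)) (degeneracy i x)) (standard_simplex (Suc q))"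

text \<open>The walls separate consecutive prisms. The wall m = 0 lies at time 1 and m = q + 1 at
  time 0; the others are interior.\<close>

definition prism_wall ::
  "(nat \<Rightarrow> ((nat \<Rightarrow> real) \<Rightarrow> 'a) \<Rightarrow> real \<Rightarrow> (nat \<Rightarrow> real) \<Rightarrow> 'a) \<Rightarrow> nat \<Rightarrow> nat \<Rightarrow>
    ((nat \<Rightarrow> real) \<Rightarrow> 'a) \<Rightarrow> (nat \<Rightarrow> real) \<Rightarrow> 'a" where
  "prism_wall h q m \<sigma> = restrict (\<lambda>x. h q \<sigma> (1 - (\<Sum>j<m. x j)) x) (standard_simplex q)"

definition prism_chain where
  "prism_chain h q \<sigma> = (\<Sum>i\<le>q. frag_cmul ((-1) ^ i) (frag_of (prism h q i \<sigma>)))"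

definition face_natural where
  "face_natural h \<longleftrightarrow> (\<forall>q \<sigma> k s t. 1 \<le> q \<longrightarrow> k \<le> q \<longrightarrow> t \<in> standard_simplex (q - 1) \<longrightarrow>
     h (q - 1) (singular_face q k \<sigma>) s t = h q \<sigma> s (simplical_face k t))"

lemma face_naturalD:
  "face_natural h \<Longrightarrow> 1 \<le> q \<Longrightarrow> k \<le> q \<Longrightarrow> t \<in> standard_simplex (q - 1) \<Longrightarrow>
     h (q - 1) (singular_face q k \<sigma>) s t = h q \<sigma> s (simplical_face k t)"
  by (simp add: face_natural_def)

text \<open>The right-hand side does not involve i, so the same wall is a face of two neighbouring
  prisms.\<close>

lemma singular_face_prism_eq:
  assumes "k = i \<or> k = Suc i" "i \<le> q"
  shows "singular_face (Suc q) k (prism h q i \<sigma>) = prism_wall h q k \<sigma>"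
proof
  fix x
  have "simplical_face k x \<in> standard_simplex (Suc q)" if "x \<in> standard_simplex q"
    using simplical_face_in_standard_simplex[of "Suc q" k x] that assms by auto
  then show "singular_face (Suc q) k (prism h q i \<sigma>) x = prism_wall h q k \<sigma> x"
    using assms by (auto simp: singular_face_def prism_def prism_wall_def restrict_def
        degeneracy_face_eq sum_simplical_face lessThan_Suc_atMost)
qed

lemma singular_face_prism_lt:
  assumes "face_natural h" "k < i" "i \<le> q"
  shows "singular_face (Suc q) k (prism h q i \<sigma>) = prism h (q - 1) (i - 1) (singular_face q k \<sigma>)"
proof
  fix x
  obtain i' where i: "i = Suc i'" using assms(2) by (cases i) auto
  obtain q' where q: "q = Suc q'" using assms by (cases q) auto
  show "singular_face (Suc q) k (prism h q i \<sigma>) x = prism h (q - 1) (i - 1) (singular_face q k \<sigma>) x"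
  proof (cases "x \<in> standard_simplex q")
    case True
    then have fx: "simplical_face k x \<in> standard_simplex (Suc q)"
      using simplical_face_in_standard_simplex[of "Suc q" k x] assms by auto
    have dx: "degeneracy i' x \<in> standard_simplex q'"
      by (rule degeneracy_in_standard_simplex) (use True i q assms in auto)
    have "singular_face (Suc q) k (prism h q i \<sigma>) x
        = h q \<sigma> (1 - (\<Sum>j\<le>i. simplical_face k x j)) (degeneracy i (simplical_face k x))"
      using True fx by (simp add: singular_face_def prism_def)
    also have "\<dots> = h q \<sigma> (1 - (\<Sum>j\<le>i'. x j)) (simplical_face k (degeneracy i' x))"
      using assms by (simp add: sum_simplical_face degeneracy_face_lt i lessThan_Suc_atMost del: sum.atMost_Suc)
    also have "\<dots> = h (q - 1) (singular_face q k \<sigma>) (1 - (\<Sum>j\<le>i'. x j)) (degeneracy i' x)"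
      using face_naturalD[OF assms(1), of q k "degeneracy i' x"] assms dx by (simp add: q)
    also have "\<dots> = prism h (q - 1) (i - 1) (singular_face q k \<sigma>) x"
      using True by (simp add: prism_def q i)
    finally show ?thesis .
  qed (simp add: singular_face_def prism_def q)
qed

lemma singular_face_prism_gt:
  assumes "face_natural h" "Suc i < k" "k \<le> Suc q"
  shows "singular_face (Suc q) k (prism h q i \<sigma>) = prism h (q - 1) i (singular_face q (k - 1) \<sigma>)"
proof
  fix x
  obtain k' where k: "k = Suc k'" using assms(2) by (cases k) auto
  obtain q' where q: "q = Suc q'" using assms by (cases q) auto
  show "singular_face (Suc q) k (prism h q i \<sigma>) x = prism h (q - 1) i (singular_face q (k - 1) \<sigma>) x"
  proof (cases "x \<in> standard_simplex q")
    case True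
    then have fx: "simplical_face k x \<in> standard_simplex (Suc q)"
      using simplical_face_in_standard_simplex[of "Suc q" k x] assms by auto
    have dx: "degeneracy i x \<in> standard_simplex q'"
      by (rule degeneracy_in_standard_simplex) (use True k q assms in auto)
    have "singular_face (Suc q) k (prism h q i \<sigma>) x
        = h q \<sigma> (1 - (\<Sum>j\<le>i. simplical_face k x j)) (degeneracy i (simplical_face k x))"
      using True fx by (simp add: singular_face_def prism_def)
    also have "\<dots> = h q \<sigma> (1 - (\<Sum>j\<le>i. x j)) (simplical_face k' (degeneracy i x))"
      using assms degeneracy_face_gt[OF assms(2), of x] by (simp add: sum_simplical_face k)
    also have "\<dots> = h (q - 1) (singular_face q k' \<sigma>) (1 - (\<Sum>j\<le>i. x j)) (degeneracy i x)"
      using face_naturalD[OF assms(1), of q k' "degeneracy i x"] assms dx by (simp add: q k)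
    also have "\<dots> = prism h (q - 1) i (singular_face q (k - 1) \<sigma>) x"
      using True by (simp add: prism_def q k)
    finally show ?thesis .
  qed (simp add: singular_face_def prism_def q)
qed

text \<open>This is the chain homotopy formula: top minus bottom minus the prism over the
  boundary.\<close>

lemma chain_boundary_prism_chain:
  assumes nat: "face_natural h" and q: "1 \<le> q"
  shows "chain_boundary (Suc q) (prism_chain h q \<sigma>)
    = frag_of (prism_wall h q 0 \<sigma>) - frag_of (prism_wall h q (Suc q) \<sigma>)
      - frag_extend (prism_chain h (q - 1)) (chain_boundary q (frag_of \<sigma>))"
proof -
  define F where "F i k = frag_cmul ((-1) ^ (i + k)) (frag_of (singular_face (Suc q) k (prism h q i \<sigma>)))" for i k
  define G where "G i k = frag_cmul ((-1) ^ (i + k)) (frag_of (prism h (q - 1) i (singular_face q k \<sigma>)))" for i k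
  \<comment> \<open>A and B index the walls, whose contributions telescope; C and D index the faces
    that are prisms over faces of \<sigma>.\<close>
  define A B C D where ABCD: "A = (\<lambda>i. (i, i)) ` {..q}" "B = (\<lambda>i. (i, Suc i)) ` {..q}"
    "C = {(i, k). k < i \<and> i \<le> q}" "D = {(i, k). Suc i < k \<and> k \<le> Suc q}"
  have fin: "finite A" "finite B" "finite C" "finite D"
    by (rule finite_subset[of _ "{..q} \<times> {..Suc q}"]; auto simp: ABCD)+
  have disj: "(A \<union> B \<union> C) \<inter> D = {}" "(A \<union> B) \<inter> C = {}" "A \<inter> B = {}" by (auto simp: ABCD)
  define w where "w m = frag_of (prism_wall h q m \<sigma>)" for m
  have "chain_boundary (Suc q) (prism_chain h q \<sigma>) = (\<Sum>i\<le>q. \<Sum>k\<le>Suc q. F i k)"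
    unfolding prism_chain_def F_def
    by (simp add: chain_boundary_sum chain_boundary_cmul chain_boundary_of frag_cmul_sum power_add
        o_def frag_cmul_distrib2 del: sum.atMost_Suc)
  also have "\<dots> = (\<Sum>(i,k)\<in>{..q} \<times> {..Suc q}. F i k)"
    by (simp add: sum.cartesian_product del: sum.atMost_Suc)
  also have "{..q} \<times> {..Suc q} = A \<union> B \<union> C \<union> D"
    by (auto simp: ABCD image_iff)
  also have "(\<Sum>(i,k)\<in>A \<union> B \<union> C \<union> D. F i k)
      = (\<Sum>(i,k)\<in>A. F i k) + (\<Sum>(i,k)\<in>B. F i k) + (\<Sum>(i,k)\<in>C. F i k) + (\<Sum>(i,k)\<in>D. F i k)"
    using fin disj by (simp add: sum.union_disjoint)
  also have "(\<Sum>(i,k)\<in>A. F i k) = (\<Sum>i\<le>q. w i)"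
    unfolding ABCD by (subst sum.reindex) (auto simp: inj_on_def F_def w_def singular_face_prism_eq simp flip: power_add intro!: sum.cong)
  also have "(\<Sum>(i,k)\<in>B. F i k) = (\<Sum>i\<le>q. - w (Suc i))"
    unfolding ABCD by (subst sum.reindex) (auto simp: inj_on_def F_def w_def singular_face_prism_eq simp flip: power_add intro!: sum.cong)
  also have "(\<Sum>(i,k)\<in>C. F i k) = (\<Sum>(i,k)\<in>{(i, k). k \<le> i \<and> i < q}. - G i k)"
    unfolding ABCD
  proof (rule sum.reindex_bij_witness[of _ "\<lambda>(i, k). (Suc i, k)" "\<lambda>(i, k). (i - 1, k)"], goal_cases)
    case (5 a)
    then obtain i k where a: "a = (Suc i, k)" "k \<le> i" "i < q" by (cases a; cases "fst a") auto
    then show ?case using singular_face_prism_lt[OF nat, of k "Suc i" q \<sigma>] by (simp add: F_def G_def)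
  qed auto
  also have "(\<Sum>(i,k)\<in>D. F i k) = (\<Sum>(i,k)\<in>{(i, k). i < k \<and> k \<le> q}. - G i k)"
    unfolding ABCD
  proof (rule sum.reindex_bij_witness[of _ "\<lambda>(i, k). (i, Suc k)" "\<lambda>(i, k). (i, k - 1)"], goal_cases)
    case (5 a)
    then obtain i k where a: "a = (i, Suc k)" "i < k" "k \<le> q" by (cases a; cases "snd a") auto
    then show ?case using singular_face_prism_gt[OF nat, of i "Suc k" q \<sigma>] by (simp add: F_def G_def)
  qed auto
  also have "(\<Sum>i\<le>q. w i) + (\<Sum>i\<le>q. - w (Suc i)) = w 0 - w (Suc q)"
    using sum_telescope[of w q] by (simp add: sum_negf sum_subtractf)
  also have "w 0 - w (Suc q) + (\<Sum>(i,k)\<in>{(i, k). k \<le> i \<and> i < q}. - G i k)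
        + (\<Sum>(i,k)\<in>{(i, k). i < k \<and> k \<le> q}. - G i k)
      = w 0 - w (Suc q) - (\<Sum>(i,k)\<in>{(i, k). k \<le> i \<and> i < q} \<union> {(i, k). i < k \<and> k \<le> q}. G i k)"
    by (subst sum.union_disjoint)
      (auto simp: sum_negf case_prod_beta intro: finite_subset[of _ "{..q} \<times> {..q}"])
  also have "{(i, k). k \<le> i \<and> i < q} \<union> {(i, k). i < k \<and> k \<le> q} = {..q - 1} \<times> {..q}"
    using q by auto
  also have "(\<Sum>(i,k)\<in>{..q - 1} \<times> {..q}. G i k)
      = frag_extend (prism_chain h (q - 1)) (chain_boundary q (frag_of \<sigma>))"
    using q unfolding G_def prism_chain_def
    by (subst sum.cartesian_product[symmetric], subst sum.swap)
      (simp add: chain_boundary_of frag_extend_sum frag_extend_cmul frag_cmul_sum o_def power_add mult.commute)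
  finally show ?thesis by (simp add: w_def)
qed

section \<open>Singular cycles in a geometric realization\<close>

definition realization_points :: "nat set set \<Rightarrow> (nat \<Rightarrow> real) set" where
  "realization_points \<Delta> =
     {x. (\<forall>i. 0 \<le> x i) \<and> (\<exists>F\<in>\<Delta>. (\<forall>i. i \<notin> F \<longrightarrow> x i = 0) \<and> (\<Sum>i\<in>F. x i) = 1)}"

lemma geometric_realization_eq: "geometric_realization \<Delta> = top_of_set (realization_points \<Delta>)"
  by (simp add: geometric_realization_def realization_points_def euclidean_product_topology)

lemma singular_simplex_realization:
  "singular_simplex q (geometric_realization \<Delta>) \<sigma> \<longleftrightarrow>
     continuous_on (standard_simplex q) \<sigma> \<and> \<sigma> \<in> standard_simplex q \<rightarrow> realization_points \<Delta> \<and>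
     \<sigma> \<in> extensional (standard_simplex q)"
  by (auto simp: singular_simplex_def geometric_realization_eq euclidean_product_topology)

section \<open>Moving small singular simplices to labelled vertices\<close>

definition corner :: "nat \<Rightarrow> nat \<Rightarrow> real" where
  "corner v = (\<lambda>i. if i = v then 1 else 0)"

lemma corner_in_standard_simplex: "l \<le> q \<Longrightarrow> corner l \<in> standard_simplex q"
  by (simp add: corner_def)

lemma simplical_face_corner: "simplical_face k (corner l) = corner (if l < k then l else Suc l)"
  by (rule ext) (auto simp: simplical_face_def corner_def)

definition corner_labels :: "((nat \<Rightarrow> real) \<Rightarrow> nat) \<Rightarrow> nat \<Rightarrow> ((nat \<Rightarrow> real) \<Rightarrow> nat \<Rightarrow> real) \<Rightarrow> nat list" where
  "corner_labels lab q \<sigma> = map (\<lambda>l. lab (\<sigma> (corner l))) [0..<Suc q]"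

lemma length_corner_labels [simp]: "length (corner_labels lab q \<sigma>) = Suc q"
  by (simp add: corner_labels_def del: upt_Suc)

lemma corner_labels_face:
  assumes "1 \<le> q" "k \<le> q"
  shows "corner_labels lab (q - 1) (singular_face q k \<sigma>) = remove_nth k (corner_labels lab q \<sigma>)"
proof (rule nth_equalityI)
  show "length (corner_labels lab (q - 1) (singular_face q k \<sigma>)) = length (remove_nth k (corner_labels lab q \<sigma>))"
    using assms by (simp add: length_remove_nth)
  fix j assume "j < length (corner_labels lab (q - 1) (singular_face q k \<sigma>))"
  then have j: "j < q" using assms by simp
  then have "singular_face q k \<sigma> (corner j) = \<sigma> (corner (if j < k then j else Suc j))"
    using corner_in_standard_simplex[of j "q - 1"]
    by (simp add: singular_face_def simplical_face_corner)
  then show "corner_labels lab (q - 1) (singular_face q k \<sigma>) ! j = remove_nth k (corner_labels lab q \<sigma>) ! j"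
    using j assms by (simp add: nth_remove_nth corner_labels_def del: upt_Suc)
qed

text \<open>This plays the role of a simplicial approximation of \<sigma>: each corner goes to the
  vertex that labels its image.\<close>

definition label_simplex where
  "label_simplex lab q \<sigma> = affine_simplex (map corner (corner_labels lab q \<sigma>))"

lemma label_simplex_eq:
  "t \<in> standard_simplex q \<Longrightarrow>
    label_simplex lab q \<sigma> t i = (\<Sum>l\<le>q. if i = lab (\<sigma> (corner l)) then t l else 0)"
  by (auto simp: label_simplex_def affine_simplex_def oriented_simplex_def corner_labels_def corner_def
      nth_append if_distrib[of "\<lambda>x. x * _"] simp del: upt_Suc cong: if_cong intro!: sum.cong)

lemma map_remove_nth: "map f (remove_nth k w) = remove_nth k (map f w)"
  by (simp add: remove_nth_def take_map drop_map)

lemma label_simplex_face: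
  assumes "1 \<le> q" "k \<le> q"
  shows "label_simplex lab (q - 1) (singular_face q k \<sigma>) = singular_face q k (label_simplex lab q \<sigma>)"
  unfolding label_simplex_def corner_labels_face[OF assms] map_remove_nth
  using singular_face_affine_simplex[of "map corner (corner_labels lab q \<sigma>)" k] assms by simp

definition label_homotopy where
  "label_homotopy lab q \<sigma> s t = (\<lambda>i. (1 - s) * \<sigma> t i + s * label_simplex lab q \<sigma> t i)"

lemma face_natural_label_homotopy: "face_natural (label_homotopy lab)"
  unfolding face_natural_def
proof (intro allI impI)
  fix q \<sigma> k s and t :: "nat \<Rightarrow> real" assume "1 \<le> q" "k \<le> q" "t \<in> standard_simplex (q - 1)"
  then show "label_homotopy lab (q - 1) (singular_face q k \<sigma>) s t = label_homotopy lab q \<sigma> s (simplical_face k t)"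
    unfolding label_homotopy_def label_simplex_face[OF \<open>1 \<le> q\<close> \<open>k \<le> q\<close>]
    by (simp add: singular_face_def)
qed

text \<open>Every label used on \<sigma> has positive coordinate all over \<sigma>. Hence each face
  containing a point of \<sigma> in its simplex also contains all the labels, and straight lines to
  the label simplex stay in the complex.\<close>

definition label_small ::
  "((nat \<Rightarrow> real) \<Rightarrow> nat) \<Rightarrow> nat set set \<Rightarrow> nat \<Rightarrow> ((nat \<Rightarrow> real) \<Rightarrow> nat \<Rightarrow> real) \<Rightarrow> bool" where
  "label_small lab \<Delta> q \<sigma> \<longleftrightarrow> singular_simplex q (geometric_realization \<Delta>) \<sigma> \<and>
     (\<forall>a\<in>standard_simplex q. \<forall>b\<in>standard_simplex q. 0 < \<sigma> a (lab (\<sigma> b)))"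

lemma label_simplex_sum:
  assumes t: "t \<in> standard_simplex q" and F: "\<And>l. l \<le> q \<Longrightarrow> lab (\<sigma> (corner l)) \<in> F" "finite F"
  shows "(\<Sum>i\<in>F. label_simplex lab q \<sigma> t i) = 1"
proof -
  have "(\<Sum>i\<in>F. label_simplex lab q \<sigma> t i)
      = (\<Sum>l\<le>q. \<Sum>i\<in>F. if i = lab (\<sigma> (corner l)) then t l else 0)"
    unfolding label_simplex_eq[OF t] by (rule sum.swap)
  also have "\<dots> = (\<Sum>l\<le>q. t l)"
    by (rule sum.cong[OF refl]) (use F in simp)
  finally show ?thesis using t by (simp add: standard_simplex_def)
qed

lemma label_small_face:
  assumes fin: "\<And>F. F \<in> \<Delta> \<Longrightarrow> finite F" and "label_small lab \<Delta> q \<sigma>" "t \<in> standard_simplex q"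
  shows "\<exists>F\<in>\<Delta>. finite F \<and> (\<forall>i. 0 \<le> \<sigma> t i) \<and> (\<forall>i. i \<notin> F \<longrightarrow> \<sigma> t i = 0) \<and> (\<Sum>i\<in>F. \<sigma> t i) = 1 \<and>
    (\<forall>l\<le>q. lab (\<sigma> (corner l)) \<in> F)"
proof -
  have "\<sigma> t \<in> realization_points \<Delta>"
    using assms(2,3) by (auto simp: label_small_def singular_simplex_realization)
  then obtain F where F: "F \<in> \<Delta>" "\<forall>i. 0 \<le> \<sigma> t i" "\<forall>i. i \<notin> F \<longrightarrow> \<sigma> t i = 0" "(\<Sum>i\<in>F. \<sigma> t i) = 1"
    unfolding realization_points_def by blast
  have "lab (\<sigma> (corner l)) \<in> F" if "l \<le> q" for l
  proof (rule ccontr)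
    assume "lab (\<sigma> (corner l)) \<notin> F"
    then have "\<sigma> t (lab (\<sigma> (corner l))) = 0" using F by blast
    moreover have "0 < \<sigma> t (lab (\<sigma> (corner l)))"
      using assms(2,3) corner_in_standard_simplex[OF that] unfolding label_small_def by blast
    ultimately show False by simp
  qed
  then show ?thesis using F fin by blast
qed

text \<open>The point and its approximation lie in the simplex of one common face, which is
  convex.\<close>

lemma label_homotopy_in_realization:
  assumes fin: "\<And>F. F \<in> \<Delta> \<Longrightarrow> finite F" and sm: "label_small lab \<Delta> q \<sigma>"
    and t: "t \<in> standard_simplex q" and s: "0 \<le> s" "s \<le> 1"
  shows "label_homotopy lab q \<sigma> s t \<in> realization_points \<Delta>"
proof -
  obtain F where F: "F \<in> \<Delta>" "finite F" "\<And>i. 0 \<le> \<sigma> t i" "\<And>i. i \<notin> F \<Longrightarrow> \<sigma> t i = 0" "(\<Sum>i\<in>F. \<sigma> t i) = 1"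
    "\<And>l. l \<le> q \<Longrightarrow> lab (\<sigma> (corner l)) \<in> F"
    using label_small_face[OF fin sm t] by blast
  have t0: "0 \<le> t l" for l using t by (simp add: standard_simplex_def)
  have l0: "0 \<le> label_simplex lab q \<sigma> t i" for i
    unfolding label_simplex_eq[OF t] by (rule sum_nonneg) (use t0 in auto)
  have lF: "label_simplex lab q \<sigma> t i = 0" if "i \<notin> F" for i
    unfolding label_simplex_eq[OF t] by (rule sum.neutral) (use F(6) that in auto)
  have "(\<Sum>i\<in>F. label_homotopy lab q \<sigma> s t i) = (1 - s) * (\<Sum>i\<in>F. \<sigma> t i) + s * (\<Sum>i\<in>F. label_simplex lab q \<sigma> t i)"
    by (simp add: label_homotopy_def sum.distrib sum_distrib_left)
  also have "\<dots> = 1" using F(5) label_simplex_sum[OF t, of lab \<sigma> F] F by simp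
  finally have 1: "(\<Sum>i\<in>F. label_homotopy lab q \<sigma> s t i) = 1" .
  moreover have "0 \<le> label_homotopy lab q \<sigma> s t i" for i
    using F(3) l0 s by (simp add: label_homotopy_def)
  moreover have "label_homotopy lab q \<sigma> s t i = 0" if "i \<notin> F" for i
    using F(4)[OF that] lF[OF that] by (simp add: label_homotopy_def)
  ultimately show ?thesis using F(1) unfolding realization_points_def by blast
qed

lemma continuous_on_coordinate [continuous_intros]:
  "continuous_on S (\<lambda>x :: nat \<Rightarrow> real. x i)"
  by (rule continuous_on_product_then_coordinatewise) (rule continuous_on_id)

lemma singular_simplex_prism:
  assumes fin: "\<And>F. F \<in> \<Delta> \<Longrightarrow> finite F" and sm: "label_small lab \<Delta> q \<sigma>" and i: "i \<le> q"
  shows "singular_simplex (Suc q) (geometric_realization \<Delta>) (prism (label_homotopy lab) q i \<sigma>)"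
  unfolding singular_simplex_realization
proof (intro conjI)
  let ?S = "standard_simplex (Suc q)"
  have contD: "continuous_on ?S (degeneracy i)"
    unfolding degeneracy_def
  proof (rule continuous_on_coordinatewise_then_product)
    show "continuous_on ?S (\<lambda>x. if j < i then x j else if j = i then x i + x (Suc i) else x (Suc j))" for j
      by (cases "j < i"; cases "j = i") (auto intro!: continuous_intros)
  qed
  have "continuous_on (standard_simplex q) \<sigma>" using sm by (simp add: label_small_def singular_simplex_realization)
  then have "continuous_on ?S (\<lambda>x. \<sigma> (degeneracy i x))"
    by (rule continuous_on_compose2[OF _ contD]) (use degeneracy_in_standard_simplex i in blast)
  then have 1: "continuous_on ?S (\<lambda>x. \<sigma> (degeneracy i x) j)" for j
    by (rule continuous_on_product_then_coordinatewise)
  have dc: "continuous_on ?S (\<lambda>x. degeneracy i x l)" for l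
    by (rule continuous_on_product_then_coordinatewise[OF contD])
  have "continuous_on ?S (\<lambda>x. \<Sum>l\<le>q. if j = lab (\<sigma> (corner l)) then degeneracy i x l else 0)" for j
  proof (rule continuous_on_sum)
    show "continuous_on ?S (\<lambda>x. if j = lab (\<sigma> (corner l)) then degeneracy i x l else 0)" for l
      by (cases "j = lab (\<sigma> (corner l))") (simp_all add: dc)
  qed
  then have 2: "continuous_on ?S (\<lambda>x. label_simplex lab q \<sigma> (degeneracy i x) j)" for j
    by (rule continuous_on_eq) (simp add: label_simplex_eq[OF degeneracy_in_standard_simplex[OF _ i]])
  have "continuous_on ?S (\<lambda>x. label_homotopy lab q \<sigma> (1 - (\<Sum>j\<le>i. x j)) (degeneracy i x))"
    unfolding label_homotopy_def
    by (rule continuous_on_coordinatewise_then_product) (intro continuous_intros 1 2)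
  then show "continuous_on ?S (prism (label_homotopy lab) q i \<sigma>)"
    by (rule continuous_on_eq) (simp add: prism_def)
  show "prism (label_homotopy lab) q i \<sigma> \<in> ?S \<rightarrow> realization_points \<Delta>"
  proof
    fix x assume x: "x \<in> ?S"
    show "prism (label_homotopy lab) q i \<sigma> x \<in> realization_points \<Delta>"
      using label_homotopy_in_realization[OF fin sm degeneracy_in_standard_simplex[OF x i], of "1 - (\<Sum>j\<le>i. x j)"]
        partial_sum_standard_simplex[OF x, of "{..i}"] x by (simp add: prism_def)
  qed
qed (simp add: prism_def)

text \<open>The prism chain over c bounds the difference, since the prism over the boundary of a
  cycle vanishes. The formula is linear in c and only has to be checked on small simplices.\<close>

lemma homologous_label_chain:
  assumes fin: "\<And>F. F \<in> \<Delta> \<Longrightarrow> finite F" and q: "1 \<le> q"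
    and sm: "\<And>\<sigma>. \<sigma> \<in> Poly_Mapping.keys c \<Longrightarrow> label_small lab \<Delta> q \<sigma>"
    and cyc: "chain_boundary q c = 0"
  shows "homologous_rel q (geometric_realization \<Delta>) {} c (frag_extend (frag_of \<circ> label_simplex lab q) c)"
proof -
  let ?h = "label_homotopy lab"
  let ?P = "frag_extend (prism_chain ?h q)"
  have "singular_chain (Suc q) (geometric_realization \<Delta>) (?P c) \<and> chain_boundary (Suc q) (?P c)
      = frag_extend (frag_of \<circ> label_simplex lab q) c - c - frag_extend (prism_chain ?h (q - 1)) (chain_boundary q c)"
  proof (rule frag_induction[of c "Collect (label_small lab \<Delta> q)"])
    show "Poly_Mapping.keys c \<subseteq> Collect (label_small lab \<Delta> q)" using sm by blast
  next
    fix \<sigma> assume "\<sigma> \<in> Collect (label_small lab \<Delta> q)"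
    then have sm\<sigma>: "label_small lab \<Delta> q \<sigma>" by simp
    \<comment> \<open>Wall 0 is at time 1, and wall q + 1 is at time 0 because barycentric
      coordinates add up to 1.\<close>
    have "prism_wall ?h q 0 \<sigma> = label_simplex lab q \<sigma>"
      by (rule ext) (auto simp: prism_wall_def label_homotopy_def label_simplex_def affine_simplex_def
          oriented_simplex_def)
    moreover have "prism_wall ?h q (Suc q) \<sigma> = \<sigma>"
    proof
      fix x
      show "prism_wall ?h q (Suc q) \<sigma> x = \<sigma> x"
      proof (cases "x \<in> standard_simplex q")
        case True
        then have "(\<Sum>j<Suc q. x j) = 1" by (simp add: standard_simplex_def lessThan_Suc_atMost)
        then show ?thesis using True by (simp add: prism_wall_def label_homotopy_def)
      next
        case False
        moreover have "\<sigma> \<in> extensional (standard_simplex q)"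
          using sm\<sigma> by (simp add: label_small_def singular_simplex_realization)
        ultimately show ?thesis by (simp add: prism_wall_def extensional_def)
      qed
    qed
    moreover have "singular_chain (Suc q) (geometric_realization \<Delta>) (prism_chain ?h q \<sigma>)"
      unfolding prism_chain_def
      by (intro singular_chain_sum singular_chain_cmul)
        (use singular_simplex_prism[OF fin sm\<sigma>] in \<open>simp add: singular_chain_of\<close>)
    ultimately show "singular_chain (Suc q) (geometric_realization \<Delta>) (?P (frag_of \<sigma>)) \<and>
        chain_boundary (Suc q) (?P (frag_of \<sigma>)) = frag_extend (frag_of \<circ> label_simplex lab q) (frag_of \<sigma>)
        - frag_of \<sigma> - frag_extend (prism_chain ?h (q - 1)) (chain_boundary q (frag_of \<sigma>))"
      by (simp only: frag_extend_of chain_boundary_prism_chain[OF face_natural_label_homotopy q] o_apply simp_thms)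
  next
    fix a b
    let ?Q = "\<lambda>c. singular_chain (Suc q) (geometric_realization \<Delta>) (?P c) \<and> chain_boundary (Suc q) (?P c)
      = frag_extend (frag_of \<circ> label_simplex lab q) c - c - frag_extend (prism_chain ?h (q - 1)) (chain_boundary q c)"
    assume "?Q a" "?Q b"
    then show "?Q (a - b)"
      by (simp add: frag_extend_diff singular_chain_diff chain_boundary_diff)
  qed simp
  then have "singular_relboundary q (geometric_realization \<Delta>) {} (frag_extend (frag_of \<circ> label_simplex lab q) c - c)"
    unfolding singular_boundary using cyc by (intro exI[of _ "?P c"]) simp
  then show ?thesis
    using homologous_rel_sym unfolding homologous_rel_def by blast
qed

text \<open>The labels turn the singular cycle into a simplicial one, whose coefficients are also
  those of the subdivided label chain with respect to subdivided faces. By \<open>nocycle\<close>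
  they vanish, so that chain is literally 0.\<close>

theorem singular_cycle_imp_boundary:
  assumes cx: "simplicial_complex_on n \<Delta>" and q: "1 \<le> q"
    and nocycle: "\<And>z :: nat set \<Rightarrow> int. \<lbrakk>\<And>B. z B \<noteq> 0 \<Longrightarrow> B \<in> \<Delta> \<and> card B = Suc q;
      \<And>B. B \<subseteq> {1..n} \<Longrightarrow> card B = q \<Longrightarrow> koszul_boundary n (\<lambda>_. 1) z B = 0\<rbrakk> \<Longrightarrow> z = (\<lambda>_. 0)"
    and c: "singular_relcycle q (geometric_realization \<Delta>) {} c"
  shows "singular_relboundary q (geometric_realization \<Delta>) {} c"
proof -
  let ?X = "geometric_realization \<Delta>"
  have sub: "F \<subseteq> {1..n}" if "F \<in> \<Delta>" for F using cx that by (auto simp: simplicial_complex_on_def)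
  have fin: "finite F" if "F \<in> \<Delta>" for F using finite_subset[OF sub[OF that]] by simp
  \<comment> \<open>At most n coordinates are nonzero and they add up to 1, so one of them is at
    least 1/n.\<close>
  define lab where "lab x = (SOME i. i \<in> {1..n} \<and> 1 / n \<le> x i)" for x :: "nat \<Rightarrow> real"
  have lab: "lab x \<in> {1..n} \<and> 1 / n \<le> x (lab x)" if x: "x \<in> realization_points \<Delta>" for x
  proof -
    obtain F where F: "F \<in> \<Delta>" "\<forall>i. i \<notin> F \<longrightarrow> x i = 0" "(\<Sum>i\<in>F. x i) = 1"
      using x unfolding realization_points_def by blast
    have "\<exists>i. i \<in> {1..n} \<and> 1 / n \<le> x i"
    proof (rule ccontr)
      assume *: "\<not> ?thesis"
      have ne: "{1..n} \<noteq> {}" using sub[OF F(1)] F(3) by (cases "F = {}") auto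
      have "(\<Sum>i\<in>F. x i) = (\<Sum>i\<in>{1..n}. x i)"
        by (rule sum.mono_neutral_left) (use sub[OF F(1)] F(2) in auto)
      also have "\<dots> < (\<Sum>i\<in>{1..n}. 1 / n)" by (rule sum_strict_mono) (use * ne in auto)
      also have "\<dots> = 1" using ne by simp
      finally show False using F(3) by simp
    qed
    then show ?thesis unfolding lab_def by (rule someI_ex)
  qed
  \<comment> \<open>Two points of one such set differ by less than 1/n in each coordinate, so a
    coordinate of at least 1/n at one point stays positive at the other.\<close>
  define U where "U x = {y \<in> realization_points \<Delta>. \<forall>i\<in>{1..n}. \<bar>y i - x i\<bar> < 1 / (2 * n)}" for x
  have openU: "openin ?X (U x)" for x
  proof -
    have "open {y :: nat \<Rightarrow> real. \<bar>y i - x i\<bar> < 1 / (2 * n)}" for i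
      by (intro open_Collect_less continuous_intros)
    then have "open (\<Inter>i\<in>{1..n}. {y :: nat \<Rightarrow> real. \<bar>y i - x i\<bar> < 1 / (2 * n)})" by (intro open_INT) auto
    moreover have "U x = realization_points \<Delta> \<inter> (\<Inter>i\<in>{1..n}. {y :: nat \<Rightarrow> real. \<bar>y i - x i\<bar> < 1 / (2 * n)})"
      by (auto simp: U_def)
    ultimately show ?thesis unfolding geometric_realization_eq openin_open by blast
  qed
  have cover: "topspace ?X \<subseteq> \<Union>(U ` realization_points \<Delta>)"
  proof
    fix x assume "x \<in> topspace ?X"
    then have x: "x \<in> realization_points \<Delta>" by (simp add: geometric_realization_eq)
    then have "0 < n" using lab[OF x] by auto
    then have "x \<in> U x" using x by (simp add: U_def)
    then show "x \<in> \<Union>(U ` realization_points \<Delta>)" using x by blast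
  qed
  obtain c' where c': "singular_relcycle q ?X {} c'" "homologous_rel q ?X {} c c'"
    "\<And>f. f \<in> Poly_Mapping.keys c' \<Longrightarrow> \<exists>V \<in> U ` realization_points \<Delta>. f \<in> standard_simplex q \<rightarrow> V"
    by (rule small_homologous_rel_relcycle_exists[OF _ cover c]) (use openU in auto)
  have cyc: "singular_chain q ?X c'" "chain_boundary q c' = 0"
    using c'(1) by (simp_all add: singular_cycle)
  have small: "label_small lab \<Delta> q \<sigma>" if \<sigma>: "\<sigma> \<in> Poly_Mapping.keys c'" for \<sigma>
    unfolding label_small_def
  proof (intro conjI ballI)
    show "singular_simplex q ?X \<sigma>" using cyc(1) \<sigma> by (auto simp: singular_chain_def)
    fix a b assume ab: "a \<in> standard_simplex q" "b \<in> standard_simplex q"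
    obtain x where x: "\<sigma> \<in> standard_simplex q \<rightarrow> U x" using c'(3)[OF \<sigma>] by blast
    then have "\<sigma> a \<in> U x" "\<sigma> b \<in> U x" using ab by auto
    moreover have "lab (\<sigma> b) \<in> {1..n} \<and> 1 / n \<le> \<sigma> b (lab (\<sigma> b))"
      using \<open>\<sigma> b \<in> U x\<close> by (intro lab) (simp add: U_def)
    ultimately have "\<bar>\<sigma> a (lab (\<sigma> b)) - x (lab (\<sigma> b))\<bar> < 1 / (2 * n)"
      "\<bar>\<sigma> b (lab (\<sigma> b)) - x (lab (\<sigma> b))\<bar> < 1 / (2 * n)" "1 / n \<le> \<sigma> b (lab (\<sigma> b))"
      unfolding U_def by blast+
    moreover have "1 / (2 * n) + 1 / (2 * n) = 1 / real n" by (simp add: field_simps)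
    ultimately show "0 < \<sigma> a (lab (\<sigma> b))" by linarith
  qed
  define W where "W = corner_labels lab q"
  have labels: "set (W \<sigma>) \<in> \<Delta>" if \<sigma>: "\<sigma> \<in> Poly_Mapping.keys c'" for \<sigma>
  proof -
    obtain F where F: "F \<in> \<Delta>" "\<And>l. l \<le> q \<Longrightarrow> lab (\<sigma> (corner l)) \<in> F"
      using label_small_face[OF fin small[OF \<sigma>] corner_in_standard_simplex[of 0 q]] by blast
    have "set (W \<sigma>) \<subseteq> F" using F(2) by (auto simp: W_def corner_labels_def simp del: upt_Suc)
    then show ?thesis using cx F(1) by (auto simp: simplicial_complex_on_def)
  qed
  \<comment> \<open>This is the simplicial chain of the labels, with orientation signs and with
    degenerate label simplices counted as 0.\<close>
  define z where "z A = frag_lin (\<lambda>\<sigma>. wedge_list (W \<sigma>) A) c'" for A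
  have z0: "z = (\<lambda>_. 0)"
  proof (rule nocycle)
    fix A assume "z A \<noteq> 0"
    have "\<exists>\<sigma>\<in>Poly_Mapping.keys c'. wedge_list (W \<sigma>) A \<noteq> 0"
    proof (rule ccontr)
      assume "\<not> ?thesis"
      then have "z A = 0" unfolding z_def frag_lin_def by (intro sum.neutral) auto
      then show False using \<open>z A \<noteq> 0\<close> by simp
    qed
    then obtain \<sigma> where \<sigma>: "\<sigma> \<in> Poly_Mapping.keys c'" "wedge_list (W \<sigma>) A \<noteq> 0" by blast
    have len: "length (W \<sigma>) = Suc q" by (simp add: W_def)
    have "A = set (W \<sigma>)" "card A = length (W \<sigma>)" using wedge_list_nonzero[OF \<sigma>(2)] by blast+
    then show "A \<in> \<Delta> \<and> card A = Suc q" using labels[OF \<sigma>(1)] unfolding len by blast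
  next
    \<comment> \<open>Taking labels commutes with boundaries, so the boundary of z comes from that
      of c', which is 0.\<close>
    fix A :: "nat set" assume A: "A \<subseteq> {1..n}" "card A = q"
    then have fA: "finite A" using finite_subset by blast
    have "koszul_boundary n (\<lambda>_. 1) z A
        = frag_lin (\<lambda>\<sigma>. koszul_boundary n (\<lambda>_. 1) (wedge_list (W \<sigma>)) A) c'"
      unfolding z_def frag_lin_def koszul_boundary_sum koszul_boundary_mult ..
    also have "\<dots> = frag_lin (\<lambda>\<sigma>. \<Sum>k\<le>q. (-1) ^ k *
        wedge_list (corner_labels lab (q - 1) (singular_face q k \<sigma>)) A) c'"
      unfolding frag_lin_def
    proof (rule sum.cong[OF refl])
      fix \<sigma> assume "\<sigma> \<in> Poly_Mapping.keys c'"
      then have "set (W \<sigma>) \<subseteq> {1..n}" using labels sub by blast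
      from koszul_boundary_wedge_list[OF this fA]
      have "koszul_boundary n (\<lambda>_. 1) (wedge_list (W \<sigma>)) A
          = (\<Sum>k\<le>q. (-1) ^ k * wedge_list (corner_labels lab (q - 1) (singular_face q k \<sigma>)) A)"
        using corner_labels_face[OF q] by (simp add: W_def lessThan_Suc_atMost)
      then show "poly_mapping.lookup c' \<sigma> * koszul_boundary n (\<lambda>_. 1) (wedge_list (W \<sigma>)) A
          = poly_mapping.lookup c' \<sigma> * (\<Sum>k\<le>q. (-1) ^ k *
            wedge_list (corner_labels lab (q - 1) (singular_face q k \<sigma>)) A)" by simp
    qed
    also have "\<dots> = frag_lin (\<lambda>\<sigma>. wedge_list (corner_labels lab (q - 1) \<sigma>) A) (chain_boundary q c')"
      by (rule frag_lin_chain_boundary[symmetric]) (use q in simp)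
    also have "\<dots> = 0" by (simp add: cyc)
    finally show "koszul_boundary n (\<lambda>_. 1) z A = 0" .
  qed
  let ?R = "frag_extend (frag_of \<circ> label_simplex lab q) c'"
  have hR: "homologous_rel q ?X {} c' ?R"
    by (rule homologous_label_chain[OF fin q small cyc(2)])
  then have cR: "singular_relcycle q ?X {} ?R"
    using homologous_rel_singular_relcycle c'(1) by blast
  have "singular_subdivision q ?R = 0"
  proof -
    have "simplicial_chain q (realization_points \<Delta>) ?R"
    proof -
      have "simplicial_simplex q (realization_points \<Delta>) (label_simplex lab q \<sigma>)" if "\<sigma> \<in> Poly_Mapping.keys c'" for \<sigma>
        unfolding simplicial_simplex
      proof
        have "label_homotopy lab q \<sigma> 1 t = label_simplex lab q \<sigma> t" for t by (simp add: label_homotopy_def)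
        then show "label_simplex lab q \<sigma> ` standard_simplex q \<subseteq> realization_points \<Delta>"
          using label_homotopy_in_realization[OF fin small[OF that], of _ 1] by auto
        show "\<exists>l. label_simplex lab q \<sigma> = oriented_simplex q l"
          by (auto simp: label_simplex_def affine_simplex_def)
      qed
      then show ?thesis
        unfolding simplicial_chain_def using keys_frag_extend[of "frag_of \<circ> label_simplex lab q" c']
        by fastforce
    qed
    \<comment> \<open>On affine simplices both subdivisions agree, and the simplicial one alternates
      in the vertices.\<close>
    then have "singular_subdivision q ?R = simplicial_subdivision q ?R"
      by (rule singular_subdivision_simplicial_simplex)
    also have "\<dots> = frag_extend (\<lambda>\<sigma>. subdivided (map corner (W \<sigma>))) c'"
      unfolding frag_extend_def
      by (simp add: simplicial_subdivision_sum simplicial_subdivision_cmul subdivided_def label_simplex_def W_def)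
    also have "\<dots> = (\<Sum>\<sigma>\<in>Poly_Mapping.keys c'. \<Sum>B\<in>Pow {1..n}. frag_cmul (poly_mapping.lookup c' \<sigma> * wedge_list (W \<sigma>) B)
        (subdivided (map corner (sorted_list_of_set B))))"
      unfolding frag_extend_def
    proof (rule sum.cong[OF refl])
      fix \<sigma> assume "\<sigma> \<in> Poly_Mapping.keys c'"
      then have w: "set (W \<sigma>) \<subseteq> {1..n}" using labels sub by blast
      have "alternating (\<lambda>w. subdivided (map corner w))"
        using alternating_subdivided unfolding alternating_def map_append list.map by blast
      from alternating_eq_sum_wedge_list[OF this w]
      show "frag_cmul (poly_mapping.lookup c' \<sigma>) (subdivided (map corner (W \<sigma>)))
          = (\<Sum>B\<in>Pow {1..n}. frag_cmul (poly_mapping.lookup c' \<sigma> * wedge_list (W \<sigma>) B)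
              (subdivided (map corner (sorted_list_of_set B))))"
        by (simp add: frag_cmul_sum)
    qed
    also have "\<dots> = (\<Sum>B\<in>Pow {1..n}. frag_cmul (z B) (subdivided (map corner (sorted_list_of_set B))))"
    proof (subst sum.swap, rule sum.cong[OF refl])
      fix B
      show "(\<Sum>\<sigma>\<in>Poly_Mapping.keys c'. frag_cmul (poly_mapping.lookup c' \<sigma> * wedge_list (W \<sigma>) B)
          (subdivided (map corner (sorted_list_of_set B)))) =
        frag_cmul (z B) (subdivided (map corner (sorted_list_of_set B)))"
        unfolding z_def frag_lin_def
        by (rule poly_mapping_eqI) (simp add: lookup_sum sum_distrib_right)
    qed
    also have "\<dots> = 0" by (simp add: z0)
    finally show ?thesis .
  qed
  \<comment> \<open>A cycle is homologous to its subdivision, which is 0 here.\<close>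
  then have "homologous_rel q ?X {} 0 ?R"
    using homologous_rel_singular_subdivision[OF cR] by simp
  then have "homologous_rel q ?X {} c 0"
    using hR c'(2) by (meson homologous_rel_sym homologous_rel_trans)
  then show ?thesis by (simp add: homologous_rel_def)
qed

section \<open>Triangulated spheres\<close>

lemma continuous_on_Min:
  fixes f :: "'i \<Rightarrow> 'a::topological_space \<Rightarrow> real"
  assumes "finite I" "I \<noteq> {}" "\<And>i. i \<in> I \<Longrightarrow> continuous_on S (f i)"
  shows "continuous_on S (\<lambda>x. Min ((\<lambda>i. f i x) ` I))"
  using assms
proof (induction I rule: finite_ne_induct)
  case (insert j I)
  have "continuous_on S (\<lambda>x. min (f j x) (Min ((\<lambda>i. f i x) ` I)))"
    by (intro continuous_on_min insert) (use insert in auto)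
  then show ?case using insert by simp
qed simp

definition sphere_set :: "nat \<Rightarrow> (nat \<Rightarrow> real) set" where
  "sphere_set k = {x. (\<Sum>i\<le>k. (x i)\<^sup>2) = 1 \<and> (\<forall>i>k. x i = 0)}"

lemma nsphere_eq: "nsphere k = top_of_set (sphere_set k)"
  by (simp add: nsphere sphere_set_def euclidean_product_topology)

lemma Euclidean_space_eq: "Euclidean_space n = top_of_set {x. \<forall>i\<ge>n. x i = 0}"
  by (simp add: Euclidean_space_def euclidean_product_topology)

lemma boundary_simplex_points:
  "x \<in> realization_points (boundary_simplex d) \<longleftrightarrow>
     (\<forall>i. 0 \<le> x i) \<and> (\<forall>i>d. x i = 0) \<and> (\<Sum>i\<le>d. x i) = 1 \<and> (\<exists>i\<le>d. x i = 0)" (is "?L \<longleftrightarrow> ?R")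
proof
  assume ?L
  then obtain F where F: "F \<subset> {0..d}" "\<forall>i. i \<notin> F \<longrightarrow> x i = 0" "(\<Sum>i\<in>F. x i) = 1" "\<forall>i. 0 \<le> x i"
    unfolding realization_points_def boundary_simplex_def by blast
  have "(\<Sum>i\<in>F. x i) = (\<Sum>i\<le>d. x i)"
    by (rule sum.mono_neutral_left) (use F in auto)
  moreover obtain i where "i \<le> d" "i \<notin> F" using psubset_imp_ex_mem[OF F(1)] by auto
  moreover have "x i = 0" if "d < i" for i using F(1,2) that by force
  ultimately show ?R using F by auto
next
  assume R: ?R
  then obtain i where i: "i \<le> d" "x i = 0" by blast
  have "(\<Sum>i\<in>{0..d} - {i}. x i) = (\<Sum>i\<le>d. x i)"
    by (rule sum.mono_neutral_left) (use i in auto)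
  then have "(\<Sum>i\<in>{0..d} - {i}. x i) = 1" using R by simp
  moreover have "{0..d} - {i} \<subset> {0..d}" 
  proof -
    have "i \<in> {0..d}" using i(1) by simp
    then show ?thesis by blast
  qed
  moreover have "\<forall>j. j \<notin> {0..d} - {i} \<longrightarrow> x j = 0"
  proof (intro allI impI)
    fix j assume "j \<notin> {0..d} - {i}"
    then have "j = i \<or> d < j" by auto
    then show "x j = 0" using R i(2) by blast
  qed
  moreover have "\<forall>i. 0 \<le> x i" using R by blast
  ultimately show ?L unfolding realization_points_def boundary_simplex_def by blast
qed

text \<open>Radial projection from the barycentre. Only the first \<open>k + 1\<close> barycentric coordinates are
  used; for the inverse the last one is recovered from the fact that the coordinates, shifted by
  those of the barycentre, add up to \<open>0\<close>.\<close>

lemma boundary_simplex_homeomorphic_nsphere: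
  "geometric_realization (boundary_simplex (Suc k)) homeomorphic_space nsphere k"
proof -
  let ?P = "realization_points (boundary_simplex (Suc k))" and ?S = "sphere_set k"
  \<comment> \<open>This is each of the k + 2 barycentric coordinates of the barycentre.\<close>
  define b :: real where "b = 1 / (k + 2)"
  have b: "0 < b" "(k + 2) * b = 1" by (auto simp: b_def)
  define N where "N x = sqrt (\<Sum>i\<le>k. (x i - b)\<^sup>2)" for x :: "nat \<Rightarrow> real"
  define \<phi> where "\<phi> x = (\<lambda>i. if i \<le> k then (x i - b) / N x else 0)" for x
  define e where "e u i = (if i \<le> k then u i else - (\<Sum>j\<le>k. u j))" for u :: "nat \<Rightarrow> real" and i :: nat
  define m where "m u = Min ((\<lambda>i. e u i) ` {..Suc k})" for u
  \<comment> \<open>The ray from the barycentre in direction \<open>e u\<close> leaves the simplex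
    when its least coordinate reaches 0, at parameter - b / m u.\<close>
  define \<psi> where "\<psi> u = (\<lambda>i. if i \<le> Suc k then b - b * e u i / m u else 0)" for u
  \<comment> \<open>If the first k + 1 coordinates equal b, so does the last one, and x would be the
    barycentre.\<close>
  have N0: "0 < N x" if x: "x \<in> ?P" for x
  proof (rule ccontr)
    assume "\<not> ?thesis"
    moreover have "0 \<le> (\<Sum>i\<le>k. (x i - b)\<^sup>2)" by (simp add: sum_nonneg)
    ultimately have "(\<Sum>i\<le>k. (x i - b)\<^sup>2) = 0" by (simp add: N_def)
    then have *: "x i = b" if "i \<le> k" for i using that by (subst (asm) sum_nonneg_eq_0_iff) auto
    then have "(\<Sum>i\<le>k. x i) = (k + 1) * b" by simp
    moreover have "(\<Sum>i\<le>k. x i) + x (Suc k) = 1" using x by (simp add: boundary_simplex_points)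
    ultimately have "x (Suc k) = b" using b(2) by (simp add: algebra_simps)
    then show False using * x b(1) by (auto simp: boundary_simplex_points le_Suc_eq)
  qed
  have e\<phi>: "e (\<phi> x) i = (x i - b) / N x" if x: "x \<in> ?P" and i: "i \<le> Suc k" for x i
  proof (cases "i \<le> k")
    case True
    then show ?thesis by (simp add: e_def \<phi>_def)
  next
    case False
    then have i: "i = Suc k" using i by simp
    have s: "(\<Sum>j\<le>k. x j) + x (Suc k) = 1" using x by (simp add: boundary_simplex_points)
    have "e (\<phi> x) i = - ((\<Sum>j\<le>k. x j) - (k + 1) * b) / N x"
      unfolding e_def \<phi>_def by (simp add: i sum_subtractf diff_divide_distrib flip: sum_divide_distrib)
    also have "- ((\<Sum>j\<le>k. x j) - (k + 1) * b) = x (Suc k) - b"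
      using s b(2) by (simp add: algebra_simps)
    finally show ?thesis by (simp add: i)
  qed
  have m\<phi>: "m (\<phi> x) = - b / N x" if x: "x \<in> ?P" for x
    unfolding m_def
  proof (rule Min_eqI)
    fix y assume "y \<in> e (\<phi> x) ` {..Suc k}"
    then obtain i where "i \<le> Suc k" "y = (x i - b) / N x" using e\<phi>[OF x] by auto
    moreover have "0 \<le> x i" using x by (simp add: boundary_simplex_points)
    ultimately show "- b / N x \<le> y" using N0[OF x] divide_right_mono[of "- b" "x i - b" "N x"] by simp
  next
    obtain i where "i \<le> Suc k" "x i = 0" using x by (auto simp: boundary_simplex_points)
    then show "- b / N x \<in> e (\<phi> x) ` {..Suc k}" using e\<phi>[OF x, of i] by (intro image_eqI[of _ _ i]) auto
  qed simp
  have e0: "(\<Sum>i\<le>Suc k. e u i) = 0" for u by (simp add: e_def)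
  have mle: "m u \<le> e u i" if "i \<le> Suc k" for u i
    unfolding m_def by (rule Min_le) (use that in auto)
  have m0: "m u < 0" if u: "u \<in> ?S" for u
  proof (rule ccontr)
    assume "\<not> ?thesis"
    then have nn: "0 \<le> e u i" if "i \<le> Suc k" for i
      using mle[OF that, of u] by simp
    have z: "e u i = 0" if "i \<le> Suc k" for i
      using e0[of u] nn that sum_nonneg_eq_0_iff[of "{..Suc k}" "e u"] by (simp del: sum.atMost_Suc)
    have "u i = 0" if "i \<le> k" for i using z[of i] that by (simp add: e_def)
    then show False using u by (simp add: sphere_set_def)
  qed
  have "\<phi> x \<in> ?S" if x: "x \<in> ?P" for x
  proof -
    have "(\<Sum>i\<le>k. (\<phi> x i)\<^sup>2) = (\<Sum>i\<le>k. (x i - b)\<^sup>2) / (N x)\<^sup>2"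
      by (simp add: \<phi>_def power_divide sum_divide_distrib)
    also have "\<dots> = 1" using N0[OF x] by (simp add: N_def sum_nonneg)
    finally show ?thesis by (simp add: sphere_set_def \<phi>_def)
  qed
  moreover have "\<psi> u \<in> ?P" if u: "u \<in> ?S" for u
    unfolding boundary_simplex_points
  proof (intro conjI allI impI)
    show "0 \<le> \<psi> u i" for i
    proof (cases "i \<le> Suc k")
      case True
      then have "e u i / m u \<le> 1" using mle[OF True, of u] m0[OF u] by (simp add: divide_le_eq)
      then have "b * (e u i / m u) \<le> b * 1" using b(1) by (intro mult_left_mono) auto
      then show ?thesis by (simp add: \<psi>_def)
    qed (simp add: \<psi>_def)
    have "(\<Sum>i\<le>Suc k. \<psi> u i) = (\<Sum>i\<le>Suc k. b - b / m u * e u i)"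
      by (rule sum.cong) (auto simp: \<psi>_def)
    also have "\<dots> = (k + 2) * b - b / m u * (\<Sum>i\<le>Suc k. e u i)"
      by (simp add: sum_subtractf sum_distrib_left algebra_simps)
    also have "\<dots> = 1" unfolding e0 using b by simp
    finally show "(\<Sum>i\<le>Suc k. \<psi> u i) = 1" .
    have "m u \<in> e u ` {..Suc k}" unfolding m_def by (rule Min_in) auto
    then obtain i where "i \<le> Suc k" "e u i = m u" by auto
    then show "\<exists>i\<le>Suc k. \<psi> u i = 0" using m0[OF u] by (intro exI[of _ i]) (simp add: \<psi>_def)
  qed (simp add: \<psi>_def)
  moreover have "\<psi> (\<phi> x) = x" if x: "x \<in> ?P" for x
  proof
    fix i
    show "\<psi> (\<phi> x) i = x i"
    proof (cases "i \<le> Suc k")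
      case True
      then show ?thesis
        using e\<phi>[OF x True] m\<phi>[OF x] N0[OF x] b(1) by (simp add: \<psi>_def)
    next
      case False
      then show ?thesis using x by (simp add: \<psi>_def boundary_simplex_points)
    qed
  qed
  moreover have "\<phi> (\<psi> u) = u" if u: "u \<in> ?S" for u
  proof
    fix i
    have "(\<Sum>i\<le>k. (\<psi> u i - b)\<^sup>2) = (\<Sum>i\<le>k. (b / m u)\<^sup>2 * (u i)\<^sup>2)"
      by (rule sum.cong) (auto simp: \<psi>_def e_def power_mult_distrib power_divide)
    also have "\<dots> = (b / m u)\<^sup>2" using u by (simp add: sphere_set_def flip: sum_distrib_left)
    finally have "N (\<psi> u) = - b / m u"
      using b(1) m0[OF u] by (simp add: N_def real_sqrt_abs divide_less_0_iff)
    then show "\<phi> (\<psi> u) i = u i"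
      using u b(1) m0[OF u] by (auto simp: \<phi>_def \<psi>_def e_def sphere_set_def)
  qed
  moreover have "continuous_on ?P \<phi>"
  proof (rule continuous_on_coordinatewise_then_product)
    have cN: "continuous_on ?P N" unfolding N_def by (intro continuous_intros)
    show "continuous_on ?P (\<lambda>x. \<phi> x i)" for i
    proof (cases "i \<le> k")
      case True
      have "continuous_on ?P (\<lambda>x. (x i - b) / N x)"
        by (intro continuous_intros cN) (use N0 in force)
      then show ?thesis using True by (simp add: \<phi>_def)
    qed (simp add: \<phi>_def)
  qed
  moreover have "continuous_on ?S \<psi>"
  proof (rule continuous_on_coordinatewise_then_product)
    have ce: "continuous_on ?S (\<lambda>u. e u i)" for i
      unfolding e_def by (cases "i \<le> k") (auto intro!: continuous_intros)
    have cm: "continuous_on ?S m" unfolding m_def by (rule continuous_on_Min) (use ce in auto)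
    show "continuous_on ?S (\<lambda>u. \<psi> u i)" for i
    proof (cases "i \<le> Suc k")
      case True
      have "continuous_on ?S (\<lambda>u. b - b * e u i / m u)"
        by (intro continuous_intros cm ce) (use m0 in force)
      then show ?thesis using True by (simp add: \<psi>_def)
    qed (simp add: \<psi>_def)
  qed
  ultimately have "homeomorphic_maps (geometric_realization (boundary_simplex (Suc k))) (nsphere k) \<phi> \<psi>"
    unfolding homeomorphic_maps_def geometric_realization_eq nsphere_eq
    by (auto simp: continuous_map_in_subtopology)
  then show ?thesis unfolding homeomorphic_space_def by blast
qed

text \<open>Stretching a point by a factor slightly above 1 stays in the open set but leaves the
  sphere.\<close>

lemma openin_subset_sphere_empty:
  assumes O: "openin (Euclidean_space (Suc k)) U" and sub: "U \<subseteq> sphere_set k"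
  shows "U = {}"
proof (rule ccontr)
  assume "U \<noteq> {}"
  then obtain p where p: "p \<in> U" by blast
  obtain T where T: "open T" "U = {x. \<forall>i\<ge>Suc k. x i = 0} \<inter> T"
    using O unfolding Euclidean_space_eq openin_open by blast
  have "open ((\<lambda>t i. t * p i) -` T)"
    by (rule open_vimage[OF T(1)]) (intro continuous_on_coordinatewise_then_product continuous_intros)
  moreover have "1 \<in> (\<lambda>t i. t * p i) -` T" using p T by simp
  ultimately obtain \<epsilon> where \<epsilon>: "0 < \<epsilon>" "ball 1 \<epsilon> \<subseteq> (\<lambda>t i. t * p i) -` T"
    by (meson open_contains_ball)
  let ?t = "1 + \<epsilon> / 2"
  have "?t \<in> ball 1 \<epsilon>" using \<epsilon>(1) by (simp add: dist_norm)
  then have "(\<lambda>i. ?t * p i) \<in> T" using \<epsilon>(2) by blast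
  moreover have ps: "(\<Sum>i\<le>k. (p i)\<^sup>2) = 1" "\<forall>i>k. p i = 0" using p sub by (auto simp: sphere_set_def)
  ultimately have "(\<lambda>i. ?t * p i) \<in> sphere_set k" using T sub by auto
  then have "?t\<^sup>2 * (\<Sum>i\<le>k. (p i)\<^sup>2) = 1"
    by (simp add: sphere_set_def power_mult_distrib sum_distrib_left)
  then have "?t\<^sup>2 = 1" using ps by simp
  moreover have "1 < ?t\<^sup>2" using \<epsilon>(1) by (simp add: one_less_power)
  ultimately show False by simp
qed

text \<open>The interior of a (k + 1)-dimensional face is an open set of (k + 1)-space. Its
  injective continuous image in the k-sphere would be open by invariance of domain, which is
  impossible.\<close>

lemma card_face_le_of_sphere:
  assumes fin: "\<And>F. F \<in> \<Delta> \<Longrightarrow> finite F" and cl: "\<And>F G. F \<in> \<Delta> \<Longrightarrow> G \<subseteq> F \<Longrightarrow> G \<in> \<Delta>"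
    and f: "continuous_on (realization_points \<Delta>) f" "inj_on f (realization_points \<Delta>)" "f \<in> realization_points \<Delta> \<rightarrow> sphere_set k"
    and "F \<in> \<Delta>"
  shows "card F \<le> Suc k"
proof (rule ccontr)
  assume "\<not> ?thesis"
  then obtain G where G: "G \<subseteq> F" "card G = Suc (Suc k)"
    by (metis not_less_eq_eq obtain_subset_with_card_n)
  then have G\<Delta>: "G \<in> \<Delta>" and fG: "finite G" using cl fin \<open>F \<in> \<Delta>\<close> by blast+
  obtain g where g: "bij_betw g G {..<Suc (Suc k)}"
    using fG G(2) by (metis ex_bij_betw_finite_nat atLeast0LessThan)
  \<comment> \<open>The first k + 1 barycentric coordinates are free, and the last is recovered from
    the total 1.\<close>
  define \<iota> where "\<iota> y = (\<lambda>v. if v \<in> G then (if g v \<le> k then y (g v) else 1 - (\<Sum>i\<le>k. y i)) else 0)"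
    for y :: "nat \<Rightarrow> real"
  define U where "U = {y :: nat \<Rightarrow> real. \<forall>i\<ge>Suc k. y i = 0} \<inter> ((\<Inter>i\<le>k. {y. 0 < y i}) \<inter> {y. (\<Sum>i\<le>k. y i) < 1})"
  have "open ((\<Inter>i\<le>k. {y :: nat \<Rightarrow> real. 0 < y i}) \<inter> {y. (\<Sum>i\<le>k. y i) < 1})"
    by (intro open_Int open_INT ballI open_Collect_less continuous_intros) auto
  then have oU: "openin (Euclidean_space (Suc k)) U" unfolding Euclidean_space_eq openin_open U_def by blast
  have \<iota>P: "\<iota> y \<in> realization_points \<Delta>" if y: "y \<in> U" for y
  proof -
    have "(\<Sum>v\<in>G. \<iota> y v) = (\<Sum>v\<in>G. (\<lambda>i. if i \<le> k then y i else 1 - (\<Sum>i\<le>k. y i)) (g v))"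
      by (rule sum.cong) (auto simp: \<iota>_def)
    also have "\<dots> = (\<Sum>i<Suc (Suc k). if i \<le> k then y i else 1 - (\<Sum>i\<le>k. y i))"
      by (rule sum.reindex_bij_betw[OF g])
    also have "\<dots> = 1" by (simp add: lessThan_Suc_atMost)
    finally have "(\<Sum>v\<in>G. \<iota> y v) = 1" .
    moreover have "0 \<le> \<iota> y v" for v using y by (auto simp: U_def \<iota>_def intro: less_imp_le)
    moreover have "\<iota> y v = 0" if "v \<notin> G" for v using that by (simp add: \<iota>_def)
    ultimately show ?thesis using G\<Delta> unfolding realization_points_def by blast
  qed
  have "inj_on \<iota> U"
  proof (rule inj_onI, rule ext)
    fix y y' i assume yy: "y \<in> U" "y' \<in> U" "\<iota> y = \<iota> y'"
    show "y i = y' i"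
    proof (cases "i \<le> k")
      case True
      then have "i \<in> {..<Suc (Suc k)}" by simp
      then obtain v where v: "v \<in> G" "g v = i" using bij_betw_imp_surj_on[OF g] by (metis imageE)
      then show ?thesis using fun_cong[OF yy(3), of v] True by (simp add: \<iota>_def)
    next
      case False
      then show ?thesis using yy by (simp add: U_def)
    qed
  qed
  then have inj: "inj_on (f \<circ> \<iota>) U"
    by (rule comp_inj_on) (use f(2) \<iota>P in \<open>auto intro: inj_on_subset\<close>)
  have "continuous_on U \<iota>"
  proof (rule continuous_on_coordinatewise_then_product)
    show "continuous_on U (\<lambda>y. \<iota> y v)" for v
      unfolding \<iota>_def by (cases "v \<in> G"; cases "g v \<le> k") (auto intro!: continuous_intros)
  qed
  then have cont: "continuous_on U (f \<circ> \<iota>)"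
    by (rule continuous_on_compose) (rule continuous_on_subset[OF f(1)], use \<iota>P in auto)
  have im: "(f \<circ> \<iota>) ` U \<subseteq> sphere_set k" using f(3) \<iota>P by auto
  have "openin (Euclidean_space (Suc k)) ((f \<circ> \<iota>) ` U)"
  proof (rule invariance_of_domain_Euclidean_space[OF oU _ inj])
    have "topspace (subtopology (Euclidean_space (Suc k)) U) = U"
      by (auto simp: topspace_Euclidean_space U_def)
    then show "continuous_map (subtopology (Euclidean_space (Suc k)) U) (Euclidean_space (Suc k)) (f \<circ> \<iota>)"
      unfolding cm_Euclidean_space_iff_continuous_on using cont im
      by (auto simp: topspace_Euclidean_space sphere_set_def Suc_le_eq)
  qed
  then have "(f \<circ> \<iota>) ` U = {}" using openin_subset_sphere_empty im by blast
  \<comment> \<open>The barycentre shows that U is nonempty.\<close>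
  moreover have "(\<lambda>i. if i \<le> k then 1 / (k + 2) else 0) \<in> U"
    by (auto simp: U_def divide_less_eq)
  ultimately show False by blast
qed

text \<open>The radial extension \<open>G\<close> of \<open>f\<close> to Euclidean space is injective, so by invariance of domain its
  image is a neighbourhood of the origin and meets every ray.\<close>

lemma sphere_injective_imp_surjective:
  assumes f: "continuous_on (sphere_set k) f" "inj_on f (sphere_set k)" "f \<in> sphere_set k \<rightarrow> sphere_set k"
  shows "f ` sphere_set k = sphere_set k"
proof -
  define E :: "(nat \<Rightarrow> real) set" where "E = {x. \<forall>i\<ge>Suc k. x i = 0}"
  define r where "r x = sqrt (\<Sum>i\<le>k. (x i)\<^sup>2)" for x :: "nat \<Rightarrow> real"
  \<comment> \<open>At the origin the factor \<open>r x\<close> is 0, so G is 0 there whatever value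
    f takes.\<close>
  define G where "G x = (\<lambda>i. r x * f (\<lambda>j. x j / r x) i)" for x
  have r0: "0 \<le> r x" for x by (simp add: r_def sum_nonneg)
  have r_eq_0: "r x = 0 \<longleftrightarrow> (\<forall>i\<le>k. x i = 0)" for x
    by (simp add: r_def sum_nonneg_eq_0_iff) auto
  have r_scale: "r (\<lambda>i. t * x i) = \<bar>t\<bar> * r x" for t x
    by (simp add: r_def power_mult_distrib real_sqrt_mult flip: sum_distrib_left)
  have unit: "(\<lambda>j. x j / r x) \<in> sphere_set k" if "x \<in> E" "r x \<noteq> 0" for x
  proof -
    have "(\<Sum>i\<le>k. (x i / r x)\<^sup>2) = (\<Sum>i\<le>k. (x i)\<^sup>2) / (r x)\<^sup>2"
      by (simp add: power_divide sum_divide_distrib)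
    also have "(\<Sum>i\<le>k. (x i)\<^sup>2) = (r x)\<^sup>2" by (simp add: r_def sum_nonneg)
    finally show ?thesis using that by (simp add: sphere_set_def E_def)
  qed
  have fS: "f (\<lambda>j. x j / r x) \<in> sphere_set k" if "x \<in> E" "r x \<noteq> 0" for x
    using unit[OF that] f(3) by blast
  have rS: "r u = 1" if "u \<in> sphere_set k" for u using that by (simp add: sphere_set_def r_def)
  have rG: "r (G x) = r x" if "x \<in> E" for x
  proof (cases "r x = 0")
    case True
    then have "G x = (\<lambda>_. 0)" by (simp add: G_def)
    then show ?thesis using True by (simp add: r_def[of "\<lambda>_. 0"])
  next
    case False
    have "r (G x) = \<bar>r x\<bar> * r (f (\<lambda>j. x j / r x))" unfolding G_def by (rule r_scale)
    then show ?thesis using rS[OF fS[OF that False]] r0[of x] by simp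
  qed
  have bound: "\<bar>u i\<bar> \<le> 1" if "u \<in> sphere_set k" for u i
  proof (cases "i \<le> k")
    case True
    then have "(u i)\<^sup>2 \<le> (\<Sum>i\<le>k. (u i)\<^sup>2)" by (intro member_le_sum) auto
    then show ?thesis using that by (simp add: sphere_set_def abs_square_le_1)
  next
    case False
    then show ?thesis using that by (simp add: sphere_set_def)
  qed
  have cr: "continuous_on A r" for A unfolding r_def by (intro continuous_intros)
  have G_E: "G \<in> E \<rightarrow> E"
  proof
    fix x assume x: "x \<in> E"
    show "G x \<in> E"
      using fS[OF x] by (cases "r x = 0") (auto simp: E_def G_def sphere_set_def)
  qed
  have "continuous_on E G"
  proof (rule continuous_on_coordinatewise_then_product)
    fix i
    show "continuous_on E (\<lambda>x. G x i)"
      unfolding continuous_on_eq_continuous_within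
    proof
      fix x assume x: "x \<in> E"
      show "continuous (at x within E) (\<lambda>x. G x i)"
      proof (cases "r x = 0")
        case True
        \<comment> \<open>Continuity at the origin holds because G does not increase any coordinate
          beyond the radius.\<close>
        have "((\<lambda>y. G y i) \<longlongrightarrow> 0) (at x within E)"
        proof (rule Lim_null_comparison)
          show "\<forall>\<^sub>F y in at x within E. norm (G y i) \<le> r y"
            unfolding eventually_at_filter
          proof (intro always_eventually allI impI)
            fix y assume y: "y \<in> E"
            show "norm (G y i) \<le> r y"
            proof (cases "r y = 0")
              case False
              have "\<bar>r y\<bar> * \<bar>f (\<lambda>j. y j / r y) i\<bar> \<le> \<bar>r y\<bar> * 1"
                by (intro mult_left_mono bound fS y False) auto
              then show ?thesis using r0[of y] by (simp add: G_def abs_mult)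
            qed (simp add: G_def)
          qed
          have "(r \<longlongrightarrow> r x) (at x within E)" using cr[of E] x by (simp add: continuous_on_def)
          then show "(r \<longlongrightarrow> 0) (at x within E)" using True by simp
        qed
        then show ?thesis using True by (simp add: continuous_within G_def)
      next
        case False
        define T where "T = {y. r y \<noteq> 0}"
        have "open T" unfolding T_def by (intro open_Collect_neq cr continuous_intros)
        have "continuous_on (E \<inter> T) (\<lambda>y j. y j / r y)"
          by (intro continuous_on_coordinatewise_then_product continuous_intros cr) (auto simp: T_def)
        then have "continuous_on (E \<inter> T) (\<lambda>y. f (\<lambda>j. y j / r y))"
          by (rule continuous_on_compose2[OF f(1)]) (use unit in \<open>auto simp: T_def\<close>)
        then have "continuous_on (E \<inter> T) (\<lambda>y. f (\<lambda>j. y j / r y) i)"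
          by (rule continuous_on_product_then_coordinatewise)
        then have "continuous_on (E \<inter> T) (\<lambda>y. G y i)"
          unfolding G_def by (intro continuous_intros cr)
        then have "continuous (at x within (E \<inter> T)) (\<lambda>y. G y i)"
          using x False by (simp add: continuous_on_eq_continuous_within T_def)
        moreover have "at x within (E \<inter> T) = at x within E"
          by (rule at_within_nhd[OF _ \<open>open T\<close>]) (use False in \<open>auto simp: T_def\<close>)
        ultimately show ?thesis by simp
      qed
    qed
  qed
  moreover have "inj_on G E"
  proof (rule inj_onI)
    fix x y assume xy: "x \<in> E" "y \<in> E" "G x = G y"
    have req: "r x = r y" using rG[OF xy(1)] rG[OF xy(2)] xy(3) by simp
    show "x = y"
    proof (cases "r x = 0")
      case True
      have x0: "\<forall>i\<le>k. x i = 0" using True r_eq_0[of x] by simp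
      have y0: "\<forall>i\<le>k. y i = 0" using True req r_eq_0[of y] by simp
      show ?thesis
      proof
        fix i show "x i = y i" using x0 y0 xy(1,2) by (cases "i \<le> k") (simp_all add: E_def)
      qed
    next
      case False
      have "f (\<lambda>j. x j / r x) i = f (\<lambda>j. y j / r y) i" for i
        using fun_cong[OF xy(3), of i] False req by (simp add: G_def)
      then have "f (\<lambda>j. x j / r x) = f (\<lambda>j. y j / r y)" by (rule ext)
      then have eq: "(\<lambda>j. x j / r x) = (\<lambda>j. y j / r y)"
        using inj_onD[OF f(2)] unit xy False req by metis
      show ?thesis
      proof
        fix i show "x i = y i" using fun_cong[OF eq, of i] False req by simp
      qed
    qed
  qed
  ultimately have "openin (Euclidean_space (Suc k)) (G ` E)"
  proof (intro invariance_of_domain_Euclidean_space)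
    show "openin (Euclidean_space (Suc k)) E" by (simp add: Euclidean_space_eq E_def)
    assume "continuous_on E G"
    then show "continuous_map (subtopology (Euclidean_space (Suc k)) E) (Euclidean_space (Suc k)) G"
      unfolding cm_Euclidean_space_iff_continuous_on using G_E
      by (simp add: topspace_Euclidean_space E_def)
  qed
  then obtain T where T: "open T" "G ` E = E \<inter> T"
    unfolding Euclidean_space_eq openin_open E_def by blast
  show ?thesis
  proof
    show "f ` sphere_set k \<subseteq> sphere_set k" using f(3) by blast
    show "sphere_set k \<subseteq> f ` sphere_set k"
    proof
      fix y assume y: "y \<in> sphere_set k"
      have "open ((\<lambda>t i. t * y i) -` T)"
        by (rule open_vimage[OF T(1)]) (intro continuous_on_coordinatewise_then_product continuous_intros)
      moreover have "0 \<in> (\<lambda>t i. t * y i) -` T"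
      proof -
        have "G (\<lambda>_. 0) = (\<lambda>_. 0)" by (simp add: G_def r_def)
        moreover have "(\<lambda>_. 0) \<in> E" by (simp add: E_def)
        ultimately have "(\<lambda>_. 0) \<in> G ` E" by (metis imageI)
        then show ?thesis using T by simp
      qed
      ultimately obtain \<epsilon> where \<epsilon>: "0 < \<epsilon>" "ball 0 \<epsilon> \<subseteq> (\<lambda>t i. t * y i) -` T"
        by (meson open_contains_ball)
      \<comment> \<open>A small positive multiple of y lies in the image of G. Its preimage has the
        same radius, and dividing by the radius gives a preimage of y under f.\<close>
      let ?t = "\<epsilon> / 2"
      have "?t \<in> ball 0 \<epsilon>" using \<epsilon>(1) by (simp add: dist_norm)
      then have "(\<lambda>i. ?t * y i) \<in> T" using \<epsilon>(2) by blast
      moreover have "(\<lambda>i. ?t * y i) \<in> E" using y by (simp add: E_def sphere_set_def)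
      ultimately obtain x where x: "x \<in> E" "G x = (\<lambda>i. ?t * y i)" using T(2) by (metis IntI imageE)
      have rt: "r x = ?t" using rG[OF x(1)] rS[OF y] \<epsilon>(1) unfolding x(2) r_scale by simp
      have "f (\<lambda>j. x j / r x) i = y i" for i
      proof -
        have "r x * f (\<lambda>j. x j / r x) i = ?t * y i" using fun_cong[OF x(2), of i] by (simp only: G_def)
        then have *: "r x * f (\<lambda>j. x j / r x) i = r x * y i" by (simp only: rt)
        have "r x \<noteq> 0" using rt \<epsilon>(1) by simp
        then show ?thesis using * by (rule mult_left_cancel[THEN iffD1])
      qed
      then have "f (\<lambda>j. x j / r x) = y" by (rule ext)
      then show "y \<in> f ` sphere_set k" using unit[OF x(1)] rt \<epsilon>(1) by force
    qed
  qed
qed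

section \<open>Geochordality\<close>

lemma trivial_homology_group:
  assumes "\<And>c. singular_relcycle p X {} c \<Longrightarrow> singular_relboundary p X {} c"
  shows "trivial_group (homology_group (int p) X)"
proof -
  interpret group "homology_group (int p) X" by simp
  have "homologous_rel_set p X {} c = singular_relboundary_set p X {}" if "singular_relcycle p X {} c" for c
  proof (rule Set.set_eqI)
    fix d
    have c: "singular_relboundary p X {} c" using assms that .
    have "singular_relboundary p X {} (c - d) \<longleftrightarrow> singular_relboundary p X {} d"
    proof
      assume "singular_relboundary p X {} (c - d)"
      from singular_relboundary_diff[OF c this] show "singular_relboundary p X {} d" by simp
    qed (rule singular_relboundary_diff[OF c])
    then show "d \<in> homologous_rel_set p X {} c \<longleftrightarrow> d \<in> singular_relboundary_set p X {}"
      by (simp add: homologous_rel_def)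
  qed
  then show ?thesis
    unfolding trivial_group_subset carrier_relative_homology_group one_relative_homology_group by blast
qed

text \<open>In positive degree reduced and unreduced homology agree, so the reduced homology of
  spheres decides the matter.\<close>

lemma nontrivial_homology_of_sphere:
  assumes "X homeomorphic_space nsphere k" "1 \<le> k"
  shows "\<not> trivial_group (homology_group (int k) X)"
proof -
  have "homology_group (int k) X \<cong> reduced_homology_group (int k) (nsphere k)"
    using homeomorphic_space_imp_isomorphic_reduced_homology_groups[OF assms(1), of "int k"] assms(2)
    by (simp add: un_reduced_homology_group)
  then show ?thesis
    using isomorphic_group_triviality[of "homology_group (int k) X" "reduced_homology_group (int k) (nsphere k)"]
      trivial_reduced_homology_group_nsphere[of "int k" k] by simp
qed

text \<open>The boundary of the simplex on A is itself a k-sphere, so its inclusion becomes an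
  injective continuous self-map of the k-sphere and is therefore onto. Hence both complexes have the
  same points, and comparing barycentres shows that they have the same faces.\<close>

lemma eq_boundary_of_simplex:
  assumes f: "homeomorphic_maps (geometric_realization \<Delta>) (nsphere k) f f'"
    and fin: "\<And>F. F \<in> \<Delta> \<Longrightarrow> finite F"
    and A: "card A = Suc (Suc k)" "A \<notin> \<Delta>" "\<And>B. B \<subset> A \<Longrightarrow> B \<in> \<Delta>"
  shows "\<Delta> = {B. B \<subset> A}"
proof -
  have fA: "finite A" using A(1) by (metis card.infinite nat.distinct(1))
  obtain g where g: "bij_betw g A {..<Suc (Suc k)}"
    using fA A(1) by (metis ex_bij_betw_finite_nat atLeast0LessThan)
  have cf: "continuous_on (realization_points \<Delta>) f" "f \<in> realization_points \<Delta> \<rightarrow> sphere_set k"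
    and inv: "\<And>x. x \<in> realization_points \<Delta> \<Longrightarrow> f' (f x) = x"
    using f by (auto simp: homeomorphic_maps_def geometric_realization_eq nsphere_eq continuous_map_in_subtopology)
  obtain \<phi> \<psi> where \<psi>: "homeomorphic_maps (geometric_realization (boundary_simplex (Suc k))) (nsphere k) \<phi> \<psi>"
    using boundary_simplex_homeomorphic_nsphere unfolding homeomorphic_space_def by blast
  let ?P = "realization_points (boundary_simplex (Suc k))"
  have c\<psi>: "continuous_on (sphere_set k) \<psi>" "\<psi> \<in> sphere_set k \<rightarrow> ?P"
    and inv\<psi>: "\<And>u. u \<in> sphere_set k \<Longrightarrow> \<phi> (\<psi> u) = u"
    using \<psi> by (auto simp: homeomorphic_maps_def geometric_realization_eq nsphere_eq continuous_map_in_subtopology)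
  \<comment> \<open>This transports the standard boundary sphere to the vertices in A along
    g.\<close>
  define \<rho> where "\<rho> x = (\<lambda>v. if v \<in> A then x (g v) else 0)" for x :: "nat \<Rightarrow> real"
  have gA: "g v \<le> Suc k" if "v \<in> A" for v
    using bij_betwE[OF g] that by auto
  have g_ex: "\<exists>v\<in>A. g v = i" if "i \<le> Suc k" for i
  proof -
    have "i \<in> g ` A" using that bij_betw_imp_surj_on[OF g] by simp
    then show ?thesis by blast
  qed
  have \<rho>: "\<rho> x \<in> realization_points {B. B \<subset> A}" if x: "x \<in> ?P" for x
  proof -
    obtain i where i: "i \<le> Suc k" "x i = 0" using x by (auto simp: boundary_simplex_points)
    obtain v where v: "v \<in> A" "g v = i" using g_ex[OF i(1)] by blast
    have "(\<Sum>w\<in>A - {v}. \<rho> x w) = (\<Sum>w\<in>A. \<rho> x w)"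
      by (rule sum.mono_neutral_left) (use fA v i in \<open>auto simp: \<rho>_def\<close>)
    also have "\<dots> = (\<Sum>w\<in>A. x (g w))" by (rule sum.cong) (auto simp: \<rho>_def)
    also have "\<dots> = (\<Sum>i<Suc (Suc k). x i)" by (rule sum.reindex_bij_betw[OF g])
    also have "\<dots> = 1" using x unfolding lessThan_Suc_atMost boundary_simplex_points by blast
    finally have "(\<Sum>w\<in>A - {v}. \<rho> x w) = 1" .
    moreover have "\<forall>w. 0 \<le> \<rho> x w" using x by (simp add: \<rho>_def boundary_simplex_points)
    moreover have "\<forall>w. w \<notin> A - {v} \<longrightarrow> \<rho> x w = 0" using v i by (auto simp: \<rho>_def)
    moreover have "A - {v} \<in> {B. B \<subset> A}" using v by blast
    ultimately show ?thesis unfolding realization_points_def by blast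
  qed
  have sub: "realization_points {B. B \<subset> A} \<subseteq> realization_points \<Delta>" using A(3) unfolding realization_points_def by blast
  have \<rho>\<Delta>: "\<rho> (\<psi> u) \<in> realization_points \<Delta>" if "u \<in> sphere_set k" for u
    using \<rho> sub c\<psi>(2) that by blast
  define h where "h = f \<circ> (\<rho> \<circ> \<psi>)"
  have "h ` sphere_set k = sphere_set k"
  proof (rule sphere_injective_imp_surjective)
    have "continuous_on ?P \<rho>"
    proof (rule continuous_on_coordinatewise_then_product)
      show "continuous_on ?P (\<lambda>x. \<rho> x v)" for v
        unfolding \<rho>_def by (cases "v \<in> A") (simp_all add: continuous_on_coordinate)
    qed
    then have "continuous_on (sphere_set k) (\<rho> \<circ> \<psi>)"
      by (intro continuous_on_compose[OF c\<psi>(1)]) (rule continuous_on_subset, use c\<psi>(2) in auto)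
    then show "continuous_on (sphere_set k) h"
      unfolding h_def by (rule continuous_on_compose) (rule continuous_on_subset[OF cf(1)], use \<rho>\<Delta> in auto)
    show "h \<in> sphere_set k \<rightarrow> sphere_set k" using cf(2) \<rho>\<Delta> by (auto simp: h_def)
    show "inj_on h (sphere_set k)"
    proof (rule inj_onI)
      fix u v assume uv: "u \<in> sphere_set k" "v \<in> sphere_set k" "h u = h v"
      have "f' (f (\<rho> (\<psi> u))) = f' (f (\<rho> (\<psi> v)))" using uv(3) by (simp add: h_def)
      then have eq: "\<rho> (\<psi> u) = \<rho> (\<psi> v)" using inv \<rho>\<Delta> uv by simp
      have uP: "\<psi> u \<in> ?P" "\<psi> v \<in> ?P" using c\<psi>(2) uv by auto
      have "\<psi> u i = \<psi> v i" for i
      proof (cases "i \<le> Suc k")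
        case True
        then obtain w where "w \<in> A" "g w = i" using g_ex by blast
        then show ?thesis using fun_cong[OF eq, of w] by (simp add: \<rho>_def)
      next
        case False
        then show ?thesis using uP by (simp add: boundary_simplex_points)
      qed
      then have "\<psi> u = \<psi> v" by (rule ext)
      then show "u = v" using inv\<psi> uv by metis
    qed
  qed
  then have P: "x \<in> realization_points {B. B \<subset> A}" if x: "x \<in> realization_points \<Delta>" for x
  proof -
    have "f x \<in> h ` sphere_set k" using \<open>h ` sphere_set k = sphere_set k\<close> cf(2) x by blast
    then obtain u where u: "u \<in> sphere_set k" "f x = f (\<rho> (\<psi> u))" by (auto simp: h_def)
    have "f' (f x) = f' (f (\<rho> (\<psi> u)))" using u(2) by simp
    then have "x = \<rho> (\<psi> u)" using inv[OF x] inv[OF \<rho>\<Delta>[OF u(1)]] by simp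
    then show ?thesis using \<rho> c\<psi>(2) u(1) by blast
  qed
  have "F \<subset> A" if F: "F \<in> \<Delta>" for F
  proof (cases "F = {}")
    case True
    then show ?thesis using A(1) by auto
  next
    case False
    \<comment> \<open>All coordinates of the barycentre on F are positive, so any face containing it
      in its simplex contains F.\<close>
    define x where "x = (\<lambda>v. if v \<in> F then 1 / real (card F) else 0)"
    have cF: "0 < card F" using fin[OF F] False by (simp add: card_gt_0_iff)
    have "(\<Sum>v\<in>F. x v) = 1" using cF by (simp add: x_def)
    moreover have "\<forall>v. v \<notin> F \<longrightarrow> x v = 0" "\<forall>v. 0 \<le> x v" by (auto simp: x_def)
    ultimately have "x \<in> realization_points \<Delta>" using F unfolding realization_points_def by blast
    then have "x \<in> realization_points {B. B \<subset> A}" by (rule P)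
    then obtain B where B: "B \<subset> A" "\<forall>v. v \<notin> B \<longrightarrow> x v = 0"
      unfolding realization_points_def by (elim CollectE conjE bexE) (rule that)
    have "F \<subseteq> B"
    proof
      fix v assume "v \<in> F"
      then have "x v \<noteq> 0" using cF by (simp add: x_def)
      then show "v \<in> B" using B(2) by blast
    qed
    then show ?thesis using B(1) by blast
  qed
  then show ?thesis using A(3) by blast
qed

lemma boundary_combinatorially_equivalent:
  assumes "card A = Suc (Suc k)"
  shows "combinatorially_equivalent {B. B \<subset> A} (boundary_simplex (Suc k))"
proof -
  have fA: "finite A" using assms by (metis card.infinite nat.distinct(1))
  obtain g where "bij_betw g A {0..<Suc (Suc k)}"
    using fA assms by (metis ex_bij_betw_finite_nat)
  then have g: "bij_betw g A {0..Suc k}" by (simp only: atLeastLessThanSuc_atLeastAtMost)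
  have Un: "\<Union>{B. B \<subset> C} = C" if "2 \<le> card C" for C :: "nat set"
  proof
    show "C \<subseteq> \<Union>{B. B \<subset> C}"
    proof
      fix v assume "v \<in> C"
      moreover have "C \<noteq> {v}" using that by auto
      ultimately have "{v} \<subset> C" by blast
      then show "v \<in> \<Union>{B. B \<subset> C}" by blast
    qed
  qed blast
  have inj: "inj_on g A" and im: "g ` A = {0..Suc k}" using g by (auto simp: bij_betw_def)
  have "(\<lambda>F. g ` F) ` {B. B \<subset> A} = {F. F \<subset> {0..Suc k}}"
  proof (rule equalityI; rule subsetI)
    fix F assume "F \<in> (\<lambda>F. g ` F) ` {B. B \<subset> A}"
    then obtain B where "B \<subset> A" "F = g ` B" by blast
    then have "F \<subset> g ` A" using image_strict_mono[OF inj, of B] by simp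
    then show "F \<in> {F. F \<subset> {0..Suc k}}" unfolding im by (rule CollectI)
  next
    fix F assume "F \<in> {F. F \<subset> {0..Suc k}}"
    then have F: "F \<subset> g ` A" unfolding im by (rule CollectD)
    have eq: "F = g ` {v \<in> A. g v \<in> F}" using F by blast
    have "{v \<in> A. g v \<in> F} \<noteq> A"
    proof
      assume "{v \<in> A. g v \<in> F} = A"
      then have "F = g ` A" using eq by simp
      then show False using F by simp
    qed
    then have "{v \<in> A. g v \<in> F} \<in> {B. B \<subset> A}" by auto
    with eq show "F \<in> (\<lambda>F. g ` F) ` {B. B \<subset> A}" by (rule image_eqI)
  qed
  then show ?thesis
    unfolding combinatorially_equivalent_def boundary_simplex_def
    using g Un[of A] Un[of "{0..Suc k}"] assms by (intro exI[of _ g]) simp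
qed

theorem corollary141:
  fixes n :: nat and \<Delta> :: "nat set set"
  assumes "simplicial_complex_on n \<Delta>"
    and "sequentially_Cohen_Macaulay TYPE('k::field) n (alexander_dual n \<Delta>)"
  shows "geochordal \<Delta>"
  unfolding geochordal_def geometrically_chordal_def
proof (intro allI impI)
  fix k W assume "1 \<le> k \<and> int k \<le> complex_dim \<Delta>"
    and homeo: "geometric_realization (induced_subcomplex \<Delta> W) homeomorphic_space
      geometric_realization (boundary_simplex (k + 1))"
  then have k: "1 \<le> k" by simp
  \<comment> \<open>W may contain numbers outside the ground set; the subcomplexes induced on W and
    V are the same.\<close>
  define V where "V = W \<inter> {1..n}"
  let ?\<Sigma> = "induced_subcomplex \<Delta> W"
  have \<Sigma>_iff: "F \<in> ?\<Sigma> \<longleftrightarrow> F \<in> \<Delta> \<and> F \<subseteq> V" for F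
    using assms(1) by (auto simp: induced_subcomplex_def simplicial_complex_on_def V_def)
  have down: "G \<in> \<Delta>" if "F \<in> \<Delta>" "G \<subseteq> F" for F G
    using assms(1) that by (auto simp: simplicial_complex_on_def)
  have cx: "simplicial_complex_on n ?\<Sigma>"
    unfolding simplicial_complex_on_def
  proof (intro conjI ballI allI impI)
    show "?\<Sigma> \<subseteq> Pow {1..n}" using \<Sigma>_iff V_def by blast
    show "G \<in> ?\<Sigma>" if "F \<in> ?\<Sigma>" "G \<subseteq> F" for F G using that down[of F G] \<Sigma>_iff by blast
  qed
  have fin: "finite F" if "F \<in> ?\<Sigma>" for F
  proof -
    have "F \<subseteq> {1..n}" using that by (auto simp: \<Sigma>_iff V_def)
    then show ?thesis by (rule finite_subset) simp
  qed
  have sph: "geometric_realization ?\<Sigma> homeomorphic_space nsphere k"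
    using homeomorphic_space_trans[OF homeo] boundary_simplex_homeomorphic_nsphere[of k] by simp
  then obtain f f' where f: "homeomorphic_maps (geometric_realization ?\<Sigma>) (nsphere k) f f'"
    unfolding homeomorphic_space_def by blast
  have cf: "continuous_on (realization_points ?\<Sigma>) f" "f \<in> realization_points ?\<Sigma> \<rightarrow> sphere_set k"
    and inv: "\<And>x. x \<in> realization_points ?\<Sigma> \<Longrightarrow> f' (f x) = x"
    using f by (auto simp: homeomorphic_maps_def geometric_realization_eq nsphere_eq continuous_map_in_subtopology)
  have inj: "inj_on f (realization_points ?\<Sigma>)" by (rule inj_on_inverseI[of _ f'], rule inv)
  have down': "G \<in> ?\<Sigma>" if "F \<in> ?\<Sigma>" "G \<subseteq> F" for F G
    using that down[of F G] \<Sigma>_iff by blast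
  have dim: "card F \<le> Suc k" if "F \<in> ?\<Sigma>" for F
    by (rule card_face_le_of_sphere[OF fin down' cf(1) inj cf(2) that])
  show "combinatorially_equivalent ?\<Sigma> (boundary_simplex (k + 1))"
  \<comment> \<open>The negation of this case is the assumption \<open>nomin\<close> of
    \<open>sequentially_Cohen_Macaulay_dual_no_cycle\<close>.\<close>
  proof (cases "\<exists>A\<subseteq>V. card A = Suc (Suc k) \<and> A \<notin> \<Delta> \<and> (\<forall>B. B \<subset> A \<longrightarrow> B \<in> \<Delta>)")
    case True
    then obtain A where A: "A \<subseteq> V" "card A = Suc (Suc k)" "A \<notin> \<Delta>" "\<forall>B. B \<subset> A \<longrightarrow> B \<in> \<Delta>"
      by (elim exE conjE) (rule that)
    have "?\<Sigma> = {B. B \<subset> A}"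
    proof (rule eq_boundary_of_simplex[OF f fin A(2)])
      show "A \<notin> ?\<Sigma>" using A(3) \<Sigma>_iff by blast
      show "B \<in> ?\<Sigma>" if "B \<subset> A" for B using A(1,4) \<Sigma>_iff that by blast
    qed
    then show ?thesis using boundary_combinatorially_equivalent[OF A(2)] by simp
  next
    case False
    \<comment> \<open>The absence of cycles over the field excludes integral cycles, hence kills the
      homology in degree k, which is nonzero for a k-sphere.\<close>
    have "trivial_group (homology_group (int k) (geometric_realization ?\<Sigma>))"
    proof (rule trivial_homology_group, rule singular_cycle_imp_boundary[OF cx k])
      fix z :: "nat set \<Rightarrow> int"
      assume z: "\<And>B. z B \<noteq> 0 \<Longrightarrow> B \<in> ?\<Sigma> \<and> card B = Suc k"
        "\<And>B. B \<subseteq> {1..n} \<Longrightarrow> card B = k \<Longrightarrow> koszul_boundary n (\<lambda>_. 1) z B = 0"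
      show "z = (\<lambda>_. 0)"
      proof (rule ccontr)
        assume "z \<noteq> (\<lambda>_. 0)"
        then obtain B0 where B0: "z B0 \<noteq> 0" by blast
        let ?S = "{B \<in> ?\<Sigma>. card B = Suc k}" and ?T = "{B. B \<subseteq> {1..n} \<and> card B = k}"
        have fS: "finite ?S"
          by (rule finite_subset[of _ "Pow {1..n}"]) (auto simp: \<Sigma>_iff V_def)
        have "\<exists>y :: nat set \<Rightarrow> 'k. (\<exists>B. y B \<noteq> 0) \<and> (\<forall>B. y B \<noteq> 0 \<longrightarrow> B \<in> ?S) \<and>
            (\<forall>B\<in>?T. koszul_boundary n (\<lambda>_. 1) y B = 0)"
        proof (rule int_cycle_imp_field_cycle[where z = z and ?B0.0 = B0, OF fS _ B0])
          show "B \<in> ?S" if "z B \<noteq> 0" for B using z(1)[OF that] by blast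
          show "koszul_boundary n (\<lambda>_. 1) z B = 0" if "B \<in> ?T" for B using z(2)[of B] that by blast
        qed
        then obtain y :: "nat set \<Rightarrow> 'k" and B where y: "y B \<noteq> 0" "\<forall>B. y B \<noteq> 0 \<longrightarrow> B \<in> ?S"
          "\<forall>B\<in>?T. koszul_boundary n (\<lambda>_. 1) y B = 0"
          by (elim exE conjE)
        have "y B = 0"
        proof (rule sequentially_Cohen_Macaulay_dual_no_cycle[OF assms])
          show "V \<subseteq> {1..n}" by (simp add: V_def)
          show "card F \<le> Suc k" if "F \<in> \<Delta>" "F \<subseteq> V" for F using dim[of F] that by (simp add: \<Sigma>_iff)
          show "\<exists>B. B \<subset> A \<and> B \<notin> \<Delta>" if "A \<subseteq> V" "card A = Suc (Suc k)" "A \<notin> \<Delta>" for A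
            using False that by blast
          show "B \<in> \<Delta> \<and> B \<subseteq> V \<and> card B = Suc k" if "y B \<noteq> 0" for B
            using y(2) that \<Sigma>_iff by blast
          show "koszul_boundary n (\<lambda>_. 1) y B = 0" if "B \<subseteq> {1..n}" "card B = k" for B
            using y(3) that by blast
        qed
        then show False using y(1) by simp
      qed
    qed
    then show ?thesis using nontrivial_homology_of_sphere[OF sph k] by blast
  qed
qed

end
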